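(* Let $E$ be a Banach space, $H$ a separable Hilbert space, and $A:D(A)\subset E\to E$ the generator of a $C_0$-semigroup $S(t)$ on $E$ with $\|S(t)\|_{\mathcal L(E)}\le Me^{-\omega t}$ for all $t\ge 0$, for some $M\ge 1$, $\omega>0$. Let $Q$ be a linear operator with domain $H$ such that $S(t)Q\in\mathcal L(H,E)$ for every $t>0$ and such that for every $t>0$ the stochastic convolution $Z(t)=\int_0^t S(t-s)Q\,dw(s)$ is an $E$-valued Gaussian random variable. Let $F:E\to E$ be uniformly continuous on bounded subsets of $E$ with $F(0)=0$, and suppose there is $\lambda>0$ such that for all $x,y\in D(A)$ there is $x^\star\in\partial|x-y|_E$ with $\langle A(x-y)+F(x)-F(y),x^\star\rangle_{E,E^\star}\le-\lambda|x-y|_E$. Then for every $r\in\mathbb R$ the set $$K_{-\infty}(r)=\left\{\varphi\in C((-\infty,0];E):\lim_{t\to-\infty}|\varphi(t)|_E=0,\ I_{-\infty,0}(\varphi)\le r\right\}$$ is compact in the topology of uniform convergence on bounded intervals.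
   Context: $w(t)=\sum_{k\ge1}\beta_k(t)e_k$ (formal sum) is a cylindrical Wiener process on $H$: $\{e_k\}$ is a complete orthonormal system of $H$ and $\{\beta_k\}$ are independent one-dimensional Brownian motions. $Q$ need not be bounded into $E$; only the operators $S(t)Q\in\mathcal L(H,E)$, $t>0$, are used, with $S(s)(S(t)Q)=S(s+t)Q$. $Z(t)$ is characterized by $\langle Z(t),x^\star\rangle_{E,E^\star}=\sum_k\int_0^t\langle S(t-s)Qe_k,x^\star\rangle_{E,E^\star}d\beta_k(s)$ for $x^\star\in E^\star$. Subdifferential: $\partial|x|_E=\{x^\star\in E^\star:|x^\star|_{E^\star}=1,\ \langle x,x^\star\rangle_{E,E^\star}=|x|_E\}$. For $x\in E$, $\psi\in L^2([0,T];H)$, $X^\psi_x\in C([0,T];E)$ is the unique solution of $X^\psi_x(t)=S(t)x+\int_0^tS(t-s)F(X^\psi_x(s))ds+\int_0^tS(t-s)Q\psi(s)ds$. For $\varphi\in C([0,T];E)$, $I_{0,T}(\varphi)=\inf\{\frac12|\psi|^2_{L^2([0,T];H)}:\varphi=X^\psi_{\varphi(0)}\}$ with $\inf\emptyset=+\infty$. For $t<T$ in $\mathbb R$, $I_{t,T}(\varphi)=I_{0,T-t}(\varphi(\cdot+t))$, and $I_{-\infty,0}(\varphi)=\sup_{t<0}I_{t,0}(\varphi)$. *)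

theory Defs
  imports "HOL-Probability.Probability"
begin

section \<open>Strongly continuous semigroups\<close>

text \<open>Semigroups and the family \<open>S(t)Q\<close> are functions on all of \<open>real\<close>; only the values
  at \<open>t \<ge> 0\<close>, respectively \<open>t > 0\<close>, are ever constrained or matter.\<close>

definition c0_semigroup :: "(real \<Rightarrow> 'e::real_normed_vector \<Rightarrow>\<^sub>L 'e) \<Rightarrow> bool" where
  "c0_semigroup S \<longleftrightarrow>
     S 0 = id_blinfun \<and>
     (\<forall>s\<ge>0. \<forall>t\<ge>0. S (s + t) = S s o\<^sub>L S t) \<and>
     (\<forall>x. ((\<lambda>t. S t x) \<longlongrightarrow> x) (at_right 0))"

definition is_generator ::
  "(real \<Rightarrow> 'e::real_normed_vector \<Rightarrow>\<^sub>L 'e) \<Rightarrow> 'e set \<Rightarrow> ('e \<Rightarrow> 'e) \<Rightarrow> bool" where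
  "is_generator S D A \<longleftrightarrow>
     D = {x. \<exists>y. ((\<lambda>h. (S h x - x) /\<^sub>R h) \<longlongrightarrow> y) (at_right 0)} \<and>
     (\<forall>x\<in>D. ((\<lambda>h. (S h x - x) /\<^sub>R h) \<longlongrightarrow> A x) (at_right 0))"

definition norm_subdiff :: "'e::real_normed_vector \<Rightarrow> ('e \<Rightarrow>\<^sub>L real) set" where
  "norm_subdiff x = {xs. norm xs = 1 \<and> blinfun_apply xs x = norm x}"


section \<open>Cylindrical Wiener processes and stochastic convolutions\<close>

definition brownian_motion :: "'w measure \<Rightarrow> (real \<Rightarrow> 'w \<Rightarrow> real) \<Rightarrow> bool" where
  "brownian_motion M b \<longleftrightarrow>
     (\<forall>t\<ge>0. b t \<in> borel_measurable M) \<and>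
     (AE \<omega> in M. b 0 \<omega> = 0) \<and>
     (AE \<omega> in M. continuous_on {0..} (\<lambda>t. b t \<omega>)) \<and>
     (\<forall>s t. 0 \<le> s \<and> s < t \<longrightarrow>
        distributed M lborel (\<lambda>\<omega>. b t \<omega> - b s \<omega>) (normal_density 0 (sqrt (t - s)))) \<and>
     (\<forall>n. \<forall>\<tau>::nat \<Rightarrow> real. 0 \<le> \<tau> 0 \<and> strict_mono \<tau> \<longrightarrow>
        prob_space.indep_vars M (\<lambda>_. borel) (\<lambda>i \<omega>. b (\<tau> (Suc i)) \<omega> - b (\<tau> i) \<omega>) {..<n})"

definition complete_orthonormal :: "nat set \<Rightarrow> (nat \<Rightarrow> 'h::real_inner) \<Rightarrow> bool" where
  "complete_orthonormal K e \<longleftrightarrow>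
     (\<forall>i\<in>K. \<forall>j\<in>K. inner (e i) (e j) = (if i = j then 1 else 0)) \<and>
     closure (span (e ` K)) = UNIV"

text \<open>The formal sum of the \<open>\<beta> k\<close> times \<open>e k\<close> over \<open>k \<in> K\<close>. The index set \<open>K\<close> is infinite if
  \<open>H\<close> is infinite-dimensional and finite otherwise. Independence is independence of the whole
  paths, seen as random elements of the product space over \<open>{0..}\<close>.\<close>

definition cylindrical_wiener ::
  "'w measure \<Rightarrow> nat set \<Rightarrow> (nat \<Rightarrow> 'h::real_inner) \<Rightarrow> (nat \<Rightarrow> real \<Rightarrow> 'w \<Rightarrow> real) \<Rightarrow> bool" where
  "cylindrical_wiener M K e \<beta> \<longleftrightarrow>
     complete_orthonormal K e \<and>
     (\<forall>k\<in>K. brownian_motion M (\<beta> k)) \<and>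
     prob_space.indep_vars M (\<lambda>_. PiM {0..} (\<lambda>_. borel)) (\<lambda>k \<omega>. \<lambda>t\<in>{0..}. \<beta> k t \<omega>) K"

text \<open>Mean-square convergence, with the nonnegative integral so that no integrability side
  condition is needed.\<close>

definition L2_converges :: "'a measure \<Rightarrow> (nat \<Rightarrow> 'a \<Rightarrow> real) \<Rightarrow> ('a \<Rightarrow> real) \<Rightarrow> bool" where
  "L2_converges N g G \<longleftrightarrow>
     (\<forall>n. g n \<in> borel_measurable N) \<and> G \<in> borel_measurable N \<and>
     (\<lambda>n. \<integral>\<^sup>+ x. ennreal ((g n x - G x)\<^sup>2) \<partial>N) \<longlonglongrightarrow> 0"

text \<open>A triple \<open>(n, c, \<tau>)\<close> encodes the step function with value \<open>c i\<close> on \<open>{\<tau> i<..\<tau> (Suc i)}\<close>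
  for \<open>i < n\<close>, and \<open>0\<close> elsewhere. The Wiener integral over \<open>{0..T}\<close> of a deterministic function
  is the extension of the elementary integral by mean-square limits.\<close>

definition step_on :: "real \<Rightarrow> nat \<times> (nat \<Rightarrow> real) \<times> (nat \<Rightarrow> real) \<Rightarrow> bool" where
  "step_on T = (\<lambda>(n, c, \<tau>). 0 \<le> \<tau> 0 \<and> (\<forall>i<n. \<tau> i < \<tau> (Suc i)) \<and> \<tau> n \<le> T)"

definition step_fun :: "nat \<times> (nat \<Rightarrow> real) \<times> (nat \<Rightarrow> real) \<Rightarrow> real \<Rightarrow> real" where
  "step_fun = (\<lambda>(n, c, \<tau>) s. \<Sum>i<n. c i * indicator {\<tau> i<..\<tau> (Suc i)} s)"

definition step_integral ::
  "(real \<Rightarrow> 'w \<Rightarrow> real) \<Rightarrow> nat \<times> (nat \<Rightarrow> real) \<times> (nat \<Rightarrow> real) \<Rightarrow> 'w \<Rightarrow> real" where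
  "step_integral b = (\<lambda>(n, c, \<tau>) \<omega>. \<Sum>i<n. c i * (b (\<tau> (Suc i)) \<omega> - b (\<tau> i) \<omega>))"

definition has_wiener_integral ::
  "'w measure \<Rightarrow> (real \<Rightarrow> 'w \<Rightarrow> real) \<Rightarrow> real \<Rightarrow> (real \<Rightarrow> real) \<Rightarrow> ('w \<Rightarrow> real) \<Rightarrow> bool" where
  "has_wiener_integral M b T f Y \<longleftrightarrow>
     (\<exists>p. (\<forall>j. step_on T (p j)) \<and>
          L2_converges (restrict_space lborel {0..T}) (\<lambda>j. step_fun (p j)) f \<and>
          L2_converges M (\<lambda>j. step_integral b (p j)) Y)"

definition real_gaussian :: "'w measure \<Rightarrow> ('w \<Rightarrow> real) \<Rightarrow> bool" where
  "real_gaussian M Y \<longleftrightarrow>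
     Y \<in> borel_measurable M \<and>
     ((\<exists>m. AE \<omega> in M. Y \<omega> = m) \<or>
      (\<exists>m \<sigma>. \<sigma> > 0 \<and> distributed M lborel Y (normal_density m \<sigma>)))"

definition gaussian_rv :: "'w measure \<Rightarrow> ('w \<Rightarrow> 'e::real_normed_vector) \<Rightarrow> bool" where
  "gaussian_rv M X \<longleftrightarrow>
     X \<in> borel_measurable M \<and>
     (\<forall>xs :: 'e \<Rightarrow>\<^sub>L real. real_gaussian M (\<lambda>\<omega>. blinfun_apply xs (X \<omega>)))"

text \<open>\<open>X\<close> is the stochastic convolution at time \<open>t\<close>: tested against every functional it is the
  sum over \<open>k \<in> K\<close>, convergent in mean square, of the one-dimensional Wiener integrals.\<close>

definition stochastic_convolution ::
  "'w measure \<Rightarrow> nat set \<Rightarrow> (nat \<Rightarrow> 'h::real_inner) \<Rightarrow> (nat \<Rightarrow> real \<Rightarrow> 'w \<Rightarrow> real) \<Rightarrow>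
   (real \<Rightarrow> 'h \<Rightarrow>\<^sub>L 'e::real_normed_vector) \<Rightarrow> real \<Rightarrow> ('w \<Rightarrow> 'e) \<Rightarrow> bool" where
  "stochastic_convolution M K e \<beta> SQ t X \<longleftrightarrow>
     (\<forall>xs :: 'e \<Rightarrow>\<^sub>L real. \<exists>Y.
        (\<forall>k\<in>K. has_wiener_integral M (\<beta> k) t
                 (\<lambda>s. blinfun_apply xs (SQ (t - s) (e k))) (Y k)) \<and>
        L2_converges M (\<lambda>n \<omega>. \<Sum>k\<in>K \<inter> {..<n}. Y k \<omega>) (\<lambda>\<omega>. blinfun_apply xs (X \<omega>)))"


section \<open>The controlled equation and the action functional\<close>

text \<open>Weak (Pettis) integral. The norm of \<open>S(t)Q\<close> need not be square integrable near \<open>t = 0\<close>, so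
  the integrand \<open>S(t-s)Q\<psi>(s)\<close> need not be Bochner integrable for every square integrable \<open>\<psi>\<close>;
  like the stochastic convolution, its integral is characterised by testing against functionals.
  It agrees with the Bochner integral whenever the latter exists.\<close>

definition has_weak_integral :: "real set \<Rightarrow> (real \<Rightarrow> 'e::real_normed_vector) \<Rightarrow> 'e \<Rightarrow> bool" where
  "has_weak_integral B f y \<longleftrightarrow>
     (\<forall>xs :: 'e \<Rightarrow>\<^sub>L real.
        set_integrable lborel B (\<lambda>s. blinfun_apply xs (f s)) \<and>
        (LINT s:B|lborel. blinfun_apply xs (f s)) = blinfun_apply xs y)"

definition L2_control :: "real \<Rightarrow> (real \<Rightarrow> 'h::{real_inner, second_countable_topology}) \<Rightarrow> bool" where
  "L2_control T \<psi> \<longleftrightarrow>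
     set_borel_measurable lborel {0..T} \<psi> \<and>
     set_integrable lborel {0..T} (\<lambda>s. (norm (\<psi> s))\<^sup>2)"

text \<open>\<open>X\<close> is the solution \<open>X\<^sub>x\<^sup>\<psi>\<close> on \<open>{0..T}\<close>, that is, a continuous path solving the integral
  equation. The integrand with \<open>F\<close> is continuous, so the library integral applies to it.\<close>

definition mild_solution ::
  "(real \<Rightarrow> 'e::banach \<Rightarrow>\<^sub>L 'e) \<Rightarrow> ('e \<Rightarrow> 'e) \<Rightarrow> (real \<Rightarrow> 'h::real_inner \<Rightarrow>\<^sub>L 'e) \<Rightarrow>
   real \<Rightarrow> 'e \<Rightarrow> (real \<Rightarrow> 'h) \<Rightarrow> (real \<Rightarrow> 'e) \<Rightarrow> bool" where
  "mild_solution S F SQ T x \<psi> X \<longleftrightarrow>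
     continuous_on {0..T} X \<and>
     (\<forall>t\<in>{0..T}. \<exists>y.
        has_weak_integral {0..t} (\<lambda>s. SQ (t - s) (\<psi> s)) y \<and>
        X t = S t x + integral {0..t} (\<lambda>s. S (t - s) (F (X s))) + y)"

definition action0 ::
  "(real \<Rightarrow> 'e::banach \<Rightarrow>\<^sub>L 'e) \<Rightarrow> ('e \<Rightarrow> 'e) \<Rightarrow>
   (real \<Rightarrow> 'h::{real_inner, second_countable_topology} \<Rightarrow>\<^sub>L 'e) \<Rightarrow>
   real \<Rightarrow> (real \<Rightarrow> 'e) \<Rightarrow> ereal" where
  "action0 S F SQ T \<phi> =
     (INF \<psi> \<in> {\<psi>. L2_control T \<psi> \<and> mild_solution S F SQ T (\<phi> 0) \<psi> \<phi>}.
        ereal (1/2 * (LINT s:{0..T}|lborel. (norm (\<psi> s))\<^sup>2)))"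

definition action ::
  "(real \<Rightarrow> 'e::banach \<Rightarrow>\<^sub>L 'e) \<Rightarrow> ('e \<Rightarrow> 'e) \<Rightarrow>
   (real \<Rightarrow> 'h::{real_inner, second_countable_topology} \<Rightarrow>\<^sub>L 'e) \<Rightarrow>
   real \<Rightarrow> real \<Rightarrow> (real \<Rightarrow> 'e) \<Rightarrow> ereal" where
  "action S F SQ t T \<phi> = action0 S F SQ (T - t) (\<lambda>s. \<phi> (s + t))"

definition action_minf ::
  "(real \<Rightarrow> 'e::banach \<Rightarrow>\<^sub>L 'e) \<Rightarrow> ('e \<Rightarrow> 'e) \<Rightarrow>
   (real \<Rightarrow> 'h::{real_inner, second_countable_topology} \<Rightarrow>\<^sub>L 'e) \<Rightarrow>
   (real \<Rightarrow> 'e) \<Rightarrow> ereal" where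
  "action_minf S F SQ \<phi> = (SUP t \<in> {..<0}. action S F SQ t 0 \<phi>)"


section \<open>Continuous paths on the negative half-line\<close>

text \<open>Paths on \<open>{..0}\<close> are represented by extensional functions, so that equality of
  representatives is equality of paths.\<close>

definition neg_paths :: "(real \<Rightarrow> 'e::metric_space) set" where
  "neg_paths = {\<phi> \<in> extensional {..0}. continuous_on {..0} \<phi>}"

definition neg_paths_ball :: "(real \<Rightarrow> 'e::metric_space) \<Rightarrow> real \<Rightarrow> real \<Rightarrow> (real \<Rightarrow> 'e) set" where
  "neg_paths_ball \<phi> T \<epsilon> = {\<eta> \<in> neg_paths. \<forall>t\<in>{-T..0}. dist (\<eta> t) (\<phi> t) < \<epsilon>}"

definition local_uniform_topology :: "(real \<Rightarrow> 'e::metric_space) topology" where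
  "local_uniform_topology =
     topology (\<lambda>U. U \<subseteq> neg_paths \<and> (\<forall>\<phi>\<in>U. \<exists>T>0. \<exists>\<epsilon>>0. neg_paths_ball \<phi> T \<epsilon> \<subseteq> U))"

lemma openin_local_uniform_topology:
  "openin local_uniform_topology U \<longleftrightarrow>
     U \<subseteq> neg_paths \<and> (\<forall>\<phi>\<in>U. \<exists>T>0. \<exists>\<epsilon>>0. neg_paths_ball \<phi> T \<epsilon> \<subseteq> U)"
proof -
  let ?P = "\<lambda>U :: (real \<Rightarrow> 'a) set.
    U \<subseteq> neg_paths \<and> (\<forall>\<phi>\<in>U. \<exists>T>0. \<exists>\<epsilon>>0. neg_paths_ball \<phi> T \<epsilon> \<subseteq> U)"
  have "?P (U \<inter> V)" if U: "?P U" and V: "?P V" for U V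
  proof (intro conjI ballI)
    show "U \<inter> V \<subseteq> neg_paths" using U by blast
    fix \<phi> assume "\<phi> \<in> U \<inter> V"
    then obtain T \<epsilon> T' \<epsilon>' where *: "T > 0" "\<epsilon> > 0" "neg_paths_ball \<phi> T \<epsilon> \<subseteq> U"
      "T' > 0" "\<epsilon>' > 0" "neg_paths_ball \<phi> T' \<epsilon>' \<subseteq> V"
      using U V by blast
    have "neg_paths_ball \<phi> (max T T') (min \<epsilon> \<epsilon>') \<subseteq> neg_paths_ball \<phi> T \<epsilon> \<inter> neg_paths_ball \<phi> T' \<epsilon>'"
      by (auto simp: neg_paths_ball_def)
    then have "neg_paths_ball \<phi> (max T T') (min \<epsilon> \<epsilon>') \<subseteq> U \<inter> V" using * by blast
    moreover have "max T T' > 0" "min \<epsilon> \<epsilon>' > 0" using * by auto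
    ultimately show "\<exists>T>0. \<exists>\<epsilon>>0. neg_paths_ball \<phi> T \<epsilon> \<subseteq> U \<inter> V" by blast
  qed
  moreover have "?P (\<Union>\<K>)" if "\<forall>V\<in>\<K>. ?P V" for \<K>
  proof (intro conjI ballI)
    show "\<Union>\<K> \<subseteq> neg_paths" using that by blast
    fix \<phi> assume "\<phi> \<in> \<Union>\<K>"
    then obtain V where "V \<in> \<K>" "\<phi> \<in> V" by blast
    with that obtain T \<epsilon> where "T > 0" "\<epsilon> > 0" "neg_paths_ball \<phi> T \<epsilon> \<subseteq> V" by meson
    with \<open>V \<in> \<K>\<close> show "\<exists>T>0. \<exists>\<epsilon>>0. neg_paths_ball \<phi> T \<epsilon> \<subseteq> \<Union>\<K>" by blast
  qed
  ultimately have "istopology ?P" unfolding istopology_def by blast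
  then show ?thesis by (simp add: local_uniform_topology_def topology_inverse')
qed

lemma topspace_local_uniform_topology: "topspace local_uniform_topology = neg_paths"
proof -
  have "openin local_uniform_topology (neg_paths :: (real \<Rightarrow> 'a) set)"
    unfolding openin_local_uniform_topology
    by (auto simp: neg_paths_ball_def intro!: exI[of _ "1::real"])
  then show ?thesis
    by (metis openin_local_uniform_topology openin_subset openin_topspace subset_antisym)
qed

definition K_minf ::
  "(real \<Rightarrow> 'e::banach \<Rightarrow>\<^sub>L 'e) \<Rightarrow> ('e \<Rightarrow> 'e) \<Rightarrow>
   (real \<Rightarrow> 'h::{real_inner, second_countable_topology} \<Rightarrow>\<^sub>L 'e) \<Rightarrow>
   real \<Rightarrow> (real \<Rightarrow> 'e) set" where
  "K_minf S F SQ r =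
     {\<phi> \<in> neg_paths. ((\<lambda>t. norm (\<phi> t)) \<longlongrightarrow> 0) at_bot \<and> action_minf S F SQ \<phi> \<le> ereal r}"

end

theory Submission
  imports Defs
begin

text \<open>A path in \<open>K_minf\<close> is a drift, governed by the dissipative equation, plus the linear response
  of the noise operator to a control of bounded energy. Everything compact comes from the response.
  Since \<open>Z T\<close> is norm-bounded with positive probability, the unit ball of the dual is totally bounded
  for the variance of \<open>Z T\<close>: a large separated family would contain many almost uncorrelated
  functionals of \<open>Z T\<close>, one of which has to be large. By duality the responses on a
  bounded interval are totally bounded for the uniform norm. Dissipativity forgets the initial value
  exponentially fast, so two bounded paths on a long interval with close responses are close near its
  right end. On unit intervals the same estimate gives the uniform bound, and, since only finitely
  many unit intervals carry energy above a given level, the decay at \<open>-\<infinity>\<close> of limits. Lower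
  semicontinuity of the action follows from the parallelogram law.\<close>

section \<open>Total boundedness and square integrability\<close>

text \<open>The semigroup need not be compact, so the flow alone gives no compactness of the values
  of paths; the noise has to supply it. The norm of S(t)Q may fail to be square integrable near 0,
  so a response is reached only through scalar pairings. For these, Cauchy-Schwarz bounds the square
  of the pairing with a functional x by the energy times \<open>V T x\<close>, the variance of x
  applied to \<open>Z T\<close>. This is why all information on the noise is stated for the
  quadratic form \<open>V T\<close> on the dual ball. Its total boundedness is a second-moment
  argument with exponential densities of the Gaussian variables. On the nonlinear side two obstacles
  occur. Since \<open>C\<close> may exceed 1, a contraction estimate cannot be read off from the
  norms of \<open>S t\<close>; it has to come from the joint dissipativity of \<open>A\<close> and
  \<open>F\<close>. And mild solutions neither stay in the domain of the generator nor have a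
  derivative, so dissipativity is applied to short-time averages of orbits and integrated through
  one-sided difference quotients.\<close>

text \<open>A finite cover by small sets is given as a colouring with finitely many colours, so that covers
  are refined by pairing colours.\<close>

definition totally_bounded_wrt :: "('a \<Rightarrow> 'a \<Rightarrow> real) \<Rightarrow> 'a set \<Rightarrow> bool" where
  "totally_bounded_wrt d A \<longleftrightarrow>
     (\<forall>\<epsilon>>0. \<exists>c::'a \<Rightarrow> nat. finite (c ` A) \<and> (\<forall>x\<in>A. \<forall>y\<in>A. c x = c y \<longrightarrow> d x y \<le> \<epsilon>))"

lemma finite_colouring_nat:
  assumes "finite (f ` A)"
  shows "\<exists>c::'a \<Rightarrow> nat. finite (c ` A) \<and> (\<forall>x\<in>A. \<forall>y\<in>A. c x = c y \<longrightarrow> f x = f y)"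
proof -
  obtain g :: "_ \<Rightarrow> nat" where "inj_on g (f ` A)"
    using finite_imp_inj_to_nat_seg[OF assms] by blast
  then show ?thesis
    using finite_imageI[OF assms, of g]
    by (intro exI[of _ "g \<circ> f"]) (auto simp: inj_on_def image_image)
qed

text \<open>A separated set of maximal size is a net, and a point is coloured by a nearby member of
  the net. The triangle inequality carries a factor 2 because \<open>d\<close> will be a variance,
  that is, a squared distance.\<close>

lemma totally_bounded_wrt_if_bounded_separated:
  assumes refl: "\<And>x. d x x \<le> 0" and sym: "\<And>x y. d x y = d y x"
    and tri: "\<And>x y z. d x y \<le> 2 * (d x z + d z y)"
    and sep: "\<And>\<epsilon>. \<epsilon> > 0 \<Longrightarrow>
      \<exists>n. \<nexists>X. X \<subseteq> A \<and> finite X \<and> card X = n \<and> (\<forall>x\<in>X. \<forall>y\<in>X. x \<noteq> y \<longrightarrow> d x y > \<epsilon>)"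
  shows "totally_bounded_wrt d A"
  unfolding totally_bounded_wrt_def
proof (intro allI impI)
  fix \<epsilon> :: real assume "\<epsilon> > 0"
  \<comment> \<open>The quarter is forced by the factor 2: two points near the same centre satisfy d
    <= 2 * (eps/4 + eps/4).\<close>
  define P where "P X \<longleftrightarrow> X \<subseteq> A \<and> finite X \<and> (\<forall>x\<in>X. \<forall>y\<in>X. x \<noteq> y \<longrightarrow> d x y > \<epsilon> / 4)" for X
  have "\<epsilon> / 4 > 0" using \<open>\<epsilon> > 0\<close> by simp
  from sep[OF this] obtain n0 where "\<nexists>X. X \<subseteq> A \<and> finite X \<and> card X = n0 \<and>
      (\<forall>x\<in>X. \<forall>y\<in>X. x \<noteq> y \<longrightarrow> d x y > \<epsilon> / 4)" by (elim exE)
  then have "\<nexists>X. P X \<and> card X = n0" unfolding P_def by blast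
  then have ex: "\<exists>n. \<nexists>X. P X \<and> card X = n" by (rule exI)
  \<comment> \<open>The least impossible size \<open>n\<close> is not 0, so its predecessor
    \<open>m\<close> is attained, and a set of size \<open>m\<close> cannot be enlarged.\<close>
  define n where "n = (LEAST n. \<nexists>X. P X \<and> card X = n)"
  have n: "\<nexists>X. P X \<and> card X = n" unfolding n_def by (rule LeastI_ex[OF ex])
  have "P {}" by (simp add: P_def)
  then have "n \<noteq> 0" using n by (metis card.empty)
  then obtain m where m: "n = Suc m" by (cases n) auto
  have "\<exists>X. P X \<and> card X = m"
    using not_less_Least[of m "\<lambda>n. \<nexists>X. P X \<and> card X = n"] m n_def by auto
  then obtain X where X: "P X" "card X = m" by blast
  have near: "\<exists>y\<in>X. d x y \<le> \<epsilon> / 4" if x: "x \<in> A" for x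
  proof (rule ccontr)
    assume *: "\<not> ?thesis"
    have "d x x \<le> \<epsilon> / 4" using refl[of x] \<open>\<epsilon> > 0\<close> by linarith
    with * have "x \<notin> X" by blast
    have "d x y > \<epsilon> / 4" "d y x > \<epsilon> / 4" if "y \<in> X" for y
      using * that sym[of y x] by (auto simp: not_le)
    with \<open>x \<notin> X\<close> have "P (insert x X)" "card (insert x X) = Suc m"
      using X x unfolding P_def by auto
    then show False using n m by blast
  qed
  define g where "g x = (SOME y. y \<in> X \<and> d x y \<le> \<epsilon> / 4)" for x
  have g: "g x \<in> X" "d x (g x) \<le> \<epsilon> / 4" if "x \<in> A" for x
    using someI_ex[of "\<lambda>y. y \<in> X \<and> d x y \<le> \<epsilon> / 4"] near[OF that] by (auto simp: g_def)
  have "finite (g ` A)" using X g by (intro finite_subset[of "g ` A" X]) (auto simp: P_def)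
  from finite_colouring_nat[OF this] obtain c :: "'a \<Rightarrow> nat" where
    c: "finite (c ` A)" "\<forall>x\<in>A. \<forall>y\<in>A. c x = c y \<longrightarrow> g x = g y" by blast
  have "d x y \<le> \<epsilon>" if "x \<in> A" "y \<in> A" "c x = c y" for x y
  proof -
    have "g x = g y" using c(2) that by blast
    then have "d (g x) y \<le> \<epsilon> / 4" using g(2)[OF that(2)] sym[of "g x" y] by simp
    then show ?thesis using tri[of x y "g x"] g(2)[OF that(1)] by simp
  qed
  with c show "\<exists>c::'a \<Rightarrow> nat. finite (c ` A) \<and> (\<forall>x\<in>A. \<forall>y\<in>A. c x = c y \<longrightarrow> d x y \<le> \<epsilon>)"
    by blast
qed

lemma finite_floor_range:
  fixes f :: "'a \<Rightarrow> real"
  assumes "\<And>x. x \<in> A \<Longrightarrow> \<bar>f x\<bar> \<le> B"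
  shows "finite ((\<lambda>x. \<lfloor>f x\<rfloor>) ` A)"
proof (rule finite_subset)
  show "(\<lambda>x. \<lfloor>f x\<rfloor>) ` A \<subseteq> {\<lfloor>-B\<rfloor>..\<lfloor>B\<rfloor>}"
  proof (rule image_subsetI)
    fix x assume "x \<in> A"
    then have "-B \<le> f x" "f x \<le> B" using assms[of x] by auto
    then show "\<lfloor>f x\<rfloor> \<in> {\<lfloor>-B\<rfloor>..\<lfloor>B\<rfloor>}" by (auto intro: floor_mono)
  qed
qed simp

lemma floor_divide_eq_imp_close:
  fixes a b d :: real
  assumes "d > 0" "\<lfloor>a / d\<rfloor> = \<lfloor>b / d\<rfloor>"
  shows "\<bar>a - b\<bar> < d"
proof -
  have "\<bar>a / d - b / d\<bar> < 1" using assms(2) by linarith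
  then have "\<bar>(a - b) / d\<bar> < 1" by (simp only: diff_divide_distrib)
  then show ?thesis using assms(1) by simp
qed

lemma integrable_mult_of_squares:
  fixes f g :: "'a \<Rightarrow> real"
  assumes [measurable]: "f \<in> borel_measurable N" "g \<in> borel_measurable N"
    and "integrable N (\<lambda>x. (f x)\<^sup>2)" "integrable N (\<lambda>x. (g x)\<^sup>2)"
  shows "integrable N (\<lambda>x. f x * g x)"
proof (rule Bochner_Integration.integrable_bound[of N "\<lambda>x. (f x)\<^sup>2 + (g x)\<^sup>2"])
  show "AE x in N. norm (f x * g x) \<le> norm ((f x)\<^sup>2 + (g x)\<^sup>2)"
  proof (rule AE_I2)
    fix x
    have "2 * (\<bar>f x\<bar> * \<bar>g x\<bar>) \<le> (f x)\<^sup>2 + (g x)\<^sup>2"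
      using sum_squares_bound[of "\<bar>f x\<bar>" "\<bar>g x\<bar>"] by (simp add: mult.assoc)
    moreover have "0 \<le> \<bar>f x\<bar> * \<bar>g x\<bar>" by simp
    ultimately have "\<bar>f x\<bar> * \<bar>g x\<bar> \<le> (f x)\<^sup>2 + (g x)\<^sup>2" by linarith
    then show "norm (f x * g x) \<le> norm ((f x)\<^sup>2 + (g x)\<^sup>2)"
      by (simp add: abs_mult)
  qed
qed (use assms in auto)

lemma integrable_square_add:
  fixes f g :: "'a \<Rightarrow> real"
  assumes "f \<in> borel_measurable N" "g \<in> borel_measurable N"
    and "integrable N (\<lambda>x. (f x)\<^sup>2)" "integrable N (\<lambda>x. (g x)\<^sup>2)"
  shows "integrable N (\<lambda>x. (f x + g x)\<^sup>2)" "integrable N (\<lambda>x. (f x - g x)\<^sup>2)"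
  using integrable_mult_of_squares[OF assms] assms(3,4)
  by (auto simp: power2_sum power2_diff mult.assoc)

lemma square_add_le: "((a::real) + b)\<^sup>2 \<le> 2 * a\<^sup>2 + 2 * b\<^sup>2"
  using sum_squares_bound[of a b] by (simp add: power2_sum)

lemma square_diff_le: "((a::real) - b)\<^sup>2 \<le> 2 * a\<^sup>2 + 2 * b\<^sup>2"
  using square_add_le[of a "- b"] by simp

lemma integral_double_sum:
  fixes f :: "'i \<Rightarrow> 'j \<Rightarrow> 'a \<Rightarrow> real"
  assumes "\<And>i j. i \<in> I \<Longrightarrow> j \<in> J \<Longrightarrow> integrable N (f i j)"
  shows "(\<integral>x. (\<Sum>i\<in>I. \<Sum>j\<in>J. f i j x) \<partial>N) = (\<Sum>i\<in>I. \<Sum>j\<in>J. \<integral>x. f i j x \<partial>N)"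
  using assms by (simp add: Bochner_Integration.integral_sum Bochner_Integration.integrable_sum)

section \<open>Gaussian random variables\<close>

context prob_space begin

lemma real_gaussian_centred_cases:
  assumes "real_gaussian M Y" "expectation Y = 0"
  shows "(AE \<omega> in M. Y \<omega> = 0) \<or> (\<exists>\<sigma>>0. distributed M lborel Y (normal_density 0 \<sigma>))"
proof -
  have Y[measurable]: "Y \<in> borel_measurable M" using assms(1) by (simp add: real_gaussian_def)
  consider m where "AE \<omega> in M. Y \<omega> = m" |
    m \<sigma> where "\<sigma> > 0" "distributed M lborel Y (normal_density m \<sigma>)"
    using assms(1) by (auto simp: real_gaussian_def)
  then show ?thesis
  proof cases
    case 1
    have "expectation Y = expectation (\<lambda>_. m)" using 1 by (intro integral_cong_AE) auto
    then have "m = 0" using assms(2) prob_space by simp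
    with 1 show ?thesis by simp
  next
    case 2
    with normal_distributed_expectation[OF 2] assms(2) show ?thesis by auto
  qed
qed

lemma real_gaussian_square_integrable:
  assumes "real_gaussian M Y" "expectation Y = 0"
  shows "integrable M (\<lambda>\<omega>. (Y \<omega>)\<^sup>2)"
  using real_gaussian_centred_cases[OF assms]
proof (elim disjE exE conjE)
  have [measurable]: "Y \<in> borel_measurable M" using assms(1) by (simp add: real_gaussian_def)
  assume "AE \<omega> in M. Y \<omega> = 0"
  then have "integrable M (\<lambda>\<omega>. (Y \<omega>)\<^sup>2) \<longleftrightarrow> integrable M (\<lambda>\<omega>. 0::real)"
    by (intro integrable_cong_AE) auto
  then show ?thesis by simp
next
  fix \<sigma> :: real assume \<sigma>: "\<sigma> > 0" "distributed M lborel Y (normal_density 0 \<sigma>)"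
  show ?thesis
    using distributed_integrable[OF \<sigma>(2), of "\<lambda>x. x\<^sup>2"] integrable_normal_moment[OF \<sigma>(1), of 0 2]
    by simp
qed

text \<open>Completing the square: the exponential weight shifts the mean to the variance, so the
  moment generating function is read off from the total mass of a normal density.\<close>

lemma normal_density_exp:
  assumes "\<sigma> > 0"
  shows "normal_density 0 \<sigma> x * exp x = exp (\<sigma>\<^sup>2 / 2) * normal_density (\<sigma>\<^sup>2) \<sigma> x"
proof -
  have "- x\<^sup>2 / (2 * \<sigma>\<^sup>2) + x = \<sigma>\<^sup>2 / 2 - (x - \<sigma>\<^sup>2)\<^sup>2 / (2 * \<sigma>\<^sup>2)"
    using assms by (simp add: field_simps power2_eq_square)
  then have "exp (- x\<^sup>2 / (2 * \<sigma>\<^sup>2)) * exp x = exp (\<sigma>\<^sup>2 / 2) * exp (- (x - \<sigma>\<^sup>2)\<^sup>2 / (2 * \<sigma>\<^sup>2))"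
    by (simp add: exp_add[symmetric])
  then show ?thesis by (simp add: normal_density_def)
qed

lemma real_gaussian_mgf:
  assumes "real_gaussian M Y" "expectation Y = 0"
  shows "integrable M (\<lambda>\<omega>. exp (Y \<omega>))"
    and "expectation (\<lambda>\<omega>. exp (Y \<omega>)) = exp (expectation (\<lambda>\<omega>. (Y \<omega>)\<^sup>2) / 2)"
proof -
  have [measurable]: "Y \<in> borel_measurable M" using assms(1) by (simp add: real_gaussian_def)
  have "integrable M (\<lambda>\<omega>. exp (Y \<omega>)) \<and>
    expectation (\<lambda>\<omega>. exp (Y \<omega>)) = exp (expectation (\<lambda>\<omega>. (Y \<omega>)\<^sup>2) / 2)"
    using real_gaussian_centred_cases[OF assms]
  proof (elim disjE exE conjE)
    assume 0: "AE \<omega> in M. Y \<omega> = 0"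
    have "integrable M (\<lambda>\<omega>. exp (Y \<omega>)) \<longleftrightarrow> integrable M (\<lambda>\<omega>. 1::real)"
      using 0 by (intro integrable_cong_AE) auto
    moreover have "expectation (\<lambda>\<omega>. exp (Y \<omega>)) = expectation (\<lambda>\<omega>. 1)"
      using 0 by (intro integral_cong_AE) auto
    moreover have "expectation (\<lambda>\<omega>. (Y \<omega>)\<^sup>2) = expectation (\<lambda>\<omega>. 0)"
      using 0 by (intro integral_cong_AE) auto
    ultimately show ?thesis by (simp add: prob_space)
  next
    fix \<sigma> :: real assume \<sigma>: "\<sigma> > 0" "distributed M lborel Y (normal_density 0 \<sigma>)"
    have V: "expectation (\<lambda>\<omega>. (Y \<omega>)\<^sup>2) = \<sigma>\<^sup>2"
      using normal_distributed_variance[OF \<sigma>] assms(2) by simp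
    have "integrable M (\<lambda>\<omega>. exp (Y \<omega>))"
      using distributed_integrable[OF \<sigma>(2), of "exp"] \<sigma>(1) by (simp add: normal_density_exp)
    moreover have "expectation (\<lambda>\<omega>. exp (Y \<omega>)) = exp (\<sigma>\<^sup>2 / 2)"
      using distributed_integral[OF \<sigma>(2), of "exp", symmetric] \<sigma>(1) by (simp add: normal_density_exp)
    ultimately show ?thesis using V by simp
  qed
  then show "integrable M (\<lambda>\<omega>. exp (Y \<omega>))"
    "expectation (\<lambda>\<omega>. exp (Y \<omega>)) = exp (expectation (\<lambda>\<omega>. (Y \<omega>)\<^sup>2) / 2)" by auto
qed

text \<open>The density is at most 1 / (2 * sigma), because sqrt (2 * pi) is at least 2. The product
  form covers the degenerate variance 0. It is used backwards: a ball of probability at least 1/2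
  bounds the standard deviation by 2 * R.\<close>

lemma real_gaussian_small_ball:
  assumes "real_gaussian M Y" "expectation Y = 0" "R \<ge> 0"
  shows "prob {\<omega>\<in>space M. \<bar>Y \<omega>\<bar> \<le> R} * sqrt (expectation (\<lambda>\<omega>. (Y \<omega>)\<^sup>2)) \<le> R"
  using real_gaussian_centred_cases[OF assms(1,2)]
proof (elim disjE exE conjE)
  have [measurable]: "Y \<in> borel_measurable M" using assms(1) by (simp add: real_gaussian_def)
  assume 0: "AE \<omega> in M. Y \<omega> = 0"
  have "expectation (\<lambda>\<omega>. (Y \<omega>)\<^sup>2) = expectation (\<lambda>\<omega>. 0)"
    using 0 by (intro integral_cong_AE) auto
  then show ?thesis using assms(3) by simp
next
  fix \<sigma> :: real assume \<sigma>: "\<sigma> > 0" "distributed M lborel Y (normal_density 0 \<sigma>)"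
  have V: "expectation (\<lambda>\<omega>. (Y \<omega>)\<^sup>2) = \<sigma>\<^sup>2"
    using normal_distributed_variance[OF \<sigma>] assms(2) by simp
  have Ys: "Y \<in> borel_measurable M" using assms(1) by (simp add: real_gaussian_def)
  have "ennreal (prob {\<omega>\<in>space M. \<bar>Y \<omega>\<bar> \<le> R}) = emeasure M (Y -` {-R..R} \<inter> space M)"
    by (simp add: emeasure_eq_measure) (rule arg_cong[of _ _ prob], auto)
  also have "\<dots> = (\<integral>\<^sup>+x. ennreal (normal_density 0 \<sigma> x) * indicator {-R..R} x \<partial>lborel)"
    by (rule distributed_emeasure[OF \<sigma>(2)]) simp
  also have "\<dots> \<le> (\<integral>\<^sup>+x. ennreal (1 / (2 * \<sigma>)) * indicator {-R..R} x \<partial>lborel)"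
  proof (rule nn_integral_mono)
    fix x :: real
    have "2 \<le> sqrt (2 * pi)" using pi_gt3 by (intro real_le_rsqrt) simp
    then have "2 * \<sigma> \<le> sqrt (2 * pi * \<sigma>\<^sup>2)" using \<sigma>(1) by (simp add: real_sqrt_mult)
    moreover have "exp (- x\<^sup>2 / (2 * \<sigma>\<^sup>2)) \<le> 1" by simp
    ultimately have "normal_density 0 \<sigma> x \<le> 1 / (2 * \<sigma>)"
      unfolding normal_density_def using \<sigma>(1)
      by (intro order_trans[OF mult_left_le[of "exp _"]]) (auto intro!: divide_left_mono mult_pos_pos)
    then show "ennreal (normal_density 0 \<sigma> x) * indicator {-R..R} x
        \<le> ennreal (1 / (2 * \<sigma>)) * indicator {-R..R} x"
      by (intro mult_right_mono ennreal_leI) auto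
  qed
  also have "\<dots> = ennreal (1 / (2 * \<sigma>)) * ennreal (2 * R)"
    using assms(3) by (subst nn_integral_cmult_indicator) auto
  also have "\<dots> = ennreal (R / \<sigma>)" using \<sigma>(1) assms(3) by (simp add: ennreal_mult[symmetric])
  finally have "prob {\<omega>\<in>space M. \<bar>Y \<omega>\<bar> \<le> R} \<le> R / \<sigma>"
    using \<sigma>(1) assms(3) by simp
  then show ?thesis using \<sigma>(1) V by (simp add: field_simps)
qed

text \<open>The variance bound comes from \<open>real_gaussian_small_ball\<close> on a ball of
  probability at least 1/2. If total boundedness failed, there would be arbitrarily many functionals
  with variance above a fixed level and nearly vanishing covariances. Their normalised exponentials
  have mean 1 and are nearly uncorrelated, so their average is close to 1 in mean square. On the
  event \<open>G\<close> where \<open>Z\<close> is bounded, however, each exponential is at most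
  1/2, and \<open>G\<close> is too likely for that.\<close>

lemma centred_gaussian_totally_bounded:
  fixes Z :: "'a \<Rightarrow> 'e::real_normed_vector"
  assumes Z: "gaussian_rv M Z" and mean: "\<And>x. expectation (\<lambda>\<omega>. blinfun_apply (x :: 'e \<Rightarrow>\<^sub>L real) (Z \<omega>)) = 0"
  shows "totally_bounded_wrt (\<lambda>x y. expectation (\<lambda>\<omega>. (blinfun_apply (x - y) (Z \<omega>))\<^sup>2)) (cball (0 :: 'e \<Rightarrow>\<^sub>L real) 1)"
    and "\<exists>B. \<forall>x :: 'e \<Rightarrow>\<^sub>L real. expectation (\<lambda>\<omega>. (blinfun_apply x (Z \<omega>))\<^sup>2) \<le> B * (norm x)\<^sup>2"
proof -
  define g where "g x \<omega> = blinfun_apply x (Z \<omega>)" for x :: "'e \<Rightarrow>\<^sub>L real" and \<omega>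
  define V where "V x = expectation (\<lambda>\<omega>. (g x \<omega>)\<^sup>2)" for x
  define c where "c x y = expectation (\<lambda>\<omega>. g x \<omega> * g y \<omega>)" for x y
  have Zm[measurable]: "Z \<in> borel_measurable M" using Z by (simp add: gaussian_rv_def)
  have rg: "real_gaussian M (g x)" for x using Z unfolding gaussian_rv_def g_def[abs_def] by blast
  then have gm[measurable]: "g x \<in> borel_measurable M" for x by (simp add: real_gaussian_def)
  have gmean: "expectation (g x) = 0" for x using mean unfolding g_def[abs_def] .
  have g_lin: "g (x + y) \<omega> = g x \<omega> + g y \<omega>" "g (x - y) \<omega> = g x \<omega> - g y \<omega>" "g (a *\<^sub>R x) \<omega> = a * g x \<omega>"
    for x y a \<omega> by (auto simp: g_def blinfun.bilinear_simps)
  have sq_int: "integrable M (\<lambda>\<omega>. (g x \<omega>)\<^sup>2)" for x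
    by (rule real_gaussian_square_integrable[OF rg gmean])
  have prod_int: "integrable M (\<lambda>\<omega>. g x \<omega> * g y \<omega>)" for x y
    by (rule integrable_mult_of_squares[OF gm gm sq_int sq_int])
  have V_add: "V (x + y) = V x + V y + 2 * c x y" for x y
  proof -
    have "V (x + y) = expectation (\<lambda>\<omega>. (g x \<omega>)\<^sup>2 + (g y \<omega>)\<^sup>2 + 2 * (g x \<omega> * g y \<omega>))"
      by (simp add: V_def g_lin power2_eq_square algebra_simps)
    then show ?thesis using sq_int prod_int by (simp add: V_def c_def)
  qed
  have c_diff: "c u (x - y) = c u x - c u y" for u x y
    using prod_int by (simp add: c_def g_lin right_diff_distrib)
  have V_scale: "V (a *\<^sub>R x) = a\<^sup>2 * V x" for a x
    by (simp add: V_def g_lin power_mult_distrib)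
  have V_nonneg: "0 \<le> V x" for x by (simp add: V_def)
  have V_tri: "V (x - y) \<le> 2 * (V (x - z) + V (z - y))" for x y z
  proof -
    have "V (x - y) \<le> expectation (\<lambda>\<omega>. 2 * (g (x - z) \<omega>)\<^sup>2 + 2 * (g (z - y) \<omega>)\<^sup>2)"
      unfolding V_def
    proof (rule integral_mono)
      fix \<omega>
      from square_add_le[of "g (x - z) \<omega>" "g (z - y) \<omega>"]
      show "(g (x - y) \<omega>)\<^sup>2 \<le> 2 * (g (x - z) \<omega>)\<^sup>2 + 2 * (g (z - y) \<omega>)\<^sup>2"
        by (simp add: g_lin)
    qed (use sq_int in auto)
    then show ?thesis using sq_int by (simp add: V_def)
  qed
  have c_bound: "\<bar>c x y\<bar> \<le> V x + V y" for x y
  proof -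

    have "g (-1 *\<^sub>R y) \<omega> = - g y \<omega>" for \<omega> using g_lin(3)[of "-1" y \<omega>] by simp
    then have "c x (-1 *\<^sub>R y) = - c x y" unfolding c_def by simp
    then have "V (x + (-1) *\<^sub>R y) = V x + V y - 2 * c x y"
      using V_add[of x "(-1) *\<^sub>R y"] V_scale[of "-1" y] by simp
    then show ?thesis using V_add[of x y] V_nonneg[of "x + y"] V_nonneg[of "x + (-1) *\<^sub>R y"]
      V_nonneg[of x] V_nonneg[of y] by linarith
  qed

  obtain R where R: "R \<ge> 1" "prob {\<omega>\<in>space M. norm (Z \<omega>) \<le> R} \<ge> 1/2"
  proof -
    define W where "W n = {\<omega>\<in>space M. norm (Z \<omega>) \<le> real (Suc n)}" for n
    have "(\<lambda>n. prob (W n)) \<longlonglongrightarrow> prob (\<Union>n. W n)"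
    proof (rule finite_Lim_measure_incseq)
      have "W n \<in> events" for n unfolding W_def by measurable
      then show "range W \<subseteq> events" by auto
      show "incseq W" by (auto simp: incseq_def W_def)
    qed
    moreover have "(\<Union>n. W n) = space M"
    proof -
      have "\<exists>n. norm z \<le> real (Suc n)" for z :: 'e
      proof -
        obtain n where "norm z \<le> real n" using real_arch_simple by blast
        then have "norm z \<le> real (Suc n)" by simp
        then show ?thesis ..
      qed
      then show ?thesis by (auto simp: W_def)
    qed
    ultimately have "(\<lambda>n. prob (W n)) \<longlonglongrightarrow> 1" using prob_space by simp
    then have "\<forall>\<^sub>F n in sequentially. prob (W n) > 1/2"
      by (rule order_tendstoD) simp
    then obtain n where "prob (W n) > 1/2" by (auto simp: eventually_sequentially)
    then show thesis using that[of "real (Suc n)"] by (auto simp: W_def)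
  qed
  define G where "G = {\<omega>\<in>space M. norm (Z \<omega>) \<le> R}"
  have G[measurable]: "G \<in> events" unfolding G_def by measurable
  have g_le: "\<bar>g x \<omega>\<bar> \<le> norm x * R" if "\<omega> \<in> G" for x \<omega>
    using norm_blinfun[of x "Z \<omega>"] mult_left_mono[of "norm (Z \<omega>)" R "norm x"] that
    by (auto simp: g_def G_def)
  have V_le: "V x \<le> 4 * R\<^sup>2 * (norm x)\<^sup>2" for x
  proof -
    have "prob G \<le> prob {\<omega>\<in>space M. \<bar>g x \<omega>\<bar> \<le> norm x * R}"
      using g_le by (intro finite_measure_mono) (auto simp: G_def)
    then have "1/2 * sqrt (V x) \<le> norm x * R"
      using real_gaussian_small_ball[OF rg gmean, of "norm x * R" x] R V_nonneg[of x]
        mult_right_mono[of "1/2" "prob {\<omega>\<in>space M. \<bar>g x \<omega>\<bar> \<le> norm x * R}" "sqrt (V x)"]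
      by (auto simp: G_def V_def)
    then have "(sqrt (V x))\<^sup>2 \<le> (2 * (norm x * R))\<^sup>2" using V_nonneg by (intro power_mono) auto
    then show ?thesis using V_nonneg by (simp add: power_mult_distrib mult_ac)
  qed
  then show "\<exists>B. \<forall>x :: 'e \<Rightarrow>\<^sub>L real. expectation (\<lambda>\<omega>. (blinfun_apply x (Z \<omega>))\<^sup>2) \<le> B * (norm x)\<^sup>2"
    unfolding V_def g_def by blast

  have mgf: "integrable M (\<lambda>\<omega>. exp (g x \<omega>))" "expectation (\<lambda>\<omega>. exp (g x \<omega>)) = exp (V x / 2)" for x
    using real_gaussian_mgf[OF rg gmean] by (auto simp: V_def)

  show "totally_bounded_wrt (\<lambda>x y. expectation (\<lambda>\<omega>. (blinfun_apply (x - y) (Z \<omega>))\<^sup>2)) (cball (0 :: 'e \<Rightarrow>\<^sub>L real) 1)"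
    unfolding V_def[unfolded g_def, symmetric]
  proof (rule totally_bounded_wrt_if_bounded_separated)
    show "V (x - x) \<le> 0" for x by (simp add: V_def g_def)
    show "V (x - y) = V (y - x)" for x y using V_scale[of "-1" "x - y"] by simp
    show "V (x - y) \<le> 2 * (V (x - z) + V (z - y))" for x y z by (rule V_tri)
    fix \<epsilon> :: real assume \<epsilon>: "\<epsilon> > 0"
    show "\<exists>n. \<nexists>X. X \<subseteq> cball 0 1 \<and> finite X \<and> card X = n \<and> (\<forall>x\<in>X. \<forall>y\<in>X. x \<noteq> y \<longrightarrow> \<epsilon> < V (x - y))"
    proof (rule ccontr)
      assume "\<not> ?thesis"
      then have sep: "\<exists>X. X \<subseteq> cball 0 1 \<and> finite X \<and> card X = n \<and> (\<forall>x\<in>X. \<forall>y\<in>X. x \<noteq> y \<longrightarrow> \<epsilon> < V (x - y))"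
        for n by blast
      \<comment> \<open>Pigeonhole: a separated family with more members than there are cells for
        the rounded covariances with the earlier \<open>u i\<close> has two members in one cell.
        Their difference is the next functional; separation keeps its variance above the level, and
        norm 2 is the price of taking differences.\<close>
      have greedy: "\<exists>u. \<forall>i<k. norm (u i) \<le> 2 \<and> V (u i) > \<epsilon> \<and> (\<forall>j<i. \<bar>c (u j) (u i)\<bar> \<le> \<delta>)"
        if \<delta>: "\<delta> > 0" for \<delta> and k :: nat
      proof (induction k)
        case 0
        then show ?case by simp
      next
        case (Suc k)
        then obtain u where u: "\<forall>i<k. norm (u i) \<le> 2 \<and> V (u i) > \<epsilon> \<and> (\<forall>j<i. \<bar>c (u j) (u i)\<bar> \<le> \<delta>)"
          by blast
        \<comment> \<open>The range of the rounded covariances: \<open>c_bound\<close> gives 16 *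
          R^2 from \<open>u i\<close>, of norm at most 2, plus 4 * R^2 from \<open>x\<close>, of
          norm at most 1.\<close>
        define N where "N = {\<lfloor>-(20 * R\<^sup>2 / \<delta>)\<rfloor>..\<lfloor>20 * R\<^sup>2 / \<delta>\<rfloor>}"
        define f where "f x = (\<lambda>i\<in>{..<k}. \<lfloor>c (u i) x / \<delta>\<rfloor>)" for x
        have finN: "finite ({..<k} \<rightarrow>\<^sub>E N)" by (intro finite_PiE) (auto simp: N_def)
        obtain X where X: "X \<subseteq> cball 0 1" "finite X" "card X = Suc (card ({..<k} \<rightarrow>\<^sub>E N))"
          "\<forall>x\<in>X. \<forall>y\<in>X. x \<noteq> y \<longrightarrow> \<epsilon> < V (x - y)"
          using sep[of "Suc (card ({..<k} \<rightarrow>\<^sub>E N))"] by (elim exE conjE)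
        have "f ` X \<subseteq> {..<k} \<rightarrow>\<^sub>E N"
        proof (rule image_subsetI)
          fix x assume "x \<in> X"
          then have nx: "norm x \<le> 1" using X(1) by auto
          have "\<lfloor>c (u i) x / \<delta>\<rfloor> \<in> N" if "i < k" for i
          proof -
            have "norm (u i) \<le> 2" using u that by blast
            then have "(norm (u i))\<^sup>2 \<le> 2\<^sup>2" "(norm x)\<^sup>2 \<le> 1\<^sup>2" using nx power_mono[of "norm (u i)" 2 2] power_mono[of "norm x" 1 2] by auto
            then have "4 * R\<^sup>2 * (norm (u i))\<^sup>2 \<le> 4 * R\<^sup>2 * 4" "4 * R\<^sup>2 * (norm x)\<^sup>2 \<le> 4 * R\<^sup>2 * 1"
              by (intro mult_left_mono; simp)+
            then have "V (u i) \<le> 4 * R\<^sup>2 * 4" "V x \<le> 4 * R\<^sup>2 * 1" using V_le[of "u i"] V_le[of x] by linarith+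
            then have "\<bar>c (u i) x\<bar> \<le> 20 * R\<^sup>2" using c_bound[of "u i" x] by simp
            then have "-(20 * R\<^sup>2 / \<delta>) \<le> c (u i) x / \<delta>" "c (u i) x / \<delta> \<le> 20 * R\<^sup>2 / \<delta>"
              using \<delta> by (auto simp: field_simps)
            then show ?thesis unfolding N_def by (auto intro: floor_mono)
          qed
          then show "f x \<in> {..<k} \<rightarrow>\<^sub>E N" by (auto simp: f_def)
        qed
        then have "card (f ` X) < card X" using card_mono[OF finN] X(3) by (simp add: le_imp_less_Suc)
        then have "\<not> inj_on f X" using pigeonhole by blast
        then obtain x y where xy: "x \<in> X" "y \<in> X" "x \<noteq> y" "f x = f y" by (auto simp: inj_on_def)
        have small: "\<bar>c (u i) (x - y)\<bar> \<le> \<delta>" if "i < k" for i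
        proof -
          have "\<lfloor>c (u i) x / \<delta>\<rfloor> = \<lfloor>c (u i) y / \<delta>\<rfloor>" using fun_cong[OF xy(4), of i] that by (simp add: f_def)
          from floor_divide_eq_imp_close[OF \<delta> this] show ?thesis by (simp add: c_diff)
        qed
        have "norm x \<le> 1" "norm y \<le> 1" using xy(1,2) X(1) by auto
        then have "norm (x - y) \<le> 2" using norm_triangle_ineq4[of x y] by linarith
        moreover have "V (x - y) > \<epsilon>" using X(4) xy by blast
        ultimately show ?case using u small
          by (intro exI[of _ "u(k := x - y)"]) (auto simp: less_Suc_eq)
      qed

      \<comment> \<open>On \<open>G\<close> the exponent of \<open>L i\<close> is at most 2 * t * R
        - t^2 * eps / 2. This \<open>t\<close> turns it into -t * sqrt eps, and t >= 2 / sqrt eps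
        puts it below -1.\<close>
      define t where "t = (4 * R + 2 * sqrt \<epsilon>) / \<epsilon>"
      have t: "t > 0" using \<epsilon> R by (auto simp: t_def intro!: divide_pos_pos add_pos_pos)
      have t2: "2 * t * R - t\<^sup>2 * \<epsilon> / 2 \<le> -1"
      proof -
        have "2 * t * R - t\<^sup>2 * \<epsilon> / 2 = t * (2 * R - t * \<epsilon> / 2)" by (simp add: power2_eq_square algebra_simps)
        also have "t * \<epsilon> = 4 * R + 2 * sqrt \<epsilon>" using \<epsilon> by (simp add: t_def)
        finally have "2 * t * R - t\<^sup>2 * \<epsilon> / 2 = - (t * sqrt \<epsilon>)" by (simp add: add_divide_distrib)
        moreover have "t * sqrt \<epsilon> \<ge> 2 * sqrt \<epsilon> / \<epsilon> * sqrt \<epsilon>"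
          using \<epsilon> R by (intro mult_right_mono) (auto simp: t_def divide_right_mono)
        moreover have "2 * sqrt \<epsilon> / \<epsilon> * sqrt \<epsilon> = 2" using \<epsilon> by (simp add: mult.assoc)
        ultimately show ?thesis by linarith
      qed
      \<comment> \<open>Off-diagonal terms of the second moment of \<open>Y\<close> are at most
        33/32, and \<open>k\<close> is taken so large that the diagonal adds at most 1/32. The total
        34/32 = 17/16 leaves a variance of at most 1/16.\<close>
      define \<delta> where "\<delta> = ln (33/32) / t\<^sup>2"
      have \<delta>: "\<delta> > 0" "exp (t\<^sup>2 * \<delta>) = 33/32" using t by (auto simp: \<delta>_def)
      obtain k :: nat where k0: "32 * exp (t\<^sup>2 * (16 * R\<^sup>2)) < real k" using reals_Archimedean2 by blast
      have "0 < real k" by (rule less_trans[OF _ k0]) simp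
      then have k: "k > 0" by simp
      from greedy[OF \<delta>(1), of k] obtain u where
        u: "\<And>i. i < k \<Longrightarrow> norm (u i) \<le> 2" "\<And>i. i < k \<Longrightarrow> V (u i) > \<epsilon>"
          "\<And>i j. i < k \<Longrightarrow> j < i \<Longrightarrow> \<bar>c (u j) (u i)\<bar> \<le> \<delta>" by metis
      have c_comm: "c x y = c y x" for x y by (simp add: c_def mult.commute)
      have u3: "c (u i) (u j) \<le> \<delta>" if "i < k" "j < k" "i \<noteq> j" for i j
      proof (cases "i < j")
        case True
        then show ?thesis using u(3)[of j i] that by simp
      next
        case False
        then show ?thesis using u(3)[of i j] that c_comm[of "u i" "u j"] by simp
      qed
      have Vu: "V (u i) \<le> 16 * R\<^sup>2" if "i < k" for i
      proof -
        have "(norm (u i))\<^sup>2 \<le> 2\<^sup>2" using u that by (intro power_mono) auto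
        then show ?thesis using mult_left_mono[of "(norm (u i))\<^sup>2" 4 "4 * R\<^sup>2"] V_le[of "u i"] by simp
      qed
      \<comment> \<open>Normalised to mean 1. The product of two of these is again an exponential of
        a centred Gaussian, and after cancellation of the variances only the covariance remains in
        its mean.\<close>
      define L where "L i \<omega> = exp (g (t *\<^sub>R u i) \<omega>) * exp (- (t\<^sup>2 * V (u i) / 2))" for i \<omega>
      have L_int: "integrable M (L i)" and L_mean: "expectation (L i) = 1" for i
        unfolding L_def using mgf[of "t *\<^sub>R u i"] by (auto simp del: mult_exp_exp simp: V_scale exp_minus)
      have LL: "L i \<omega> * L j \<omega> = exp (g (t *\<^sub>R (u i + u j)) \<omega>) * exp (- (t\<^sup>2 * V (u i) / 2) - t\<^sup>2 * V (u j) / 2)" for i j \<omega>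
        by (simp add: L_def g_lin mult_exp_exp algebra_simps)
      have LL_int: "integrable M (\<lambda>\<omega>. L i \<omega> * L j \<omega>)"
        and LL_mean: "expectation (\<lambda>\<omega>. L i \<omega> * L j \<omega>) = exp (t\<^sup>2 * c (u i) (u j))" for i j
      proof -
        note m = mgf[of "t *\<^sub>R (u i + u j)", unfolded V_scale V_add]
        show "integrable M (\<lambda>\<omega>. L i \<omega> * L j \<omega>)"
          unfolding LL by (intro integrable_mult_left m)
        show "expectation (\<lambda>\<omega>. L i \<omega> * L j \<omega>) = exp (t\<^sup>2 * c (u i) (u j))"
        proof -
          have "expectation (\<lambda>\<omega>. L i \<omega> * L j \<omega>) = expectation (\<lambda>\<omega>. exp (g (t *\<^sub>R (u i + u j)) \<omega>)) *
              exp (- (t\<^sup>2 * V (u i) / 2) - t\<^sup>2 * V (u j) / 2)"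
            unfolding LL by (rule integral_mult_left_zero)
          also have "\<dots> = exp (t\<^sup>2 * (V (u i) + V (u j) + 2 * c (u i) (u j)) / 2 +
              (- (t\<^sup>2 * V (u i) / 2) - t\<^sup>2 * V (u j) / 2))"
            unfolding m(2) by (rule mult_exp_exp)
          also have "\<dots> = exp (t\<^sup>2 * c (u i) (u j))" by (simp add: field_simps)
          finally show ?thesis .
        qed
      qed
      define Y where "Y \<omega> = (\<Sum>i<k. L i \<omega>) / real k" for \<omega>
      have Y_int: "integrable M Y" unfolding Y_def by (intro integrable_divide Bochner_Integration.integrable_sum L_int)
      have Y_mean: "expectation Y = 1" unfolding Y_def using L_int L_mean k by simp
      have YY: "(Y \<omega>)\<^sup>2 = (\<Sum>i<k. \<Sum>j<k. L i \<omega> * L j \<omega>) / (real k)\<^sup>2" for \<omega>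
        by (simp add: Y_def power_divide power2_eq_square sum_product)
      have YY_int: "integrable M (\<lambda>\<omega>. (Y \<omega>)\<^sup>2)" unfolding YY
        by (intro integrable_divide Bochner_Integration.integrable_sum LL_int)
      have "expectation (\<lambda>\<omega>. (Y \<omega>)\<^sup>2) = (\<Sum>i<k. \<Sum>j<k. exp (t\<^sup>2 * c (u i) (u j))) / (real k)\<^sup>2"
        unfolding YY using LL_int LL_mean by simp
      also have "(\<Sum>i<k. \<Sum>j<k. exp (t\<^sup>2 * c (u i) (u j))) \<le> (\<Sum>i<k. real k / 32 + real k * (33/32))"
      proof (rule sum_mono)
        fix i assume "i \<in> {..<k}"
        then have i: "i < k" by simp
        have "(\<Sum>j<k. exp (t\<^sup>2 * c (u i) (u j))) \<le> (\<Sum>j<k. (if j = i then real k / 32 else 0) + 33/32)"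
        proof (rule sum_mono)
          fix j assume "j \<in> {..<k}"
          then have j: "j < k" by simp
          show "exp (t\<^sup>2 * c (u i) (u j)) \<le> (if j = i then real k / 32 else 0) + 33/32"
          proof (cases "j = i")
            case True
            have "c (u i) (u i) = V (u i)" by (simp add: c_def V_def power2_eq_square)
            then have "t\<^sup>2 * c (u i) (u j) \<le> t\<^sup>2 * (16 * R\<^sup>2)" using Vu[OF i] True by (intro mult_left_mono) auto
            then have "exp (t\<^sup>2 * c (u i) (u j)) \<le> exp (t\<^sup>2 * (16 * R\<^sup>2))" by (simp only: exp_le_cancel_iff)
            also have "\<dots> \<le> real k / 32" using k0 by simp
            finally show ?thesis using True by simp
          next
            case False
            have "t\<^sup>2 * c (u i) (u j) \<le> t\<^sup>2 * \<delta>" using u3[OF i j] False by (intro mult_left_mono) auto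
            then have "exp (t\<^sup>2 * c (u i) (u j)) \<le> exp (t\<^sup>2 * \<delta>)" by simp
            then show ?thesis using \<delta>(2) False by simp
          qed
        qed
        also have "\<dots> = real k / 32 + real k * (33/32)" using i by (simp add: sum.distrib)
        finally show "(\<Sum>j<k. exp (t\<^sup>2 * c (u i) (u j))) \<le> real k / 32 + real k * (33/32)" .
      qed
      also have "(\<Sum>i<k. real k / 32 + real k * (33/32)) = (17/16) * (real k)\<^sup>2"
        by (simp add: power2_eq_square field_simps)
      finally have Y2: "expectation (\<lambda>\<omega>. (Y \<omega>)\<^sup>2) \<le> 17/16" using k by (simp add: divide_right_mono field_simps)
      have Yd: "integrable M (\<lambda>\<omega>. (Y \<omega> - 1)\<^sup>2)" "expectation (\<lambda>\<omega>. (Y \<omega> - 1)\<^sup>2) \<le> 1/16"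
      proof -
        have e: "(Y \<omega> - 1)\<^sup>2 = (Y \<omega>)\<^sup>2 - 2 * Y \<omega> + 1" for \<omega> by (simp add: power2_diff)
        show "integrable M (\<lambda>\<omega>. (Y \<omega> - 1)\<^sup>2)" unfolding e using YY_int Y_int by auto
        show "expectation (\<lambda>\<omega>. (Y \<omega> - 1)\<^sup>2) \<le> 1/16" unfolding e using YY_int Y_int Y_mean Y2 by (simp add: prob_space)
      qed
      have "Y \<omega> \<le> 1/2" if "\<omega> \<in> G" for \<omega>
      proof -
        have "L i \<omega> \<le> 1/2" if "i < k" for i
        proof -
          have "g (t *\<^sub>R u i) \<omega> \<le> t * (2 * R)"
          proof -
            have "norm (u i) * R \<le> 2 * R" using u(1)[OF that] R(1) by (intro mult_right_mono) auto
            then have "g (u i) \<omega> \<le> 2 * R" using g_le[OF \<open>\<omega> \<in> G\<close>, of "u i"] by linarith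
            then show ?thesis using t by (simp add: g_lin)
          qed
          moreover have "t\<^sup>2 * \<epsilon> \<le> t\<^sup>2 * V (u i)" using u(2)[OF that] by (intro mult_left_mono) auto
          ultimately have "g (t *\<^sub>R u i) \<omega> + (- (t\<^sup>2 * V (u i) / 2)) \<le> -1" using t2 by (simp add: field_simps)
          then have "L i \<omega> \<le> exp (-1)" unfolding L_def exp_add[symmetric] by simp
          also have "exp (-1::real) \<le> 1/2" using exp_ge_add_one_self[of 1] by (simp add: exp_minus field_simps)
          finally show ?thesis .
        qed
        then have "(\<Sum>i<k. L i \<omega>) \<le> (\<Sum>i<k. 1/2)" by (intro sum_mono) auto
        then show ?thesis using k by (simp add: Y_def field_simps)
      qed
      \<comment> \<open>Integrating this gives P(G)/4 <= 1/16, against P(G) >= 1/2.\<close>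
      then have "1/4 * indicator G \<omega> \<le> (Y \<omega> - 1)\<^sup>2" for \<omega>
      proof (cases "\<omega> \<in> G")
        case True
        then have "(1/2)\<^sup>2 \<le> (1 - Y \<omega>)\<^sup>2" using \<open>\<And>\<omega>. \<omega> \<in> G \<Longrightarrow> Y \<omega> \<le> 1/2\<close>[OF True] by (intro power_mono) auto
        then show ?thesis using True by (simp add: power2_commute[of 1] power_divide)
      qed simp
      then have "expectation (\<lambda>\<omega>. 1/4 * indicator G \<omega>) \<le> expectation (\<lambda>\<omega>. (Y \<omega> - 1)\<^sup>2)"
        using Yd(1) by (intro integral_mono integrable_mult_right integrable_real_indicator)
          (auto simp: emeasure_eq_measure)
      then have "1/4 * prob G \<le> 1/16" using Yd(2) by simp
      then show False using R(2) by (simp add: G_def)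
    qed
  qed
qed

end

section \<open>Mean-square limits\<close>

lemma L2_converges_add:
  assumes g: "L2_converges N g G" and h: "L2_converges N h H"
  shows "L2_converges N (\<lambda>n x. g n x + h n x) (\<lambda>x. G x + H x)"
    and "L2_converges N (\<lambda>n x. g n x - h n x) (\<lambda>x. G x - H x)"
proof -
  have m[measurable]: "g n \<in> borel_measurable N" "h n \<in> borel_measurable N" "G \<in> borel_measurable N"
    "H \<in> borel_measurable N" for n using assms by (auto simp: L2_converges_def)
  let ?D = "\<lambda>n. 2 * (\<integral>\<^sup>+ x. ennreal ((g n x - G x)\<^sup>2) \<partial>N) + 2 * (\<integral>\<^sup>+ x. ennreal ((h n x - H x)\<^sup>2) \<partial>N)"
  have lim: "?D \<longlonglongrightarrow> 2 * 0 + 2 * 0"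
    using assms by (intro tendsto_add ennreal_tendsto_cmult) (auto simp: L2_converges_def)
  have D: "?D n = (\<integral>\<^sup>+ x. ennreal (2 * (g n x - G x)\<^sup>2 + 2 * (h n x - H x)\<^sup>2) \<partial>N)" for n
  proof -
    have "(\<integral>\<^sup>+ x. ennreal (2 * (g n x - G x)\<^sup>2 + 2 * (h n x - H x)\<^sup>2) \<partial>N) =
        (\<integral>\<^sup>+ x. 2 * ennreal ((g n x - G x)\<^sup>2) + 2 * ennreal ((h n x - H x)\<^sup>2) \<partial>N)"
      by (intro nn_integral_cong) (simp add: ennreal_plus ennreal_mult)
    then show ?thesis by (simp add: nn_integral_add nn_integral_cmult)
  qed
  have "(\<lambda>n. \<integral>\<^sup>+ x. ennreal (((g n x + h n x) - (G x + H x))\<^sup>2) \<partial>N) \<longlonglongrightarrow> 0"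
  proof (rule tendsto_sandwich[OF _ _ tendsto_const])
    show "\<forall>\<^sub>F n in sequentially. (\<integral>\<^sup>+ x. ennreal (((g n x + h n x) - (G x + H x))\<^sup>2) \<partial>N) \<le> ?D n"
      unfolding D
    proof (intro always_eventually allI nn_integral_mono ennreal_leI)
      fix n x show "(g n x + h n x - (G x + H x))\<^sup>2 \<le> 2 * (g n x - G x)\<^sup>2 + 2 * (h n x - H x)\<^sup>2"
        using square_add_le[of "g n x - G x" "h n x - H x"] by (simp add: algebra_simps)
    qed
    show "?D \<longlonglongrightarrow> 0" using lim by simp
  qed simp
  then show "L2_converges N (\<lambda>n x. g n x + h n x) (\<lambda>x. G x + H x)" by (simp add: L2_converges_def)
  have "(\<lambda>n. \<integral>\<^sup>+ x. ennreal (((g n x - h n x) - (G x - H x))\<^sup>2) \<partial>N) \<longlonglongrightarrow> 0"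
  proof (rule tendsto_sandwich[OF _ _ tendsto_const])
    show "\<forall>\<^sub>F n in sequentially. (\<integral>\<^sup>+ x. ennreal (((g n x - h n x) - (G x - H x))\<^sup>2) \<partial>N) \<le> ?D n"
      unfolding D
    proof (intro always_eventually allI nn_integral_mono ennreal_leI)
      fix n x show "(g n x - h n x - (G x - H x))\<^sup>2 \<le> 2 * (g n x - G x)\<^sup>2 + 2 * (h n x - H x)\<^sup>2"
        using square_diff_le[of "g n x - G x" "h n x - H x"] by (simp add: algebra_simps)
    qed
    show "?D \<longlonglongrightarrow> 0" using lim by simp
  qed simp
  then show "L2_converges N (\<lambda>n x. g n x - h n x) (\<lambda>x. G x - H x)" by (simp add: L2_converges_def)
qed

text \<open>A single member with finite distance to the limit makes the limit square integrable.
  Convergence of the second moments then follows from Young's inequality with a free weight.\<close>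

lemma L2_converges_square:
  assumes g: "L2_converges N g G" and sq: "\<And>n. integrable N (\<lambda>x. (g n x)\<^sup>2)"
  shows "integrable N (\<lambda>x. (G x)\<^sup>2)" "(\<lambda>n. \<integral>x. (g n x)\<^sup>2 \<partial>N) \<longlonglongrightarrow> (\<integral>x. (G x)\<^sup>2 \<partial>N)"
proof -
  have m[measurable]: "g n \<in> borel_measurable N" "G \<in> borel_measurable N" for n
    using g by (auto simp: L2_converges_def)
  have lim: "(\<lambda>n. \<integral>\<^sup>+ x. ennreal ((g n x - G x)\<^sup>2) \<partial>N) \<longlonglongrightarrow> 0" using g by (simp add: L2_converges_def)
  have "\<forall>\<^sub>F n in sequentially. (\<integral>\<^sup>+ x. ennreal ((g n x - G x)\<^sup>2) \<partial>N) < 1"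
    using lim by (rule order_tendstoD) simp
  then obtain n0 where "(\<integral>\<^sup>+ x. ennreal ((g n0 x - G x)\<^sup>2) \<partial>N) < 1" by (auto simp: eventually_sequentially)
  then have "integrable N (\<lambda>x. (g n0 x - G x)\<^sup>2)"
    by (intro integrableI_bounded) (auto intro: less_trans[OF _ ennreal_one_less_top])
  then have "integrable N (\<lambda>x. (g n0 x - (g n0 x - G x))\<^sup>2)"
    by (intro integrable_square_add(2)[of "g n0" N "\<lambda>x. g n0 x - G x"] sq) auto
  then show G2: "integrable N (\<lambda>x. (G x)\<^sup>2)" by simp
  have d2: "integrable N (\<lambda>x. (g n x - G x)\<^sup>2)" for n
    using sq G2 by (intro integrable_square_add(2)) auto
  have D: "(\<integral>\<^sup>+ x. ennreal ((g n x - G x)\<^sup>2) \<partial>N) = ennreal (\<integral>x. (g n x - G x)\<^sup>2 \<partial>N)" for n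
    using d2 by (intro nn_integral_eq_integral) auto
  define I where "I = (\<integral>x. (G x)\<^sup>2 \<partial>N)"
  have I: "I \<ge> 0" by (simp add: I_def)
  have Dl: "(\<lambda>n. \<integral>x. (g n x - G x)\<^sup>2 \<partial>N) \<longlonglongrightarrow> 0"
    using lim unfolding D by (subst (asm) ennreal_0[symmetric], subst (asm) tendsto_ennreal_iff) auto
  \<comment> \<open>The cross term 2 * d * G is split as d^2 / \<eta> + \<eta> * G^2; \<eta> is
    fixed before n tends to infinity.\<close>
  have bound: "\<bar>(\<integral>x. (g n x)\<^sup>2 \<partial>N) - I\<bar> \<le> (1 + 1/\<eta>) * (\<integral>x. (g n x - G x)\<^sup>2 \<partial>N) + \<eta> * I"
    if "\<eta> > 0" for \<eta> n
  proof -
    have pt: "\<bar>(g n x)\<^sup>2 - (G x)\<^sup>2\<bar> \<le> (1 + 1/\<eta>) * (g n x - G x)\<^sup>2 + \<eta> * (G x)\<^sup>2" for x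
    proof -
      define d where "d = g n x - G x"
      have e: "(g n x)\<^sup>2 - (G x)\<^sup>2 = d\<^sup>2 + 2 * d * G x"
        by (simp add: d_def power2_eq_square algebra_simps)
      have "0 \<le> (\<bar>d\<bar> / sqrt \<eta> - sqrt \<eta> * \<bar>G x\<bar>)\<^sup>2" by simp
      also have "\<dots> = d\<^sup>2 / \<eta> + \<eta> * (G x)\<^sup>2 - 2 * (\<bar>d\<bar> * \<bar>G x\<bar>)"
        using that by (simp add: power2_diff power_divide power_mult_distrib)
      finally have "2 * (\<bar>d\<bar> * \<bar>G x\<bar>) \<le> d\<^sup>2 / \<eta> + \<eta> * (G x)\<^sup>2" by simp
      moreover have "\<bar>(g n x)\<^sup>2 - (G x)\<^sup>2\<bar> \<le> d\<^sup>2 + 2 * (\<bar>d\<bar> * \<bar>G x\<bar>)"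
        unfolding e by (rule order_trans[OF abs_triangle_ineq]) (simp add: abs_mult mult.assoc)
      ultimately show ?thesis unfolding d_def[symmetric] by (simp add: algebra_simps)
    qed
    have "(\<integral>x. (g n x)\<^sup>2 \<partial>N) - I = (\<integral>x. (g n x)\<^sup>2 - (G x)\<^sup>2 \<partial>N)" using sq G2 by (simp add: I_def)
    also have "\<bar>\<dots>\<bar> \<le> (\<integral>x. \<bar>(g n x)\<^sup>2 - (G x)\<^sup>2\<bar> \<partial>N)" by (rule integral_abs_bound)
    also have "\<dots> \<le> (\<integral>x. (1 + 1/\<eta>) * (g n x - G x)\<^sup>2 + \<eta> * (G x)\<^sup>2 \<partial>N)"
      using sq G2 d2 pt by (intro integral_mono) auto
    also have "\<dots> = (1 + 1/\<eta>) * (\<integral>x. (g n x - G x)\<^sup>2 \<partial>N) + \<eta> * I"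
      using G2 d2 by (simp add: I_def)
    finally show ?thesis .
  qed
  show "(\<lambda>n. \<integral>x. (g n x)\<^sup>2 \<partial>N) \<longlonglongrightarrow> (\<integral>x. (G x)\<^sup>2 \<partial>N)"
    unfolding I_def[symmetric]
  proof (rule LIMSEQ_I)
    fix \<epsilon> :: real assume \<epsilon>: "\<epsilon> > 0"
    define \<eta> where "\<eta> = \<epsilon> / (2 * (I + 1))"
    have \<eta>: "\<eta> > 0" "\<eta> * I < \<epsilon> / 2 + 0" using \<epsilon> I by (auto simp: \<eta>_def field_simps)
    have "(\<lambda>n. (1 + 1/\<eta>) * (\<integral>x. (g n x - G x)\<^sup>2 \<partial>N)) \<longlonglongrightarrow> (1 + 1/\<eta>) * 0"
      by (intro tendsto_mult tendsto_const Dl)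
    then have "\<forall>\<^sub>F n in sequentially. (1 + 1/\<eta>) * (\<integral>x. (g n x - G x)\<^sup>2 \<partial>N) < \<epsilon> / 2"
      using \<epsilon> by (intro order_tendstoD(2)[where y = 0]) auto
    then obtain n0 where "\<And>n. n \<ge> n0 \<Longrightarrow> (1 + 1/\<eta>) * (\<integral>x. (g n x - G x)\<^sup>2 \<partial>N) < \<epsilon> / 2"
      by (auto simp: eventually_sequentially)
    then show "\<exists>no. \<forall>n\<ge>no. norm ((\<integral>x. (g n x)\<^sup>2 \<partial>N) - I) < \<epsilon>"
      using bound[OF \<eta>(1)] \<eta>(2) by (intro exI[of _ n0]) (smt (verit) field_sum_of_halves real_norm_def)
  qed
qed

text \<open>Polarisation expresses the integral of a product by second moments of the sum and the
  difference.\<close>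

lemma L2_converges_inner:
  assumes g: "L2_converges N g G" and h: "L2_converges N h H"
    and sq: "\<And>n. integrable N (\<lambda>x. (g n x)\<^sup>2)" "\<And>n. integrable N (\<lambda>x. (h n x)\<^sup>2)"
  shows "(\<lambda>n. \<integral>x. g n x * h n x \<partial>N) \<longlonglongrightarrow> (\<integral>x. G x * H x \<partial>N)"
proof -
  have m: "g n \<in> borel_measurable N" "h n \<in> borel_measurable N" "G \<in> borel_measurable N"
    "H \<in> borel_measurable N" for n using g h by (auto simp: L2_converges_def)
  have polar: "(\<integral>x. f x * k x \<partial>N) = ((\<integral>x. (f x + k x)\<^sup>2 \<partial>N) - (\<integral>x. (f x - k x)\<^sup>2 \<partial>N)) / 4"
    if "f \<in> borel_measurable N" "k \<in> borel_measurable N"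
      "integrable N (\<lambda>x. (f x)\<^sup>2)" "integrable N (\<lambda>x. (k x)\<^sup>2)" for f k :: "_ \<Rightarrow> real"
  proof -
    have "(\<integral>x. (f x + k x)\<^sup>2 \<partial>N) - (\<integral>x. (f x - k x)\<^sup>2 \<partial>N) = (\<integral>x. (f x + k x)\<^sup>2 - (f x - k x)\<^sup>2 \<partial>N)"
      using integrable_square_add[OF that] by simp
    also have "\<dots> = (\<integral>x. 4 * (f x * k x) \<partial>N)"
      by (simp add: power2_eq_square algebra_simps)
    finally show ?thesis by simp
  qed
  note G2 = L2_converges_square(1)[OF g sq(1)] and H2 = L2_converges_square(1)[OF h sq(2)]
  show ?thesis
    unfolding polar[OF m(1,2) sq] polar[OF m(3,4) G2 H2]
    using L2_converges_add[OF g h] integrable_square_add[OF m(1,2) sq]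
    by (intro tendsto_divide tendsto_diff L2_converges_square(2) tendsto_const) auto
qed

section \<open>Wiener integrals\<close>

context prob_space begin

lemma brownian_increment:
  assumes b: "brownian_motion M b" and "0 \<le> s" "s \<le> t"
  shows "random_variable borel (\<lambda>\<omega>. b t \<omega> - b s \<omega>)"
    and "integrable M (\<lambda>\<omega>. (b t \<omega> - b s \<omega>)\<^sup>2)"
    and "expectation (\<lambda>\<omega>. b t \<omega> - b s \<omega>) = 0"
    and "expectation (\<lambda>\<omega>. (b t \<omega> - b s \<omega>)\<^sup>2) = t - s"
proof -
  have "b t \<in> borel_measurable M" "b s \<in> borel_measurable M" using assms by (auto simp: brownian_motion_def)
  then show m: "random_variable borel (\<lambda>\<omega>. b t \<omega> - b s \<omega>)" by measurable
  have "integrable M (\<lambda>\<omega>. (b t \<omega> - b s \<omega>)\<^sup>2) \<and> expectation (\<lambda>\<omega>. b t \<omega> - b s \<omega>) = 0 \<and>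
      expectation (\<lambda>\<omega>. (b t \<omega> - b s \<omega>)\<^sup>2) = t - s"
  proof (cases "s = t")
    case False
    then have st: "s < t" using assms by simp
    then have D: "distributed M lborel (\<lambda>\<omega>. b t \<omega> - b s \<omega>) (normal_density 0 (sqrt (t - s)))"
      using b assms by (simp add: brownian_motion_def)
    have \<sigma>: "0 < sqrt (t - s)" using st by simp
    have E: "expectation (\<lambda>\<omega>. b t \<omega> - b s \<omega>) = 0" by (rule normal_distributed_expectation[OF \<sigma> D])
    then have rg: "real_gaussian M (\<lambda>\<omega>. b t \<omega> - b s \<omega>)" unfolding real_gaussian_def using m D \<sigma> by blast
    show ?thesis using E real_gaussian_square_integrable[OF rg E] normal_distributed_variance[OF \<sigma> D] st by simp
  qed simp
  then show "integrable M (\<lambda>\<omega>. (b t \<omega> - b s \<omega>)\<^sup>2)" "expectation (\<lambda>\<omega>. b t \<omega> - b s \<omega>) = 0"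
    "expectation (\<lambda>\<omega>. (b t \<omega> - b s \<omega>)\<^sup>2) = t - s" by auto
qed

text \<open>Twice the product is a signed sum of four squared increments, those over t1..t4 and
  t2..t3 minus those over t1..t3 and t2..t4, and the lengths of these intervals cancel.\<close>

lemma brownian_increment_orthogonal:
  assumes b: "brownian_motion M b" and t: "0 \<le> t1" "t1 \<le> t2" "t2 \<le> t3" "t3 \<le> t4"
  shows "expectation (\<lambda>\<omega>. (b t2 \<omega> - b t1 \<omega>) * (b t4 \<omega> - b t3 \<omega>)) = 0"
proof -
  note i = brownian_increment(2)[OF b] and e = brownian_increment(4)[OF b]
  have "expectation (\<lambda>\<omega>. 2 * ((b t2 \<omega> - b t1 \<omega>) * (b t4 \<omega> - b t3 \<omega>))) =
     expectation (\<lambda>\<omega>. (b t4 \<omega> - b t1 \<omega>)\<^sup>2 + (b t3 \<omega> - b t2 \<omega>)\<^sup>2 - (b t3 \<omega> - b t1 \<omega>)\<^sup>2 - (b t4 \<omega> - b t2 \<omega>)\<^sup>2)"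
    by (simp add: power2_eq_square algebra_simps)
  also have "\<dots> = (t4 - t1) + (t3 - t2) - (t3 - t1) - (t4 - t2)"
    using t i[of t1 t4] i[of t2 t3] i[of t1 t3] i[of t2 t4]
    by (simp add: e)
  finally show ?thesis by simp
qed

lemma step_on_mono:
  assumes "step_on T (n, c, \<tau>)" "i \<le> j" "j \<le> n"
  shows "\<tau> i \<le> \<tau> j" "0 \<le> \<tau> i" "\<tau> i \<le> T"
proof -
  have step: "\<tau> i \<le> \<tau> (Suc i)" if "i < n" for i using assms(1) that by (auto simp: step_on_def less_imp_le)
  have mono: "\<tau> i \<le> \<tau> j" if "i \<le> j" "j \<le> n" for i j
    using that by (induction j) (auto simp: le_Suc_eq intro: order_trans[OF _ step])
  have "0 \<le> \<tau> 0" "\<tau> n \<le> T" using assms(1) by (auto simp: step_on_def)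
  then show "\<tau> i \<le> \<tau> j" "0 \<le> \<tau> i" "\<tau> i \<le> T"
    using mono[of i j] mono[of 0 i] mono[of i n] assms(2,3) by auto
qed

text \<open>Both squares expand into the same double sum: off the diagonal, increments are
  orthogonal on one side and the intervals disjoint on the other; on the diagonal both give the
  length.\<close>

lemma step_isometry:
  assumes b: "brownian_motion M b" and p: "step_on T p"
  shows "random_variable borel (step_integral b p)"
    and "integrable M (\<lambda>\<omega>. (step_integral b p \<omega>)\<^sup>2)"
    and "expectation (step_integral b p) = 0"
    and "integrable (restrict_space lborel {0..T}) (\<lambda>s. (step_fun p s)\<^sup>2)"
    and "expectation (\<lambda>\<omega>. (step_integral b p \<omega>)\<^sup>2) = (\<integral>s. (step_fun p s)\<^sup>2 \<partial>restrict_space lborel {0..T})"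
proof -
  obtain n c \<tau> where pe: "p = (n, c, \<tau>)" by (cases p) auto
  note mono = step_on_mono[OF p[unfolded pe]]
  define X where "X i \<omega> = b (\<tau> (Suc i)) \<omega> - b (\<tau> i) \<omega>" for i \<omega>
  define A where "A i = {\<tau> i<..\<tau> (Suc i)}" for i
  define N where "N = restrict_space lborel {0..T}"
  have X: "random_variable borel (X i)" "integrable M (\<lambda>\<omega>. (X i \<omega>)\<^sup>2)" "expectation (X i) = 0"
    "expectation (\<lambda>\<omega>. (X i \<omega>)\<^sup>2) = \<tau> (Suc i) - \<tau> i" if "i < n" for i
    unfolding X_def using mono[of i "Suc i"] that by (intro brownian_increment[OF b]; simp)+
  have XX: "expectation (\<lambda>\<omega>. X i \<omega> * X j \<omega>) = (if i = j then \<tau> (Suc i) - \<tau> i else 0)"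
    if "i < n" "j < n" for i j
  proof (cases i j rule: linorder_cases)
    case less
    then show ?thesis unfolding X_def
      using brownian_increment_orthogonal[OF b, of "\<tau> i" "\<tau> (Suc i)" "\<tau> j" "\<tau> (Suc j)"]
        mono[of i "Suc i"] mono[of "Suc i" j] mono[of j "Suc j"] that by simp
  next
    case equal
    then show ?thesis using X(4)[of i] that by (simp add: power2_eq_square)
  next
    case greater
    then show ?thesis unfolding X_def
      using brownian_increment_orthogonal[OF b, of "\<tau> j" "\<tau> (Suc j)" "\<tau> i" "\<tau> (Suc i)"]
        mono[of j "Suc j"] mono[of "Suc j" i] mono[of i "Suc i"] that by (simp add: mult.commute)
  qed
  have XXi: "integrable M (\<lambda>\<omega>. X i \<omega> * X j \<omega>)" if "i < n" "j < n" for i j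
    using X that by (intro integrable_mult_of_squares) auto
  have Xi: "integrable M (X i)" if "i < n" for i
    using XXi square_integrable_imp_integrable[of "X i"] X that by auto
  have S: "step_integral b p \<omega> = (\<Sum>i<n. c i * X i \<omega>)" for \<omega> by (simp add: pe step_integral_def X_def)
  have SS: "(step_integral b p \<omega>)\<^sup>2 = (\<Sum>i<n. \<Sum>j<n. (c i * c j) * (X i \<omega> * X j \<omega>))" for \<omega>
    by (simp add: S power2_eq_square sum_product mult_ac)
  show "random_variable borel (step_integral b p)"
    unfolding S[abs_def] using X by (intro borel_measurable_sum) auto
  show "integrable M (\<lambda>\<omega>. (step_integral b p \<omega>)\<^sup>2)"
    unfolding SS using XXi by (intro Bochner_Integration.integrable_sum) auto
  show "expectation (step_integral b p) = 0" unfolding S[abs_def] using Xi X by simp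
  have E: "expectation (\<lambda>\<omega>. (step_integral b p \<omega>)\<^sup>2) =
      (\<Sum>i<n. \<Sum>j<n. (c i * c j) * (if i = j then \<tau> (Suc i) - \<tau> i else 0))"
    unfolding SS using XXi by (subst integral_double_sum) (auto simp: XX intro!: sum.cong)
  have FF: "(step_fun p s)\<^sup>2 = (\<Sum>i<n. \<Sum>j<n. (c i * c j) * indicator (A i \<inter> A j) s)" for s
  proof -
    have "step_fun p s = (\<Sum>i<n. c i * indicator (A i) s)" by (simp add: pe step_fun_def A_def)
    then show ?thesis by (simp only: power2_eq_square sum_product indicator_inter_arith mult_ac)
  qed
  have A_sub: "A i \<subseteq> {0..T}" if "i < n" for i
    using mono[of i "Suc i"] mono[of "Suc i" n] that by (auto simp: A_def)
  have A_int: "A i \<inter> A j = (if i = j then A i else {})" if "i < n" "j < n" for i j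
    using mono[of "Suc i" j] mono[of "Suc j" i] that
    by (cases i j rule: linorder_cases) (auto simp: A_def)
  have A_sets: "A i \<inter> A j \<in> sets N" if "i < n" for i j
    using A_sub[OF that] by (auto simp: N_def sets_restrict_space_iff A_def)
  have A_em: "emeasure N (A i \<inter> A j) = (if i = j then \<tau> (Suc i) - \<tau> i else 0)" if "i < n" "j < n" for i j
    unfolding A_int[OF that] using A_sub[OF that(1)] mono[of i "Suc i"] that
    by (auto simp: N_def emeasure_restrict_space A_def)
  have A_m: "measure N (A i \<inter> A j) = (if i = j then \<tau> (Suc i) - \<tau> i else 0)" if "i < n" "j < n" for i j
    using A_em[OF that] mono[of i "Suc i"] that by (auto simp: measure_def)
  have A_i: "integrable N (\<lambda>s. (c i * c j) * indicator (A i \<inter> A j) s)" if "i < n" "j < n" for i j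
    using A_sets[OF that(1)] A_em[OF that] by (intro integrable_mult_right integrable_real_indicator) auto
  have space_N: "space N = {0..T}" by (simp add: N_def)
  show "integrable (restrict_space lborel {0..T}) (\<lambda>s. (step_fun p s)\<^sup>2)"
    unfolding N_def[symmetric] FF using A_i by (intro Bochner_Integration.integrable_sum) auto
  have "(\<integral>s. (step_fun p s)\<^sup>2 \<partial>N) = (\<Sum>i<n. \<Sum>j<n. (c i * c j) * measure N (A i \<inter> A j))"
  proof -
    have "(\<integral>s. (step_fun p s)\<^sup>2 \<partial>N) = (\<Sum>i<n. \<Sum>j<n. \<integral>s. (c i * c j) * indicator (A i \<inter> A j) s \<partial>N)"
      unfolding FF using A_i by (intro integral_double_sum) auto
    also have "(\<integral>s. (c i * c j) * indicator (A i \<inter> A j) s \<partial>N) = (c i * c j) * measure N (A i \<inter> A j)"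
      if "i < n" for i j
    proof -
      have "A i \<inter> A j \<inter> space N = A i \<inter> A j" using A_sub[OF that] space_N by blast
      then show ?thesis by simp
    qed
    then have "(\<Sum>i<n. \<Sum>j<n. \<integral>s. (c i * c j) * indicator (A i \<inter> A j) s \<partial>N) =
        (\<Sum>i<n. \<Sum>j<n. (c i * c j) * measure N (A i \<inter> A j))"
      by (intro sum.cong refl) auto
    finally show ?thesis .
  qed
  then show "expectation (\<lambda>\<omega>. (step_integral b p \<omega>)\<^sup>2) = (\<integral>s. (step_fun p s)\<^sup>2 \<partial>restrict_space lborel {0..T})"
    unfolding E N_def[symmetric] using A_m by (auto intro!: sum.cong)
qed

text \<open>The mean is the pairing with the constant 1, which is square integrable for a
  probability measure.\<close>

lemma L2_converges_mean:
  assumes g: "L2_converges M g G" and sq: "\<And>n. integrable M (\<lambda>x. (g n x)\<^sup>2)" and "\<And>n. expectation (g n) = 0"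
  shows "expectation G = 0"
proof -
  have "L2_converges M (\<lambda>_ _. 1) (\<lambda>_. 1)" by (simp add: L2_converges_def)
  from L2_converges_inner[OF g this sq] assms(3)
  have "(\<lambda>n. 0::real) \<longlonglongrightarrow> expectation G" by simp
  then show ?thesis using LIMSEQ_unique tendsto_const by blast
qed

lemma wiener_isometry:
  assumes b: "brownian_motion M b" and w: "has_wiener_integral M b T f Y"
  shows "random_variable borel Y" "integrable M (\<lambda>\<omega>. (Y \<omega>)\<^sup>2)" "expectation Y = 0"
    and "f \<in> borel_measurable (restrict_space lborel {0..T})"
    and "integrable (restrict_space lborel {0..T}) (\<lambda>s. (f s)\<^sup>2)"
    and "expectation (\<lambda>\<omega>. (Y \<omega>)\<^sup>2) = (\<integral>s. (f s)\<^sup>2 \<partial>restrict_space lborel {0..T})"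
proof -
  obtain p where p: "\<And>j. step_on T (p j)"
    "L2_converges (restrict_space lborel {0..T}) (\<lambda>j. step_fun (p j)) f"
    "L2_converges M (\<lambda>j. step_integral b (p j)) Y"
    using w by (auto simp: has_wiener_integral_def)
  note s = step_isometry[OF b p(1)]
  show "random_variable borel Y" "f \<in> borel_measurable (restrict_space lborel {0..T})"
    using p by (auto simp: L2_converges_def)
  show "integrable M (\<lambda>\<omega>. (Y \<omega>)\<^sup>2)" by (rule L2_converges_square(1)[OF p(3) s(2)])
  show "integrable (restrict_space lborel {0..T}) (\<lambda>s. (f s)\<^sup>2)" by (rule L2_converges_square(1)[OF p(2) s(4)])
  show "expectation Y = 0" by (rule L2_converges_mean[OF p(3) s(2,3)])
  show "expectation (\<lambda>\<omega>. (Y \<omega>)\<^sup>2) = (\<integral>s. (f s)\<^sup>2 \<partial>restrict_space lborel {0..T})"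
    using L2_converges_square(2)[OF p(3) s(2)] L2_converges_square(2)[OF p(2) s(4)]
    unfolding s(5) by (rule LIMSEQ_unique)
qed

text \<open>A step integral evaluates its path at finitely many nonnegative times, so it is a
  measurable function of the restricted path. Independence of the two paths therefore passes to the
  two integrals, whose means vanish.\<close>

lemma step_orthogonal:
  assumes W: "cylindrical_wiener M K e \<beta>" and kj: "k \<in> K" "j \<in> K" "k \<noteq> j"
    and p: "step_on T p" and q: "step_on T q"
  shows "expectation (\<lambda>\<omega>. step_integral (\<beta> k) p \<omega> * step_integral (\<beta> j) q \<omega>) = 0"
proof -
  have bm: "brownian_motion M (\<beta> k)" "brownian_motion M (\<beta> j)" using W kj by (auto simp: cylindrical_wiener_def)
  let ?P = "PiM {0..} (\<lambda>_. borel) :: (real \<Rightarrow> real) measure"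
  \<comment> \<open>Both integrands are put into one family over the index set {k, j}, as
    independence is formulated for families.\<close>
  define r where "r i = (if i = k then p else q)" for i
  have "indep_vars (\<lambda>_. ?P) (\<lambda>k \<omega>. \<lambda>t\<in>{0..}. \<beta> k t \<omega>) {k, j}"
    using W kj by (auto simp: cylindrical_wiener_def intro: indep_vars_subset)
  then have "indep_vars (\<lambda>_. borel)
    (\<lambda>i \<omega>. step_integral (\<lambda>t w. w t) (r i) (\<lambda>t\<in>{0..}. \<beta> i t \<omega>)) {k, j}"
  proof (rule indep_vars_compose2)
    fix i assume "i \<in> {k, j}"
    obtain n c \<tau> where r: "r i = (n, c, \<tau>)" by (cases "r i") auto
    then have "step_on T (n, c, \<tau>)" using p q by (auto simp: r_def split: if_splits)
    note nn = step_on_mono(2)[OF this]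
    have "\<tau> i \<in> {0..}" "\<tau> (Suc i) \<in> {0..}" if "i < n" for i using nn[of i i] nn[of "Suc i" "Suc i"] that by auto
    then show "step_integral (\<lambda>t w. w t) (r i) \<in> borel_measurable ?P"
      unfolding r step_integral_def
      by (auto intro!: borel_measurable_sum borel_measurable_times borel_measurable_diff borel_measurable_const
          intro: measurable_component_singleton)
  qed
  moreover have "step_integral (\<lambda>t w. w t) (r i) (\<lambda>t\<in>{0..}. \<beta> i t \<omega>) = step_integral (\<beta> i) (r i) \<omega>" for i \<omega>
  proof -
    obtain n c \<tau> where r: "r i = (n, c, \<tau>)" by (cases "r i") auto
    then have "step_on T (n, c, \<tau>)" using p q by (auto simp: r_def split: if_splits)
    note nn = step_on_mono(2)[OF this]
    have "\<tau> i \<in> {0..}" "\<tau> (Suc i) \<in> {0..}" if "i < n" for i using nn[of i i] nn[of "Suc i" "Suc i"] that by auto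
    then show ?thesis unfolding r step_integral_def by simp
  qed
  ultimately have ind: "indep_vars (\<lambda>_. borel) (\<lambda>i. step_integral (\<beta> i) (r i)) {k, j}" by simp
  have int: "integrable M (step_integral (\<beta> i) (r i))" if "i \<in> {k, j}" for i
  proof -
    have "brownian_motion M (\<beta> i)" "step_on T (r i)" using that bm p q by (auto simp: r_def)
    from step_isometry(1,2)[OF this] show ?thesis by (rule square_integrable_imp_integrable)
  qed
  have "expectation (\<lambda>\<omega>. \<Prod>i\<in>{k, j}. step_integral (\<beta> i) (r i) \<omega>) =
      (\<Prod>i\<in>{k, j}. expectation (step_integral (\<beta> i) (r i)))"
    using int by (intro indep_vars_lebesgue_integral ind) auto
  then show ?thesis using kj step_isometry(3)[OF bm(1) p] by (auto simp: r_def)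
qed

lemma wiener_orthogonal:
  assumes W: "cylindrical_wiener M K e \<beta>" and kj: "k \<in> K" "j \<in> K" "k \<noteq> j"
    and f: "has_wiener_integral M (\<beta> k) T f Y" and g: "has_wiener_integral M (\<beta> j) T g X"
  shows "expectation (\<lambda>\<omega>. Y \<omega> * X \<omega>) = 0"
proof -
  have bm: "brownian_motion M (\<beta> k)" "brownian_motion M (\<beta> j)" using W kj by (auto simp: cylindrical_wiener_def)
  obtain p where p: "\<And>j. step_on T (p j)" "L2_converges M (\<lambda>j. step_integral (\<beta> k) (p j)) Y"
    using f by (auto simp: has_wiener_integral_def)
  obtain q where q: "\<And>j. step_on T (q j)" "L2_converges M (\<lambda>i. step_integral (\<beta> j) (q i)) X"
    using g by (auto simp: has_wiener_integral_def)
  have "(\<lambda>n::nat. 0::real) \<longlonglongrightarrow> expectation (\<lambda>\<omega>. Y \<omega> * X \<omega>)"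
    using L2_converges_inner[OF p(2) q(2) step_isometry(2)[OF bm(1) p(1)] step_isometry(2)[OF bm(2) q(1)]]
      step_orthogonal[OF W kj p(1) q(1)] by simp
  then show ?thesis using LIMSEQ_unique tendsto_const by blast
qed

end

text \<open>The squared norm of \<open>x \<circ> SQ s\<close> as a functional on \<open>H\<close>, by Parseval.\<close>

definition noise_density ::
  "nat set \<Rightarrow> (nat \<Rightarrow> 'h::real_normed_vector) \<Rightarrow> (real \<Rightarrow> 'h \<Rightarrow>\<^sub>L 'e::real_normed_vector) \<Rightarrow>
    ('e \<Rightarrow>\<^sub>L real) \<Rightarrow> real \<Rightarrow> ennreal" where
  "noise_density K e SQ x s = (\<Sum>k. if k \<in> K then ennreal ((blinfun_apply x (SQ s (e k)))\<^sup>2) else 0)"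

text \<open>The one-dimensional integrals are orthogonal in \<open>k\<close>, so the variances of
  the partial sums are the partial sums of a nonnegative series of integrals; sum and integral are
  then exchanged.\<close>

lemma (in prob_space) stochastic_convolution_variance:
  fixes SQ :: "real \<Rightarrow> 'h::real_inner \<Rightarrow>\<^sub>L 'e::real_normed_vector" and x :: "'e \<Rightarrow>\<^sub>L real"
  assumes W: "cylindrical_wiener M K e \<beta>" and c: "stochastic_convolution M K e \<beta> SQ t Z"
  shows "expectation (\<lambda>\<omega>. blinfun_apply x (Z \<omega>)) = 0"
    and "ennreal (expectation (\<lambda>\<omega>. (blinfun_apply x (Z \<omega>))\<^sup>2)) =
      (\<integral>\<^sup>+s. noise_density K e SQ x (t - s) * indicator {0..t} s \<partial>lborel)"
proof -
  define f where "f k s = blinfun_apply x (SQ (t - s) (e k))" for k s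
  define N where "N = restrict_space lborel {0..t}"
  obtain Y where Y: "\<forall>k\<in>K. has_wiener_integral M (\<beta> k) t (f k) (Y k)"
    "L2_converges M (\<lambda>n \<omega>. \<Sum>k\<in>K \<inter> {..<n}. Y k \<omega>) (\<lambda>\<omega>. blinfun_apply x (Z \<omega>))"
    using c[unfolded stochastic_convolution_def, rule_format, of x] unfolding f_def by blast
  have bm: "brownian_motion M (\<beta> k)" if "k \<in> K" for k using W that by (auto simp: cylindrical_wiener_def)
  have wi: "random_variable borel (Y k)" "integrable M (\<lambda>\<omega>. (Y k \<omega>)\<^sup>2)" "expectation (Y k) = 0"
      "f k \<in> borel_measurable N" "integrable N (\<lambda>s. (f k s)\<^sup>2)"
      "expectation (\<lambda>\<omega>. (Y k \<omega>)\<^sup>2) = (\<integral>s. (f k s)\<^sup>2 \<partial>N)" if "k \<in> K" for k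
    using wiener_isometry[OF bm[OF that] Y(1)[rule_format, OF that]] unfolding N_def by simp_all
  define S where "S n \<omega> = (\<Sum>k\<in>K \<inter> {..<n}. Y k \<omega>)" for n \<omega>
  have YYi: "integrable M (\<lambda>\<omega>. Y k \<omega> * Y j \<omega>)" if "k \<in> K" "j \<in> K" for k j
    by (rule integrable_mult_of_squares[OF wi(1)[OF that(1)] wi(1)[OF that(2)] wi(2)[OF that(1)] wi(2)[OF that(2)]])
  have YY: "expectation (\<lambda>\<omega>. Y k \<omega> * Y j \<omega>) = (if k = j then (\<integral>s. (f k s)\<^sup>2 \<partial>N) else 0)" if "k \<in> K" "j \<in> K" for k j
    using wi(6)[OF that(1)] wiener_orthogonal[OF W that _ Y(1)[rule_format, OF that(1)] Y(1)[rule_format, OF that(2)]]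
    by (auto simp: power2_eq_square)
  have SS: "(S n \<omega>)\<^sup>2 = (\<Sum>k\<in>K \<inter> {..<n}. \<Sum>j\<in>K \<inter> {..<n}. Y k \<omega> * Y j \<omega>)" for n \<omega>
    by (simp add: S_def power2_eq_square sum_product)
  have S2: "integrable M (\<lambda>\<omega>. (S n \<omega>)\<^sup>2)" for n
    unfolding SS by (intro Bochner_Integration.integrable_sum YYi) auto
  have SE: "expectation (\<lambda>\<omega>. (S n \<omega>)\<^sup>2) = (\<Sum>k\<in>K \<inter> {..<n}. (\<integral>s. (f k s)\<^sup>2 \<partial>N))" for n
  proof -
    have "expectation (\<lambda>\<omega>. (S n \<omega>)\<^sup>2) = (\<Sum>k\<in>K \<inter> {..<n}. \<Sum>j\<in>K \<inter> {..<n}. expectation (\<lambda>\<omega>. Y k \<omega> * Y j \<omega>))"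
      unfolding SS by (rule integral_double_sum) (auto intro: YYi)
    also have "\<dots> = (\<Sum>k\<in>K \<inter> {..<n}. \<Sum>j\<in>K \<inter> {..<n}. if k = j then (\<integral>s. (f k s)\<^sup>2 \<partial>N) else 0)"
      by (intro sum.cong refl YY) auto
    finally show ?thesis by simp
  qed
  have Yi: "integrable M (Y k)" if "k \<in> K" for k
    by (rule square_integrable_imp_integrable[OF wi(1,2)[OF that]])
  have S0: "expectation (S n) = 0" for n
    unfolding S_def[abs_def] using Yi wi(3) by (simp add: Bochner_Integration.integral_sum)
  have L: "L2_converges M S (\<lambda>\<omega>. blinfun_apply x (Z \<omega>))" using Y(2) by (simp add: S_def[abs_def])
  show "expectation (\<lambda>\<omega>. blinfun_apply x (Z \<omega>)) = 0" by (rule L2_converges_mean[OF L S2 S0])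
  have "(\<lambda>n. ennreal (\<Sum>k\<in>K \<inter> {..<n}. (\<integral>s. (f k s)\<^sup>2 \<partial>N))) \<longlonglongrightarrow>
      ennreal (expectation (\<lambda>\<omega>. (blinfun_apply x (Z \<omega>))\<^sup>2))"
    using L2_converges_square(2)[OF L S2] unfolding SE by (rule tendsto_ennrealI)
  moreover have "ennreal (\<Sum>k\<in>K \<inter> {..<n}. (\<integral>s. (f k s)\<^sup>2 \<partial>N)) =
      (\<Sum>k<n. \<integral>\<^sup>+s. (if k \<in> K then ennreal ((f k s)\<^sup>2) else 0) \<partial>N)" for n
  proof -
    have "(\<Sum>k<n. \<integral>\<^sup>+s. (if k \<in> K then ennreal ((f k s)\<^sup>2) else 0) \<partial>N) =
      (\<Sum>k<n. if k \<in> K then ennreal (\<integral>s. (f k s)\<^sup>2 \<partial>N) else 0)"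
      using wi(5) by (intro sum.cong) (auto intro!: nn_integral_eq_integral)
    also have "\<dots> = (\<Sum>k\<in>K \<inter> {..<n}. ennreal (\<integral>s. (f k s)\<^sup>2 \<partial>N))"
      by (simp only: sum.inter_restrict[OF finite_lessThan, symmetric] Int_commute[of K])
    finally show ?thesis by simp
  qed
  ultimately have "(\<lambda>n. \<Sum>k<n. \<integral>\<^sup>+s. (if k \<in> K then ennreal ((f k s)\<^sup>2) else 0) \<partial>N)
      \<longlonglongrightarrow> ennreal (expectation (\<lambda>\<omega>. (blinfun_apply x (Z \<omega>))\<^sup>2))" by simp
  moreover have "(\<lambda>n. \<Sum>k<n. \<integral>\<^sup>+s. (if k \<in> K then ennreal ((f k s)\<^sup>2) else 0) \<partial>N) \<longlonglongrightarrow>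
      (\<Sum>k. \<integral>\<^sup>+s. (if k \<in> K then ennreal ((f k s)\<^sup>2) else 0) \<partial>N)"
    by (intro summable_LIMSEQ summableI)
  ultimately have "ennreal (expectation (\<lambda>\<omega>. (blinfun_apply x (Z \<omega>))\<^sup>2)) =
      (\<Sum>k. \<integral>\<^sup>+s. (if k \<in> K then ennreal ((f k s)\<^sup>2) else 0) \<partial>N)"
    by (rule LIMSEQ_unique)
  also have "\<dots> = (\<integral>\<^sup>+s. (\<Sum>k. if k \<in> K then ennreal ((f k s)\<^sup>2) else 0) \<partial>N)"
  proof (rule nn_integral_suminf[symmetric])
    fix k show "(\<lambda>s. if k \<in> K then ennreal ((f k s)\<^sup>2) else 0) \<in> borel_measurable N"
      using wi(4)[of k] by (cases "k \<in> K") auto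
  qed
  also have "\<dots> = (\<integral>\<^sup>+s. noise_density K e SQ x (t - s) * indicator {0..t} s \<partial>lborel)"
    unfolding N_def noise_density_def f_def by (rule nn_integral_restrict_space) simp
  finally show "ennreal (expectation (\<lambda>\<omega>. (blinfun_apply x (Z \<omega>))\<^sup>2)) =
      (\<integral>\<^sup>+s. noise_density K e SQ x (t - s) * indicator {0..t} s \<partial>lborel)" .
qed

section \<open>Bounded semigroups\<close>

locale bounded_semigroup =
  fixes S :: "real \<Rightarrow> 'e::banach \<Rightarrow>\<^sub>L 'e" and C :: real
  assumes c0: "c0_semigroup S" and bound: "\<And>t. t \<ge> 0 \<Longrightarrow> norm (S t) \<le> C"
begin

lemma S_0 [simp]: "S 0 x = x"
  using c0 by (simp add: c0_semigroup_def)

lemma S_add: "s \<ge> 0 \<Longrightarrow> t \<ge> 0 \<Longrightarrow> S (s + t) x = S s (S t x)"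
  using c0 by (simp add: c0_semigroup_def)

lemma S_comm: "s \<ge> 0 \<Longrightarrow> t \<ge> 0 \<Longrightarrow> S s (S t x) = S t (S s x)"
  using S_add[of s t x] S_add[of t s x] by (simp add: add.commute)

lemma C_nonneg: "C \<ge> 0"
  using bound[of 0] norm_ge_zero[of "S 0"] by linarith

lemma norm_S_le: "t \<ge> 0 \<Longrightarrow> norm (S t x) \<le> C * norm x"
  by (rule order_trans[OF norm_blinfun mult_right_mono]) (auto simp: bound)

text \<open>Right continuity at 0 is transported to any time \<open>a\<close> by \<open>S a\<close>,
  with the uniform bound \<open>C\<close>. Taking \<open>a\<close> to be the smaller of the two
  times treats both sides at once.\<close>

lemma S_continuous_orbit: "continuous_on {0..} (\<lambda>t. S t x)"
proof (rule continuous_onI)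
  fix t \<epsilon> :: real assume t: "t \<in> {0..}" and \<epsilon>: "\<epsilon> > 0"
  have "((\<lambda>t. S t x) \<longlongrightarrow> x) (at_right 0)" using c0 by (simp add: c0_semigroup_def)
  then have "\<forall>\<^sub>F r in at_right 0. dist (S r x) x < \<epsilon> / (C + 1)"
    using \<epsilon> C_nonneg by (intro tendstoD) auto
  then obtain d where d: "d > 0" "\<And>r. 0 < r \<Longrightarrow> r < d \<Longrightarrow> dist (S r x) x < \<epsilon> / (C + 1)"
    by (auto simp: eventually_at_right_field)
  have close: "norm (S r x - x) \<le> \<epsilon> / (C + 1)" if "0 \<le> r" "r < d" for r
    using d(2)[of r] that \<epsilon> C_nonneg by (cases "r = 0") (auto simp: dist_norm)
  have *: "norm (S (a + r) x - S a x) \<le> \<epsilon>" if "a \<ge> 0" "0 \<le> r" "r < d" for a r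
  proof -
    have "S (a + r) x - S a x = S a (S r x - x)" using that by (simp add: S_add blinfun.diff_right)
    then have "norm (S (a + r) x - S a x) \<le> C * (\<epsilon> / (C + 1))"
      using norm_S_le[of a "S r x - x"] mult_left_mono[OF close[OF that(2,3)] C_nonneg] that(1) by simp
    also have "\<dots> \<le> \<epsilon>" using C_nonneg \<epsilon> by (simp add: field_simps)
    finally show ?thesis .
  qed
  show "\<exists>d>0. \<forall>x'\<in>{0..}. dist x' t < d \<longrightarrow> dist (S x' x) (S t x) \<le> \<epsilon>"
  proof (intro exI[of _ d] conjI ballI impI)
    fix s assume s: "s \<in> {0..}" "dist s t < d"
    show "dist (S s x) (S t x) \<le> \<epsilon>"
    proof (cases "s \<ge> t")
      case True
      then show ?thesis using *[of t "s - t"] s t by (simp add: dist_norm)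
    next
      case False
      then show ?thesis using *[of s "t - s"] s t by (simp add: dist_norm norm_minus_commute)
    qed
  qed (rule d)
qed

text \<open>Strong continuity with a moving argument: the increment of the argument is damped
  uniformly by \<open>C\<close>, and the rest is an orbit of a fixed vector.\<close>

lemma continuous_on_S:
  fixes u :: "'t::topological_space \<Rightarrow> real"
  assumes u: "continuous_on X u" and v: "continuous_on X v" and pos: "\<And>t. t \<in> X \<Longrightarrow> u t \<ge> 0"
  shows "continuous_on X (\<lambda>t. S (u t) (v t))"
  unfolding continuous_on_def
proof
  fix t0 assume t0: "t0 \<in> X"
  have "continuous_on X (\<lambda>t. S (u t) (v t0))"
    using continuous_on_compose2[OF S_continuous_orbit[of "v t0"] u] pos by auto
  then have 1: "((\<lambda>t. S (u t) (v t0)) \<longlongrightarrow> S (u t0) (v t0)) (at t0 within X)"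
    using t0 by (simp add: continuous_on_def)
  have "((\<lambda>t. v t - v t0) \<longlongrightarrow> v t0 - v t0) (at t0 within X)"
    using v t0 by (intro tendsto_intros) (simp add: continuous_on_def)
  then have vv: "((\<lambda>t. C * norm (v t - v t0)) \<longlongrightarrow> C * norm (0::'e)) (at t0 within X)"
    by (intro tendsto_intros) simp
  have "((\<lambda>t. S (u t) (v t - v t0)) \<longlongrightarrow> 0) (at t0 within X)"
  proof (rule Lim_null_comparison)
    show "\<forall>\<^sub>F t in at t0 within X. norm (S (u t) (v t - v t0)) \<le> C * norm (v t - v t0)"
      using pos by (auto simp: eventually_at_filter norm_S_le)
  qed (use vv in simp)
  from tendsto_add[OF 1 this]
  show "((\<lambda>t. S (u t) (v t)) \<longlongrightarrow> S (u t0) (v t0)) (at t0 within X)"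
    by (simp add: blinfun.diff_right)
qed

end

section \<open>The noise and the linear responses\<close>

text \<open>Cauchy-Schwarz on finite combinations of basis vectors; the inequality defines a closed
  set and so extends to the closure of their span.\<close>

lemma parseval_bound:
  fixes f :: "'h::real_inner \<Rightarrow>\<^sub>L real"
  assumes e: "complete_orthonormal K e" and Q: "\<And>n. (\<Sum>k\<in>K \<inter> {..<n}. (f (e k))\<^sup>2) \<le> Q"
  shows "(f h)\<^sup>2 \<le> (norm h)\<^sup>2 * Q"
proof -
  have orth: "inner (e i) (e j) = (if i = j then 1 else 0)" if "i \<in> K" "j \<in> K" for i j
    using e that by (simp add: complete_orthonormal_def)
  have Q0: "Q \<ge> 0" using Q[of 0] by simp
  have "(f h)\<^sup>2 \<le> (norm h)\<^sup>2 * Q" if h: "h \<in> span (e ` K)" for h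
  proof -
    obtain t r where t: "finite t" "t \<subseteq> e ` K" and h: "h = (\<Sum>a\<in>t. r a *\<^sub>R a)"
      using h unfolding span_explicit by blast
    obtain A where A: "A \<subseteq> K" "finite A" "t = e ` A" using finite_subset_image[OF t] by blast
    have inj: "inj_on e A" using orth A(1) by (intro inj_onI) (metis subset_iff zero_neq_one)
    define a where "a k = r (e k)" for k
    have h: "h = (\<Sum>k\<in>A. a k *\<^sub>R e k)" unfolding h A(3) a_def using inj by (simp add: sum.reindex)
    have "inner h h = (\<Sum>i\<in>A. \<Sum>j\<in>A. a i * (a j * inner (e j) (e i)))"
      by (simp add: h inner_sum_left inner_sum_right sum_distrib_left mult_ac)
    also have "\<dots> = (\<Sum>i\<in>A. \<Sum>j\<in>A. if i = j then a i * a j else 0)"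
      using orth A(1) by (intro sum.cong refl) (auto simp: subset_iff)
    also have "\<dots> = (\<Sum>i\<in>A. (a i)\<^sup>2)" using A(2) by (simp add: power2_eq_square)
    finally have nh: "(norm h)\<^sup>2 = (\<Sum>i\<in>A. (a i)\<^sup>2)" by (simp add: power2_norm_eq_inner)
    obtain n where "A \<subseteq> {..<n}" using A(2) by (metis finite_nat_iff_bounded)
    then have "(\<Sum>k\<in>A. (f (e k))\<^sup>2) \<le> (\<Sum>k\<in>K \<inter> {..<n}. (f (e k))\<^sup>2)"
      using A by (intro sum_mono2) auto
    then have fQ: "(\<Sum>k\<in>A. (f (e k))\<^sup>2) \<le> Q" using Q[of n] by simp
    have "f h = (\<Sum>k\<in>A. a k * f (e k))" by (simp add: h blinfun.sum_right blinfun.scaleR_right)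
    then have "(f h)\<^sup>2 \<le> (\<Sum>k\<in>A. (a k)\<^sup>2) * (\<Sum>k\<in>A. (f (e k))\<^sup>2)"
      by (simp add: Cauchy_Schwarz_ineq_sum)
    also have "\<dots> \<le> (norm h)\<^sup>2 * Q" unfolding nh using fQ by (intro mult_left_mono sum_nonneg) auto
    finally show ?thesis .
  qed
  then have "span (e ` K) \<subseteq> {h. (f h)\<^sup>2 \<le> (norm h)\<^sup>2 * Q}" by blast
  moreover have "closed {h. (f h)\<^sup>2 \<le> (norm h)\<^sup>2 * Q}"
    by (intro closed_Collect_le continuous_intros)
  ultimately have "closure (span (e ` K)) \<subseteq> {h. (f h)\<^sup>2 \<le> (norm h)\<^sup>2 * Q}" by (rule closure_minimal)
  then show ?thesis using e by (auto simp: complete_orthonormal_def)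
qed

text \<open>Optimising the weight recovers Cauchy-Schwarz from the weighted arithmetic-geometric
  inequality. That inequality is additive and can be integrated in \<open>ennreal\<close> before
  integrability is known.\<close>

lemma square_le_mult_if_amgm:
  fixes a E v :: real
  assumes "a \<ge> 0" "E \<ge> 0" "v \<ge> 0" and amgm: "\<And>c. c > 0 \<Longrightarrow> a \<le> c / 2 * E + v / (2 * c)"
  shows "a\<^sup>2 \<le> E * v"
proof (cases "E > 0 \<and> v > 0")
  case True
  define c where "c = sqrt v / sqrt E"
  have c: "c > 0" using True by (simp add: c_def)
  have "E = sqrt E * sqrt E" "v = sqrt v * sqrt v" using True by auto
  then have "c / 2 * E = sqrt E * sqrt v / 2" "v / (2 * c) = sqrt E * sqrt v / 2"
    using True by (auto simp: c_def field_simps)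
  then have "a \<le> sqrt E * sqrt v" using amgm[OF c] by simp
  then have "a\<^sup>2 \<le> (sqrt E * sqrt v)\<^sup>2" using assms(1) by (intro power_mono) auto
  then show ?thesis using True by (simp add: power_mult_distrib)
next
  case False
  have "a \<le> 0"
  proof (rule ccontr)
    assume a: "\<not> a \<le> 0"
    show False
    proof (cases "E = 0")
      case True
      \<comment> \<open>With E = 0 a large weight, here (v + 1) / a, beats the remaining term; in
        the other degenerate case v = 0, the weight a / E does.\<close>
      have "a \<le> v / (2 * ((v + 1) / a))" using amgm[of "(v + 1) / a"] a True assms by simp
      also have "\<dots> = a * (v / (v + 1)) / 2" using a assms by (simp add: field_simps)
      also have "\<dots> \<le> a * 1 / 2" using a assms by (intro divide_right_mono mult_left_mono) auto
      finally show False using a by simp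
    next
      case E: False
      then have "v = 0" using False assms by auto
      then have "a \<le> a / E / 2 * E" using amgm[of "a / E"] a E assms by simp
      also have "\<dots> = a / 2" using E by simp
      finally show False using a by simp
    qed
  qed
  then show ?thesis using assms by simp
qed

locale noise_semigroup = bounded_semigroup S C for S :: "real \<Rightarrow> 'e::banach \<Rightarrow>\<^sub>L 'e" and C +
  fixes SQ :: "real \<Rightarrow> 'h::{real_inner, complete_space, second_countable_topology} \<Rightarrow>\<^sub>L 'e"
    and K :: "nat set" and e :: "nat \<Rightarrow> 'h"
  assumes SQ: "\<And>s t. s \<ge> 0 \<Longrightarrow> t > 0 \<Longrightarrow> S s o\<^sub>L SQ t = SQ (s + t)"
    and basis: "complete_orthonormal K e"
begin

lemma S_SQ: "s \<ge> 0 \<Longrightarrow> t > 0 \<Longrightarrow> S s (SQ t h) = SQ (s + t) h"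
  using SQ[of s t] by (metis blinfun_apply_blinfun_compose)

text \<open>Near a time t > 0 the map factors through \<open>SQ (t/2) h\<close>, which leaves an
  orbit of \<open>S\<close>.\<close>

lemma SQ_continuous: "continuous_on {0<..} (\<lambda>s. SQ s h)"
  unfolding continuous_on_eq_continuous_at[OF open_greaterThan]
proof
  fix t :: real assume "t \<in> {0<..}"
  then have t: "t > 0" by simp
  have "continuous_on {t/2<..} (\<lambda>s. S (s - t/2) (SQ (t/2) h))"
    by (intro continuous_on_S continuous_intros) auto
  then have "continuous_on {t/2<..} (\<lambda>s. SQ s h)"
    by (rule continuous_on_eq) (use t in \<open>auto simp: S_SQ\<close>)
  then show "isCont (\<lambda>s. SQ s h) t"
    using t by (simp add: continuous_on_eq_continuous_at)
qed

definition q :: "('e \<Rightarrow>\<^sub>L real) \<Rightarrow> real \<Rightarrow> ennreal" where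
  "q = noise_density K e SQ"

text \<open>The variance of x applied to \<open>Z t\<close>, see \<open>V_eq_variance\<close>. With
  values in \<open>ennreal\<close> it is defined before any integrability is known, and the interval
  is open at 0 since \<open>SQ 0\<close> is an arbitrary operator.\<close>

definition V :: "real \<Rightarrow> ('e \<Rightarrow>\<^sub>L real) \<Rightarrow> ennreal" where
  "V t x = (\<integral>\<^sup>+s. q x s * indicator {0<..t} s \<partial>lborel)"

lemma q_measurable [measurable]:
  fixes x :: "'e \<Rightarrow>\<^sub>L real"
  shows "(\<lambda>s. q x s * indicator {0<..} s) \<in> borel_measurable borel"
proof -
  have "(\<lambda>s. indicator {0<..} s *\<^sub>R x (SQ s (e k))) \<in> borel_measurable borel" for k
    by (intro borel_measurable_continuous_on_indicator continuous_intros
        bounded_linear.continuous_on[OF blinfun.bounded_linear_right] SQ_continuous) auto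
  then have [measurable]: "(\<lambda>s. indicator {0<..} s * x (SQ s (e k))) \<in> borel_measurable borel" for k
    by simp
  have "q x s * indicator {0<..} s =
      (\<Sum>k. if k \<in> K then ennreal ((indicator {0<..} s * x (SQ s (e k)))\<^sup>2) else 0)" for s
    by (cases "0 < s") (simp_all add: q_def noise_density_def cong: if_cong)
  then show ?thesis by simp
qed

lemma q_interval_measurable [measurable]: "(\<lambda>s. q x s * indicator {0<..t} s) \<in> borel_measurable borel"
proof -
  have "q x s * indicator {0<..t} s = q x s * indicator {0<..} s * indicator {..t} s" for s
    by (auto simp: indicator_def)
  then show ?thesis by simp
qed

text \<open>Reflection s -> t - s. The closed interval differs from the half-open one by the null
  point s = t, the only one at which \<open>SQ 0\<close> enters.\<close>

lemma V_shift:
  shows "(\<lambda>s. q x (t - s) * indicator {a..<t} s) \<in> borel_measurable borel"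
    and "(\<integral>\<^sup>+s. q x (t - s) * indicator {a..t} s \<partial>lborel) = V (t - a) x"
    and "(\<integral>\<^sup>+s. q x (t - s) * indicator {a..<t} s \<partial>lborel) = V (t - a) x"
proof -
  have e: "q x (t - s) * indicator {a..<t} s = q x (t + (-1) * s) * indicator {0<..t - a} (t + (-1) * s)" for s
    by (auto simp: indicator_def)
  have "(\<lambda>s. q x (t + (-1) * s) * indicator {0<..t - a} (t + (-1) * s)) \<in> borel_measurable borel"
    by (rule measurable_compose[OF _ q_interval_measurable]) simp
  then show "(\<lambda>s. q x (t - s) * indicator {a..<t} s) \<in> borel_measurable borel" unfolding e .
  show 3: "(\<integral>\<^sup>+s. q x (t - s) * indicator {a..<t} s \<partial>lborel) = V (t - a) x"
    unfolding e V_def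
    using nn_integral_real_affine[of "\<lambda>s. q x s * indicator {0<..t - a} s" "-1" t] by simp
  have "AE s in lborel. s \<noteq> t" by (rule AE_lborel_singleton)
  then have "(\<integral>\<^sup>+s. q x (t - s) * indicator {a..t} s \<partial>lborel) = (\<integral>\<^sup>+s. q x (t - s) * indicator {a..<t} s \<partial>lborel)"
    by (intro nn_integral_cong_AE) (auto elim!: eventually_mono simp: indicator_def)
  with 3 show "(\<integral>\<^sup>+s. q x (t - s) * indicator {a..t} s \<partial>lborel) = V (t - a) x" by simp
qed

lemma V_mono: "s \<le> t \<Longrightarrow> V s x \<le> V t x"
  unfolding V_def by (intro nn_integral_mono mult_left_mono) (auto simp: indicator_def)

lemma V_add: "V t (x + y) \<le> 2 * V t x + 2 * V t y"
proof -
  have "q (x + y) s \<le> 2 * q x s + 2 * q y s" for s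
  proof -
    have "q (x + y) s \<le> (\<Sum>k. 2 * (if k \<in> K then ennreal ((x (SQ s (e k)))\<^sup>2) else 0) +
        2 * (if k \<in> K then ennreal ((y (SQ s (e k)))\<^sup>2) else 0))"
      unfolding q_def noise_density_def
    proof (intro suminf_le summableI)
      fix k
      have "ennreal ((x (SQ s (e k)) + y (SQ s (e k)))\<^sup>2) \<le>
          ennreal (2 * (x (SQ s (e k)))\<^sup>2 + 2 * (y (SQ s (e k)))\<^sup>2)"
        by (intro ennreal_leI square_add_le)
      also have "\<dots> = 2 * ennreal ((x (SQ s (e k)))\<^sup>2) + 2 * ennreal ((y (SQ s (e k)))\<^sup>2)"
        by (simp add: ennreal_plus ennreal_mult)
      finally show "(if k \<in> K then ennreal (((x + y) (SQ s (e k)))\<^sup>2) else 0)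
        \<le> 2 * (if k \<in> K then ennreal ((x (SQ s (e k)))\<^sup>2) else 0) +
          2 * (if k \<in> K then ennreal ((y (SQ s (e k)))\<^sup>2) else 0)"
        by (simp add: blinfun.add_left)
    qed
    also have "\<dots> = 2 * q x s + 2 * q y s"
      unfolding q_def noise_density_def
      by (subst suminf_add[symmetric]) (auto simp: ennreal_suminf_cmult)
    finally show ?thesis .
  qed
  then have "V t (x + y) \<le> (\<integral>\<^sup>+s. 2 * (q x s * indicator {0<..t} s) + 2 * (q y s * indicator {0<..t} s) \<partial>lborel)"
    unfolding V_def by (intro nn_integral_mono) (auto simp: indicator_def)
  also have "\<dots> = 2 * V t x + 2 * V t y"
    unfolding V_def by (simp add: nn_integral_add nn_integral_cmult)
  finally show ?thesis .
qed

text \<open>Dominated convergence, which provides no rate; uniformity in x is gained in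
  \<open>V_uniformly_small_time\<close> from total boundedness.\<close>

lemma V_small_time:
  assumes fin: "V T x < \<top>" "T > 0" and \<epsilon>: "\<epsilon> > 0"
  shows "\<exists>h>0. V h x < \<epsilon>"
proof -
  have "(\<lambda>n. \<integral>\<^sup>+s. q x s * indicator {0<..T / real (Suc n)} s \<partial>lborel) \<longlonglongrightarrow> (\<integral>\<^sup>+(s::real). 0 \<partial>lborel)"
  proof (rule nn_integral_dominated_convergence[where w = "\<lambda>s. q x s * indicator {0<..T} s"])
    show "AE s in lborel. q x s * indicator {0<..T / real (Suc n)} s \<le> q x s * indicator {0<..T} s" for n
    proof (intro AE_I2 mult_left_mono)
      fix s :: real
      have "T / real (Suc n) \<le> T" using fin(2) by (simp add: divide_le_eq_numeral field_simps)
      then show "(indicator {0<..T / real (Suc n)} s :: ennreal) \<le> indicator {0<..T} s"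
        by (auto simp: indicator_def)
    qed simp
    show "(\<integral>\<^sup>+s. q x s * indicator {0<..T} s \<partial>lborel) < \<infinity>" using fin by (simp add: V_def)
    show "AE s in lborel. (\<lambda>n. q x s * indicator {0<..T / real (Suc n)} s) \<longlonglongrightarrow> 0"
    proof (rule AE_I2)
      fix s :: real
      show "(\<lambda>n. q x s * indicator {0<..T / real (Suc n)} s) \<longlonglongrightarrow> 0"
      proof (cases "s > 0")
        case True
        have "(\<lambda>n. T / real (Suc n)) \<longlonglongrightarrow> 0" by (rule LIMSEQ_Suc[OF lim_const_over_n])
        then have "\<forall>\<^sub>F n in sequentially. T / real (Suc n) < s" by (rule order_tendstoD) (rule True)
        then have "\<forall>\<^sub>F n in sequentially. q x s * indicator {0<..T / real (Suc n)} s = 0"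
          by eventually_elim (auto simp: indicator_def)
        then show ?thesis by (rule tendsto_eventually)
      qed simp
    qed
  qed auto
  then have "(\<lambda>n. V (T / real (Suc n)) x) \<longlonglongrightarrow> 0" by (simp add: V_def)
  then have "\<forall>\<^sub>F n in sequentially. V (T / real (Suc n)) x < \<epsilon>" by (rule order_tendstoD) (rule \<epsilon>)
  then obtain n where "V (T / real (Suc n)) x < \<epsilon>" by (auto simp: eventually_sequentially)
  then show ?thesis using fin(2) by (intro exI[of _ "T / real (Suc n)"]) auto
qed

lemma q_parseval:
  fixes x :: "'e \<Rightarrow>\<^sub>L real"
  shows "ennreal ((x (SQ s h))\<^sup>2) \<le> ennreal ((norm h)\<^sup>2) * q x s"
proof (cases "q x s")
  case top
  then show ?thesis by (cases "h = 0") (auto simp: ennreal_mult_top)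
next
  case (real Q)
  have "(\<Sum>k\<in>K \<inter> {..<n}. ((x o\<^sub>L SQ s) (e k))\<^sup>2) \<le> Q" for n
  proof -
    have "ennreal (\<Sum>k\<in>K \<inter> {..<n}. ((x o\<^sub>L SQ s) (e k))\<^sup>2) =
        (\<Sum>k<n. if k \<in> K then ennreal ((x (SQ s (e k)))\<^sup>2) else 0)"
      by (simp add: sum.inter_restrict[OF finite_lessThan, symmetric] Int_commute[of K])
    also have "\<dots> \<le> q x s"
      unfolding q_def noise_density_def by (intro sum_le_suminf summableI) auto
    finally show ?thesis using real by simp
  qed
  from parseval_bound[OF basis this, of h] show ?thesis
    using real by (simp add: ennreal_mult[symmetric])
qed

text \<open>Cauchy-Schwarz between the control and the functional x composed with \<open>SQ\<close>.
  It bounds the nonnegative integral of the absolute value for every weight \<open>c\<close>, so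
  integrability and estimate come out together.\<close>

lemma pairing_bound:
  fixes x :: "'e \<Rightarrow>\<^sub>L real"
  assumes w: "set_borel_measurable lborel {a..t} (\<lambda>s. x (SQ (t - s) (\<psi> s)))"
    and i: "set_integrable lborel {a..t} (\<lambda>s. (norm (\<psi> s))\<^sup>2)"
    and v: "V (t - a) x \<le> ennreal v" "v \<ge> 0"
  shows "set_integrable lborel {a..t} (\<lambda>s. x (SQ (t - s) (\<psi> s)))"
    and "(LINT s:{a..t}|lborel. x (SQ (t - s) (\<psi> s)))\<^sup>2 \<le> (LINT s:{a..t}|lborel. (norm (\<psi> s))\<^sup>2) * v"
proof -
  define F where "F s = indicator {a..t} s * x (SQ (t - s) (\<psi> s))" for s
  define E where "E = (LINT s:{a..t}|lborel. (norm (\<psi> s))\<^sup>2)"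
  have E0: "E \<ge> 0" unfolding E_def set_lebesgue_integral_def by (intro integral_nonneg_AE) auto
  have Fm[measurable]: "F \<in> borel_measurable lborel"
    using w by (simp add: set_borel_measurable_def F_def[abs_def])
  have i': "integrable lborel (\<lambda>s. indicator {a..t} s * (norm (\<psi> s))\<^sup>2)"
    using i by (simp add: set_integrable_def)
  then have m[measurable]: "(\<lambda>s. indicator {a..t} s * (norm (\<psi> s))\<^sup>2) \<in> borel_measurable lborel" by auto
  have Ee: "(\<integral>\<^sup>+s. ennreal (indicator {a..t} s * (norm (\<psi> s))\<^sup>2) \<partial>lborel) = ennreal E"
    using nn_integral_eq_integral[OF i'] by (simp add: E_def set_lebesgue_integral_def)
  note [measurable] = V_shift(1)
  have F_le: "(\<integral>\<^sup>+s. ennreal \<bar>F s\<bar> \<partial>lborel) \<le> ennreal (c / 2 * E + v / (2 * c))" if c: "c > 0" for c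
  proof -
    have "(\<integral>\<^sup>+s. ennreal \<bar>F s\<bar> \<partial>lborel) \<le> (\<integral>\<^sup>+s. ennreal (c / 2) * ennreal (indicator {a..t} s * (norm (\<psi> s))\<^sup>2) +
        ennreal (1 / (2 * c)) * (q x (t - s) * indicator {a..<t} s) \<partial>lborel)"
    proof (rule nn_integral_mono_AE)
      have "AE s in lborel. s \<noteq> t" by (rule AE_lborel_singleton)
      then show "AE s in lborel. ennreal \<bar>F s\<bar> \<le> ennreal (c / 2) * ennreal (indicator {a..t} s * (norm (\<psi> s))\<^sup>2) +
        ennreal (1 / (2 * c)) * (q x (t - s) * indicator {a..<t} s)"
      proof eventually_elim
        fix s assume "s \<noteq> t"
        show "ennreal \<bar>F s\<bar> \<le> ennreal (c / 2) * ennreal (indicator {a..t} s * (norm (\<psi> s))\<^sup>2) +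
          ennreal (1 / (2 * c)) * (q x (t - s) * indicator {a..<t} s)"
        proof (cases "s \<in> {a..<t}")
          case True
          show ?thesis
          proof (cases "q x (t - s)")
            case top
            then show ?thesis using True c by (simp add: ennreal_mult_top)
          next
            case (real k)
            have "(x (SQ (t - s) (\<psi> s)))\<^sup>2 \<le> (norm (\<psi> s))\<^sup>2 * k"
              using q_parseval[of x "t - s" "\<psi> s"] real by (simp add: ennreal_mult[symmetric])
            then have "\<bar>x (SQ (t - s) (\<psi> s))\<bar> \<le> sqrt ((norm (\<psi> s))\<^sup>2 * k)"
              by (intro real_le_rsqrt) simp
            then have 1: "\<bar>F s\<bar> \<le> norm (\<psi> s) * sqrt k" using True by (simp add: F_def real_sqrt_mult)
            have "0 \<le> (c * norm (\<psi> s) - sqrt k)\<^sup>2" by simp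
            also have "\<dots> = c\<^sup>2 * (norm (\<psi> s))\<^sup>2 + k - 2 * c * (norm (\<psi> s) * sqrt k)"
              using real by (simp add: power2_diff power_mult_distrib)
            finally have "norm (\<psi> s) * sqrt k \<le> c / 2 * (norm (\<psi> s))\<^sup>2 + 1 / (2 * c) * k"
              using c by (simp add: field_simps power2_eq_square)
            with 1 have "\<bar>F s\<bar> \<le> c / 2 * (norm (\<psi> s))\<^sup>2 + 1 / (2 * c) * k" by linarith
            then have "ennreal \<bar>F s\<bar> \<le> ennreal (c / 2 * (norm (\<psi> s))\<^sup>2 + 1 / (2 * c) * k)" by (rule ennreal_leI)
            also have "\<dots> = ennreal (c / 2) * ennreal ((norm (\<psi> s))\<^sup>2) + ennreal (1 / (2 * c)) * ennreal k"
              using c real by (simp add: ennreal_mult[symmetric])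
            finally show ?thesis using True real by simp
          qed
        next
          case False
          then have "F s = 0" using \<open>s \<noteq> t\<close> by (auto simp: F_def indicator_def)
          then show ?thesis by simp
        qed
      qed
    qed
    also have "\<dots> = ennreal (c / 2) * ennreal E + ennreal (1 / (2 * c)) * V (t - a) x"
      by (simp add: nn_integral_add nn_integral_cmult Ee V_shift(3))
    also have "\<dots> \<le> ennreal (c / 2) * ennreal E + ennreal (1 / (2 * c)) * ennreal v"
      by (intro add_left_mono mult_left_mono v) auto
    also have "\<dots> = ennreal (c / 2 * E + v / (2 * c))"
      using c E0 v by (simp add: ennreal_plus ennreal_mult[symmetric])
    finally show ?thesis .
  qed
  have Fi: "integrable lborel F"
    using F_le[of 1] by (intro integrableI_bounded) (auto intro: le_less_trans)
  then show "set_integrable lborel {a..t} (\<lambda>s. x (SQ (t - s) (\<psi> s)))"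
    by (simp add: set_integrable_def F_def[abs_def])
  have "\<bar>\<integral>s. F s \<partial>lborel\<bar> \<le> c / 2 * E + v / (2 * c)" if c: "c > 0" for c
  proof -
    have "ennreal \<bar>\<integral>s. F s \<partial>lborel\<bar> \<le> ennreal (c / 2 * E + v / (2 * c))"
      using integral_norm_bound_ennreal[OF Fi] F_le[OF c] by (auto intro: order_trans)
    then show ?thesis by (subst (asm) ennreal_le_iff) (use c E0 v in auto)
  qed
  from square_le_mult_if_amgm[OF _ E0 v(2) this]
  show "(LINT s:{a..t}|lborel. x (SQ (t - s) (\<psi> s)))\<^sup>2 \<le> (LINT s:{a..t}|lborel. (norm (\<psi> s))\<^sup>2) * v"
    by (simp add: E_def F_def set_lebesgue_integral_def)
qed

lemma weak_integral_bound:
  fixes x :: "'e \<Rightarrow>\<^sub>L real"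
  assumes w: "has_weak_integral {a..t} (\<lambda>s. SQ (t - s) (\<psi> s)) y"
    and i: "set_integrable lborel {a..t} (\<lambda>s. (norm (\<psi> s))\<^sup>2)"
    and v: "V (t - a) x \<le> ennreal v" "v \<ge> 0"
  shows "(x y)\<^sup>2 \<le> (LINT s:{a..t}|lborel. (norm (\<psi> s))\<^sup>2) * v"
proof -
  have *: "set_integrable lborel {a..t} (\<lambda>s. x (SQ (t - s) (\<psi> s)))"
    "(LINT s:{a..t}|lborel. x (SQ (t - s) (\<psi> s))) = x y"
    using w unfolding has_weak_integral_def by blast+
  then have "set_borel_measurable lborel {a..t} (\<lambda>s. x (SQ (t - s) (\<psi> s)))"
    unfolding set_integrable_def set_borel_measurable_def by (rule_tac borel_measurable_integrable)
  from pairing_bound(2)[OF this i v] show ?thesis by (simp add: *(2))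
qed

end

section \<open>Energies of controls and their linear responses\<close>

context noise_semigroup begin

definition energy :: "real \<Rightarrow> real \<Rightarrow> (real \<Rightarrow> 'h) \<Rightarrow> real" where
  "energy a b \<psi> = (LINT s:{a..b}|lborel. (norm (\<psi> s))\<^sup>2)"

text \<open>The equation with zero initial value and without \<open>F\<close>. Every controlled path
  splits off such a \<open>z\<close>, namely its \<open>residual\<close>.\<close>

definition responds :: "real \<Rightarrow> (real \<Rightarrow> 'h) \<Rightarrow> (real \<Rightarrow> 'e) \<Rightarrow> bool" where
  "responds T \<psi> z \<longleftrightarrow> L2_control T \<psi> \<and>
     (\<forall>t\<in>{0..T}. has_weak_integral {0..t} (\<lambda>s. SQ (t - s) (\<psi> s)) (z t))"

definition responses :: "real \<Rightarrow> real \<Rightarrow> (real \<Rightarrow> 'e) set" where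
  "responses T E = {z. \<exists>\<psi>. responds T \<psi> z \<and> energy 0 T \<psi> \<le> E}"

lemma energy_nonneg: "0 \<le> energy a b \<psi>"
  unfolding energy_def set_lebesgue_integral_def by (intro integral_nonneg_AE) auto

lemma L2_control_integrable:
  "L2_control T \<psi> \<Longrightarrow> 0 \<le> a \<Longrightarrow> b \<le> T \<Longrightarrow> set_integrable lborel {a..b} (\<lambda>s. (norm (\<psi> s))\<^sup>2)"
  unfolding L2_control_def by (elim conjE, rule set_integrable_subset) auto

lemma energy_mono:
  assumes "L2_control T \<psi>" "0 \<le> a" "b \<le> T"
  shows "energy a b \<psi> \<le> energy 0 T \<psi>"
  unfolding energy_def set_lebesgue_integral_def
proof (rule integral_mono)
  show "integrable lborel (\<lambda>s. indicator {a..b} s *\<^sub>R (norm (\<psi> s))\<^sup>2)"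
    "integrable lborel (\<lambda>s. indicator {0..T} s *\<^sub>R (norm (\<psi> s))\<^sup>2)"
    using L2_control_integrable[OF assms] L2_control_integrable[OF assms(1), of 0 T]
    by (simp_all add: set_integrable_def)
qed (use assms in \<open>auto simp: indicator_def\<close>)

text \<open>Testing the integral up to \<open>s\<close> against x composed with
  \<open>S (t - s)\<close> moves this operator through \<open>SQ\<close>, so it equals the part over
  0..s of the integral up to \<open>t\<close>.\<close>

lemma weak_integral_restart:
  assumes st: "0 \<le> s" "s \<le> t"
    and s: "has_weak_integral {0..s} (\<lambda>r. SQ (s - r) (\<psi> r)) y"
    and t: "has_weak_integral {0..t} (\<lambda>r. SQ (t - r) (\<psi> r)) y'"
  shows "has_weak_integral {s..t} (\<lambda>r. SQ (t - r) (\<psi> r)) (y' - S (t - s) y)"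
  unfolding has_weak_integral_def
proof (intro allI conjI)
  fix x :: "'e \<Rightarrow>\<^sub>L real"
  define f where "f r = x (SQ (t - r) (\<psi> r))" for r
  have ft: "set_integrable lborel {0..t} f" "(LINT r:{0..t}|lborel. f r) = x y'"
    using t unfolding has_weak_integral_def f_def[abs_def] by blast+
  show st_int: "set_integrable lborel {s..t} (\<lambda>r. x (SQ (t - r) (\<psi> r)))"
    using ft(1) st unfolding f_def by (rule_tac set_integrable_subset) auto
  have fs: "set_integrable lborel {0..s} f" using ft(1) st by (rule_tac set_integrable_subset) auto
  \<comment> \<open>The point r = s is left out because \<open>S_SQ\<close> needs a strictly
    positive time on \<open>SQ\<close>.\<close>
  have ne: "AE r in lborel. r \<noteq> s" by (rule AE_lborel_singleton)
  have "(LINT r:{0..s}|lborel. f r) = (LINT r:{0..s}|lborel. (x o\<^sub>L S (t - s)) (SQ (s - r) (\<psi> r)))"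
    unfolding set_lebesgue_integral_def
  proof (rule integral_cong_AE)
    show "AE r in lborel. indicator {0..s} r *\<^sub>R f r =
        indicator {0..s} r *\<^sub>R (x o\<^sub>L S (t - s)) (SQ (s - r) (\<psi> r))"
      using ne
    proof eventually_elim
      fix r assume "r \<noteq> s"
      then show "indicator {0..s} r *\<^sub>R f r =
          indicator {0..s} r *\<^sub>R (x o\<^sub>L S (t - s)) (SQ (s - r) (\<psi> r))"
        using S_SQ[of "t - s" "s - r"] st by (auto simp: f_def indicator_def)
    qed
    show "(\<lambda>r. indicator {0..s} r *\<^sub>R f r) \<in> borel_measurable lborel"
      using fs by (auto simp: set_integrable_def)
    show "(\<lambda>r. indicator {0..s} r *\<^sub>R (x o\<^sub>L S (t - s)) (SQ (s - r) (\<psi> r))) \<in> borel_measurable lborel"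
      using s unfolding has_weak_integral_def set_integrable_def by (blast intro: borel_measurable_integrable)
  qed
  also have "\<dots> = (x o\<^sub>L S (t - s)) y" using s unfolding has_weak_integral_def by blast
  also have "\<dots> = x (S (t - s) y)" by simp
  finally have s': "(LINT r:{0..s}|lborel. f r) = x (S (t - s) y)" .
  have "(LINT r:{0..t}|lborel. f r) = (LINT r:{0..s}|lborel. f r) + (LINT r:{s..t}|lborel. f r)"
  proof -
    have "(LINT r:{0..s}|lborel. f r) + (LINT r:{s..t}|lborel. f r) =
        (LINT r|lborel. indicator {0..s} r *\<^sub>R f r + indicator {s..t} r *\<^sub>R f r)"
      using fs st_int unfolding set_lebesgue_integral_def set_integrable_def f_def[symmetric] by simp
    also have "\<dots> = (LINT r:{0..t}|lborel. f r)"
      unfolding set_lebesgue_integral_def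
    proof (rule integral_cong_AE)
      show "AE r in lborel. indicator {0..s} r *\<^sub>R f r + indicator {s..t} r *\<^sub>R f r = indicator {0..t} r *\<^sub>R f r"
        using ne by eventually_elim (use st in \<open>auto simp: indicator_def\<close>)
    qed (use fs st_int ft(1) in \<open>auto simp: set_integrable_def f_def[symmetric]\<close>)
    finally show ?thesis by simp
  qed
  then show "(LINT r:{s..t}|lborel. x (SQ (t - r) (\<psi> r))) = x (y' - S (t - s) y)"
    using ft(2) s' by (simp add: f_def blinfun.diff_right)
qed

lemma responds_increment:
  assumes z: "responds T \<psi> z" and st: "0 \<le> s" "s \<le> t" "t \<le> T"
  shows "has_weak_integral {s..t} (\<lambda>r. SQ (t - r) (\<psi> r)) (z t - S (t - s) (z s))"
  using z st unfolding responds_def by (intro weak_integral_restart) auto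

lemma response_increment_bound:
  fixes x :: "'e \<Rightarrow>\<^sub>L real"
  assumes z: "z \<in> responses T E" and st: "0 \<le> s" "s \<le> t" "t \<le> T"
    and v: "V (t - s) x \<le> ennreal v" "v \<ge> 0"
  shows "\<bar>x (z t - S (t - s) (z s))\<bar> \<le> sqrt (E * v)"
proof -
  obtain \<psi> where \<psi>: "responds T \<psi> z" "energy 0 T \<psi> \<le> E" using z by (auto simp: responses_def)
  then have c: "L2_control T \<psi>" by (simp add: responds_def)
  have "(x (z t - S (t - s) (z s)))\<^sup>2 \<le> energy s t \<psi> * v"
    unfolding energy_def
    by (rule weak_integral_bound[OF responds_increment[OF \<psi>(1) st] L2_control_integrable[OF c] v]) (use st in auto)
  also have "\<dots> \<le> E * v" using energy_mono[OF c, of s t] \<psi>(2) st v by (intro mult_right_mono) auto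
  finally show ?thesis by (intro real_le_rsqrt) simp
qed

lemma response_valueI:
  assumes "z \<in> responses T E" "t \<in> {0..T}"
  shows "z t \<in> (\<Union>z\<in>responses T E. z ` {0..T})"
  using assms(1) by (rule UN_I) (rule imageI[OF assms(2)])

lemma response_bound:
  fixes x :: "'e \<Rightarrow>\<^sub>L real"
  assumes z: "z \<in> responses T E" and t: "0 \<le> t" "t \<le> T"
    and v: "V T x \<le> ennreal v" "v \<ge> 0"
  shows "\<bar>x (z t)\<bar> \<le> sqrt (E * v)"
proof -
  obtain \<psi> where \<psi>: "responds T \<psi> z" "energy 0 T \<psi> \<le> E" using z by (auto simp: responses_def)
  then have c: "L2_control T \<psi>" by (simp add: responds_def)
  have w: "has_weak_integral {0..t} (\<lambda>s. SQ (t - s) (\<psi> s)) (z t)" using \<psi>(1) t by (auto simp: responds_def)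
  have "V (t - 0) x \<le> ennreal v" using V_mono[OF t(2), of x] v(1) by simp
  from weak_integral_bound[OF w L2_control_integrable[OF c order_refl t(2)] this v(2)]
  have "(x (z t))\<^sup>2 \<le> energy 0 t \<psi> * v" by (simp add: energy_def)
  also have "\<dots> \<le> E * v" using energy_mono[OF c, of 0 t] \<psi>(2) t v by (intro mult_right_mono) auto
  finally show ?thesis by (intro real_le_rsqrt) simp
qed

end

section \<open>Total boundedness of the responses\<close>

lemma sqrt_tolerance:
  fixes E \<delta> :: real
  assumes "E \<ge> 0" "\<delta> > 0"
  shows "sqrt (E * (\<delta>\<^sup>2 / (16 * (E + 1)))) \<le> \<delta> / 4"
proof (rule real_le_lsqrt)
  \<comment> \<open>The summand 1 in E + 1 admits energy 0. This tolerance for \<open>V\<close>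
    makes an error in a pairing at most a quarter of \<delta>.\<close>
  have "E * (\<delta>\<^sup>2 / (16 * (E + 1))) = (\<delta> / 4)\<^sup>2 * (E / (E + 1))" by (simp add: power_divide)
  also have "\<dots> \<le> (\<delta> / 4)\<^sup>2 * 1" using assms by (intro mult_left_mono) auto
  finally show "E * (\<delta>\<^sup>2 / (16 * (E + 1))) \<le> (\<delta> / 4)\<^sup>2" by simp
qed (use assms in auto)

text \<open>The deterministic interface to the noise: what Gaussianity gives for \<open>V\<close>,
  and the recovery of a norm from functionals of norm at most 1.\<close>

locale noise_system = noise_semigroup S C SQ K e
  for S :: "real \<Rightarrow> 'e::banach \<Rightarrow>\<^sub>L 'e" and C
    and SQ :: "real \<Rightarrow> 'h::{real_inner, complete_space, second_countable_topology} \<Rightarrow>\<^sub>L 'e" and K e +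
  assumes V_bounded: "\<And>T. T > 0 \<Longrightarrow> \<exists>B. \<forall>x. V T x \<le> ennreal (B * (norm x)\<^sup>2)"
    and V_totally_bounded: "\<And>T. T > 0 \<Longrightarrow>
      totally_bounded_wrt (\<lambda>x y. enn2real (V T (x - y))) (cball 0 1)"
    and norming: "\<And>y c. (\<And>x :: 'e \<Rightarrow>\<^sub>L real. norm x \<le> 1 \<Longrightarrow> blinfun_apply x y \<le> c) \<Longrightarrow> norm y \<le> c"
begin

text \<open>One representative per colour gives a finite net in the dual ball; finiteness of
  \<open>V\<close> lets the bound on \<open>enn2real\<close> be read in
  \<open>ennreal\<close>.\<close>

lemma V_representatives:
  assumes "T > 0" "\<epsilon> > 0"
  shows "\<exists>X. finite X \<and> X \<subseteq> cball 0 1 \<and> (\<forall>x\<in>cball 0 1. \<exists>x'\<in>X. V T (x - x') \<le> ennreal \<epsilon>)"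
proof -
  let ?A = "cball 0 1 :: ('e \<Rightarrow>\<^sub>L real) set"
  obtain c :: "('e \<Rightarrow>\<^sub>L real) \<Rightarrow> nat" where c: "finite (c ` ?A)"
    "\<forall>x\<in>?A. \<forall>y\<in>?A. c x = c y \<longrightarrow> enn2real (V T (x - y)) \<le> \<epsilon>"
    using V_totally_bounded[OF assms(1), unfolded totally_bounded_wrt_def] assms(2) by blast
  define rep where "rep x = inv_into ?A c (c x)" for x
  have rep: "rep x \<in> ?A" "c (rep x) = c x" if "x \<in> ?A" for x
    unfolding rep_def using imageI[OF that, of c] by (rule inv_into_into, rule f_inv_into_f)
  have "rep ` ?A = inv_into ?A c ` c ` ?A" by (auto simp: rep_def)
  then have fin: "finite (rep ` ?A)" using c(1) by simp
  have "V T (x - rep x) \<le> ennreal \<epsilon>" if "x \<in> ?A" for x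
  proof -
    obtain B where "V T (x - rep x) \<le> ennreal (B * (norm (x - rep x))\<^sup>2)" using V_bounded[OF assms(1)] by blast
    then have "V T (x - rep x) < \<top>" using le_less_trans ennreal_less_top by blast
    moreover have "enn2real (V T (x - rep x)) \<le> \<epsilon>" using c(2) rep[OF that] that by metis
    ultimately show ?thesis by (metis ennreal_enn2real ennreal_leI)
  qed
  then show ?thesis using fin rep by (intro exI[of _ "rep ` ?A"]) blast
qed

text \<open>Pointwise smallness at the finitely many points of a net gives a common time. The
  distance to the net is measured at time 1 and only decreases at shorter times; quarters compensate
  the factors 2 in \<open>V_add\<close>.\<close>

lemma V_uniformly_small_time:
  assumes "\<epsilon> > 0"
  shows "\<exists>h>0. \<forall>x. norm x \<le> 1 \<longrightarrow> V h x \<le> ennreal \<epsilon>"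
proof -
  have "\<epsilon> / 4 > 0" using assms by simp
  from V_representatives[OF zero_less_one this] obtain X where
    X: "finite X" "\<forall>x\<in>cball 0 1. \<exists>x'\<in>X. V 1 (x - x') \<le> ennreal (\<epsilon> / 4)" by blast
  have "\<exists>h>0. V h x < ennreal (\<epsilon> / 4)" for x
  proof (rule V_small_time[of 1])
    obtain B where "V 1 x \<le> ennreal (B * (norm x)\<^sup>2)" using V_bounded[OF zero_less_one] by blast
    then show "V 1 x < \<top>" using le_less_trans ennreal_less_top by blast
  qed (use assms in auto)
  then obtain h where h: "\<And>x. h x > 0" "\<And>x. V (h x) x < ennreal (\<epsilon> / 4)" by metis
  define h0 where "h0 = Min (insert 1 (h ` X))"
  have h0: "h0 > 0" "h0 \<le> 1" "\<And>x. x \<in> X \<Longrightarrow> h0 \<le> h x"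
    using X(1) h(1) by (auto simp: h0_def)
  have "V h0 x \<le> ennreal \<epsilon>" if x: "norm x \<le> 1" for x
  proof -
    have "x \<in> cball 0 1" using x by simp
    then obtain x' where x': "x' \<in> X" "V 1 (x - x') \<le> ennreal (\<epsilon> / 4)" using X(2) by blast
    have "V h0 x = V h0 (x' + (x - x'))" by simp
    also have "\<dots> \<le> 2 * V h0 x' + 2 * V h0 (x - x')" by (rule V_add)
    also have "\<dots> \<le> 2 * ennreal (\<epsilon> / 4) + 2 * ennreal (\<epsilon> / 4)"
      using V_mono[OF h0(3)[OF x'(1)], of x'] h(2)[of x'] V_mono[OF h0(2), of "x - x'"] x'(2)
      by (intro add_mono mult_left_mono) (auto intro: order_trans less_imp_le)
    also have "\<dots> = ennreal (2 * (\<epsilon> / 4) + 2 * (\<epsilon> / 4))"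
      using assms by (simp add: ennreal_mult[symmetric] flip: ennreal_plus ennreal_numeral)
    also have "\<dots> = ennreal \<epsilon>" by simp
    finally show ?thesis .
  qed
  then show ?thesis using h0(1) by blast
qed

text \<open>The constant \<open>B\<close> is chosen before the energy \<open>E\<close>, so small
  energy forces small responses; \<open>unit_growth_small\<close> relies on this.\<close>

lemma responses_bounded:
  assumes "T > 0"
  shows "\<exists>B\<ge>0. \<forall>E. \<forall>z\<in>responses T E. \<forall>t\<in>{0..T}. norm (z t) \<le> sqrt (E * B)"
proof -
  obtain B where B: "\<And>x. V T x \<le> ennreal (B * (norm x)\<^sup>2)" using V_bounded[OF assms] by blast
  have "norm (z t) \<le> sqrt (E * max B 0)" if "z \<in> responses T E" "t \<in> {0..T}" for E z t
  proof (rule norming)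
    fix x :: "'e \<Rightarrow>\<^sub>L real" assume x: "norm x \<le> 1"
    have "B * (norm x)\<^sup>2 \<le> max B 0 * 1"
      using x by (intro mult_mono) (auto simp: power_le_one)
    then have "V T x \<le> ennreal (max B 0)" by (intro order_trans[OF B] ennreal_leI) simp
    then have "\<bar>x (z t)\<bar> \<le> sqrt (E * max B 0)" using that by (intro response_bound) auto
    then show "x (z t) \<le> sqrt (E * max B 0)" by (rule abs_le_D1)
  qed
  then show ?thesis by (intro exI[of _ "max B 0"]) auto
qed

text \<open>The exchange of Schauder's theorem on adjoints: the dual ball has a finite net for
  \<open>V\<close>, so a value is described up to \<delta> by its rounded pairings with the net.
  Rounding costs \<delta>/2, and replacing a functional by its representative costs \<delta>/4 for
  each of the two values.\<close>

lemma response_values_totally_bounded: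
  assumes "T > 0" "E \<ge> 0"
  shows "totally_bounded_wrt dist (\<Union>z\<in>responses T E. z ` {0..T})"
  unfolding totally_bounded_wrt_def
proof (intro allI impI)
  fix \<delta> :: real assume \<delta>: "\<delta> > 0"
  define \<Lambda> where "\<Lambda> = (\<Union>z\<in>responses T E. z ` {0..T})"
  define \<eta> where "\<eta> = \<delta>\<^sup>2 / (16 * (E + 1))"
  have \<eta>: "\<eta> > 0" "sqrt (E * \<eta>) \<le> \<delta> / 4" using \<delta> assms sqrt_tolerance by (auto simp: \<eta>_def)
  obtain X where X: "finite X" "X \<subseteq> cball 0 1" "\<forall>x\<in>cball 0 1. \<exists>x'\<in>X. V T (x - x') \<le> ennreal \<eta>"
    using V_representatives[OF assms(1) \<eta>(1)] by blast
  obtain B0 where B0: "\<forall>E. \<forall>z\<in>responses T E. \<forall>t\<in>{0..T}. norm (z t) \<le> sqrt (E * B0)"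
    using responses_bounded[OF assms(1)] by blast
  define B where "B = sqrt (E * B0)"
  have B: "norm y \<le> B" if "y \<in> \<Lambda>" for y
    using that B0 unfolding \<Lambda>_def B_def by auto
  define g where "g x y = \<lfloor>blinfun_apply x y / (\<delta> / 2)\<rfloor>" for x :: "'e \<Rightarrow>\<^sub>L real" and y
  define f where "f y = (\<lambda>x\<in>X. g x y)" for y
  have "f ` \<Lambda> \<subseteq> (\<Pi>\<^sub>E x\<in>X. g x ` \<Lambda>)"
  proof (rule image_subsetI)
    fix y assume "y \<in> \<Lambda>"
    then have "g x y \<in> g x ` \<Lambda>" for x by (rule imageI)
    then show "f y \<in> (\<Pi>\<^sub>E x\<in>X. g x ` \<Lambda>)" by (auto simp: f_def)
  qed
  moreover have "finite (\<Pi>\<^sub>E x\<in>X. g x ` \<Lambda>)"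
    unfolding g_def[abs_def]
  proof (intro finite_PiE X(1) finite_floor_range)
    fix x y assume xy: "x \<in> X" "y \<in> \<Lambda>"
    have "norm x \<le> 1" using xy X(2) by auto
    then have "norm x * norm y \<le> 1 * B" using B[OF xy(2)] by (intro mult_mono) auto
    then have "\<bar>x y\<bar> \<le> B" using norm_blinfun[of x y] by simp
    then have "\<bar>x y\<bar> / (\<delta> / 2) \<le> B / (\<delta> / 2)" using \<delta> by (intro divide_right_mono) auto
    then show "\<bar>x y / (\<delta> / 2)\<bar> \<le> B / (\<delta> / 2)" using \<delta> by simp
  qed
  ultimately have "finite (f ` \<Lambda>)" by (rule finite_subset)
  from finite_colouring_nat[OF this] obtain c :: "'e \<Rightarrow> nat" where
    c: "finite (c ` \<Lambda>)" "\<forall>x\<in>\<Lambda>. \<forall>y\<in>\<Lambda>. c x = c y \<longrightarrow> f x = f y" by blast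
  have "dist y y' \<le> \<delta>" if y: "y \<in> \<Lambda>" "y' \<in> \<Lambda>" "c y = c y'" for y y'
    unfolding dist_norm
  proof (rule norming)
    fix x :: "'e \<Rightarrow>\<^sub>L real" assume x: "norm x \<le> 1"
    have "x \<in> cball 0 1" using x by simp
    then obtain x' where x': "x' \<in> X" "V T (x - x') \<le> ennreal \<eta>" using X(3) by blast
    have small: "\<bar>(x - x') w\<bar> \<le> \<delta> / 4" if w0: "w \<in> \<Lambda>" for w
    proof -
      obtain z t where w: "z \<in> responses T E" "t \<in> {0..T}" "w = z t"
        using w0 unfolding \<Lambda>_def by (elim UN_E imageE)
      have "\<bar>(x - x') w\<bar> \<le> sqrt (E * \<eta>)"
        unfolding w(3) using w(1,2) x'(2) \<eta>(1) by (intro response_bound) auto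
      then show ?thesis using \<eta>(2) by linarith
    qed
    have "f y = f y'" using c(2) y by blast
    from fun_cong[OF this, of x'] x' have "\<lfloor>x' y / (\<delta> / 2)\<rfloor> = \<lfloor>x' y' / (\<delta> / 2)\<rfloor>" by (simp add: f_def g_def)
    with \<delta> have "\<bar>x' y - x' y'\<bar> < \<delta> / 2" by (intro floor_divide_eq_imp_close) auto
    then show "x (y - y') \<le> \<delta>" using small[OF y(1)] small[OF y(2)]
      unfolding blinfun.diff_right blinfun.diff_left by linarith
  qed
  with c(1) show "\<exists>c::'e \<Rightarrow> nat. finite (c ` (\<Union>z\<in>responses T E. z ` {0..T})) \<and>
      (\<forall>x\<in>(\<Union>z\<in>responses T E. z ` {0..T}). \<forall>y\<in>(\<Union>z\<in>responses T E. z ` {0..T}).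
         c x = c y \<longrightarrow> dist x y \<le> \<delta>)"
    unfolding \<Lambda>_def[symmetric] by blast
qed

text \<open>Colour the values at the points of a grid. Between grid points a response is the grid
  value moved by \<open>S\<close> plus an increment that is small uniformly by
  \<open>V_uniformly_small_time\<close>. The difference of two grid values is amplified at most by
  \<open>C\<close>, whence the tolerance \<delta> / (2 * (C + 1)).\<close>

lemma responses_totally_bounded:
  assumes "T > 0" "E \<ge> 0" and \<delta>: "\<delta> > 0"
  shows "\<exists>c :: (real \<Rightarrow> 'e) \<Rightarrow> nat. finite (c ` responses T E) \<and>
    (\<forall>z\<in>responses T E. \<forall>z'\<in>responses T E. c z = c z' \<longrightarrow> (\<forall>t\<in>{0..T}. norm (z t - z' t) \<le> \<delta>))"
proof -
  define \<Lambda> where "\<Lambda> = (\<Union>z\<in>responses T E. z ` {0..T})"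
  define \<eta> where "\<eta> = \<delta>\<^sup>2 / (16 * (E + 1))"
  have \<eta>: "\<eta> > 0" "sqrt (E * \<eta>) \<le> \<delta> / 4" using \<delta> assms sqrt_tolerance by (auto simp: \<eta>_def)
  obtain h where h: "h > 0" "\<And>x. norm x \<le> 1 \<Longrightarrow> V h x \<le> ennreal \<eta>"
    using V_uniformly_small_time[OF \<eta>(1)] by blast
  have "\<delta> / (2 * (C + 1)) > 0" using \<delta> C_nonneg by simp
  then have "\<exists>c :: 'e \<Rightarrow> nat. finite (c ` \<Lambda>) \<and>
      (\<forall>x\<in>\<Lambda>. \<forall>y\<in>\<Lambda>. c x = c y \<longrightarrow> dist x y \<le> \<delta> / (2 * (C + 1)))"
    using response_values_totally_bounded[OF assms(1,2), unfolded totally_bounded_wrt_def, rule_format]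
    unfolding \<Lambda>_def by simp
  then obtain c :: "'e \<Rightarrow> nat" where c: "finite (c ` \<Lambda>)"
    "\<forall>x\<in>\<Lambda>. \<forall>y\<in>\<Lambda>. c x = c y \<longrightarrow> dist x y \<le> \<delta> / (2 * (C + 1))" by (elim exE conjE)
  define N where "N = nat \<lfloor>T / h\<rfloor>"
  define \<tau> where "\<tau> i = min (real i * h) T" for i
  have \<tau>: "\<tau> i \<in> {0..T}" for i using assms h by (auto simp: \<tau>_def)
  define f where "f z = (\<lambda>i\<in>{..N}. c (z (\<tau> i)))" for z
  have "f ` responses T E \<subseteq> (\<Pi>\<^sub>E i\<in>{..N}. c ` \<Lambda>)"
  proof (rule image_subsetI)
    fix z assume "z \<in> responses T E"
    then have "z (\<tau> i) \<in> \<Lambda>" for i using \<tau>[of i] unfolding \<Lambda>_def by (rule response_valueI)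
    then have "c (z (\<tau> i)) \<in> c ` \<Lambda>" for i by (rule imageI)
    then show "f z \<in> (\<Pi>\<^sub>E i\<in>{..N}. c ` \<Lambda>)" by (auto simp: f_def)
  qed
  moreover have "finite (\<Pi>\<^sub>E i\<in>{..N}. c ` \<Lambda>)" using c(1) by (intro finite_PiE) auto
  ultimately have "finite (f ` responses T E)" by (rule finite_subset)
  from finite_colouring_nat[OF this] obtain k :: "(real \<Rightarrow> 'e) \<Rightarrow> nat" where
    k: "finite (k ` responses T E)" "\<forall>x\<in>responses T E. \<forall>y\<in>responses T E. k x = k y \<longrightarrow> f x = f y" by blast
  have "norm (z t - z' t) \<le> \<delta>" if z: "z \<in> responses T E" "z' \<in> responses T E" "k z = k z'" and t: "t \<in> {0..T}" for z z' t
  proof -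
    define i where "i = nat \<lfloor>t / h\<rfloor>"
    have "t / h \<le> T / h" using t h by (intro divide_right_mono) auto
    then have iN: "i \<le> N" unfolding i_def N_def by (intro nat_mono floor_mono)
    have "real i = of_int \<lfloor>t / h\<rfloor>" using t h by (simp add: i_def)
    then have "real i \<le> t / h" "t / h < real i + 1" by linarith+
    then have ih: "real i * h \<le> t" "t < real i * h + h" using h by (simp_all add: field_simps)
    then have \<tau>i: "\<tau> i = real i * h" using t by (simp add: \<tau>_def)
    have th: "0 \<le> \<tau> i" "\<tau> i \<le> t" "t - \<tau> i \<le> h" using ih h by (auto simp: \<tau>i)
    have "f z = f z'" using k(2) z by blast
    from fun_cong[OF this, of i] iN have "c (z (\<tau> i)) = c (z' (\<tau> i))" by (simp add: f_def)
    moreover have "z (\<tau> i) \<in> \<Lambda>" "z' (\<tau> i) \<in> \<Lambda>" using z \<tau> unfolding \<Lambda>_def by (blast intro: response_valueI)+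
    ultimately have close: "norm (z (\<tau> i) - z' (\<tau> i)) \<le> \<delta> / (2 * (C + 1))"
      using c(2)[rule_format] by (simp only: dist_norm)
    have "norm (S (t - \<tau> i) (z (\<tau> i) - z' (\<tau> i))) \<le> C * (\<delta> / (2 * (C + 1)))"
      using norm_S_le[of "t - \<tau> i" "z (\<tau> i) - z' (\<tau> i)"] mult_left_mono[OF close C_nonneg] th by simp
    also have "\<dots> \<le> \<delta> / 2" using \<delta> C_nonneg by (simp add: field_simps)
    finally have 1: "norm (S (t - \<tau> i) (z (\<tau> i) - z' (\<tau> i))) \<le> \<delta> / 2" .
    have 2: "norm (w t - S (t - \<tau> i) (w (\<tau> i))) \<le> \<delta> / 4" if w: "w \<in> responses T E" for w
    proof (rule norming)
      fix x :: "'e \<Rightarrow>\<^sub>L real" assume x: "norm x \<le> 1"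
      have "V (t - \<tau> i) x \<le> ennreal \<eta>" using V_mono[OF th(3), of x] h(2)[OF x] by simp
      from response_increment_bound[OF w th(1,2) _ this] \<eta> t
      show "x (w t - S (t - \<tau> i) (w (\<tau> i))) \<le> \<delta> / 4" by auto
    qed
    have "z t - z' t = (z t - S (t - \<tau> i) (z (\<tau> i))) - (z' t - S (t - \<tau> i) (z' (\<tau> i))) +
        S (t - \<tau> i) (z (\<tau> i) - z' (\<tau> i))" by (simp add: blinfun.diff_right)
    also have "norm \<dots> \<le> norm (z t - S (t - \<tau> i) (z (\<tau> i))) + norm (z' t - S (t - \<tau> i) (z' (\<tau> i))) +
        norm (S (t - \<tau> i) (z (\<tau> i) - z' (\<tau> i)))"
      by (intro order_trans[OF norm_triangle_ineq] add_right_mono norm_triangle_ineq4)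
    also have "\<dots> \<le> \<delta> / 4 + \<delta> / 4 + \<delta> / 2"
      by (intro add_mono 1 2 z)
    finally show ?thesis by simp
  qed
  then show ?thesis by (intro exI[of _ k] conjI k(1)) simp
qed

end

section \<open>From Gaussian noise to the deterministic interface\<close>

context noise_semigroup begin

lemma V_eq_variance:
  assumes "prob_space M" "cylindrical_wiener M K e \<beta>" "stochastic_convolution M K e \<beta> SQ t Z"
  shows "V t x = ennreal (\<integral>\<omega>. (blinfun_apply x (Z \<omega>))\<^sup>2 \<partial>M)"
  using prob_space.stochastic_convolution_variance(2)[OF assms] V_shift(2)[of x t 0] by (simp add: q_def)

text \<open>The probability space leaves the argument here: the variance identity turns both
  conclusions of \<open>centred_gaussian_totally_bounded\<close> into statements on
  \<open>V\<close>.\<close>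

lemma noise_systemI:
  assumes M: "prob_space M" and W: "cylindrical_wiener M K e \<beta>"
    and conv: "\<And>t. t > 0 \<Longrightarrow> stochastic_convolution M K e \<beta> SQ t (Z t)"
    and gauss: "\<And>t. t > 0 \<Longrightarrow> gaussian_rv M (Z t)"
    and norming: "\<And>y c. (\<And>x :: 'e \<Rightarrow>\<^sub>L real. norm x \<le> 1 \<Longrightarrow> blinfun_apply x y \<le> c) \<Longrightarrow> norm y \<le> c"
  shows "noise_system S C SQ K e"
proof
  interpret prob_space M by (rule M)
  fix T :: real assume T: "T > 0"
  note mean = stochastic_convolution_variance(1)[OF W conv[OF T]]
  note eq = V_eq_variance[OF M W conv[OF T]]
  show "\<exists>B. \<forall>x. V T x \<le> ennreal (B * (norm x)\<^sup>2)"
    unfolding eq using centred_gaussian_totally_bounded(2)[OF gauss[OF T] mean]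
    using ennreal_leI by meson
  have "(\<lambda>x y. enn2real (V T (x - y))) = (\<lambda>x y. expectation (\<lambda>\<omega>. (blinfun_apply (x - y) (Z T \<omega>))\<^sup>2))"
    unfolding eq by (simp add: fun_eq_iff)
  then show "totally_bounded_wrt (\<lambda>x y. enn2real (V T (x - y))) (cball 0 1)"
    using centred_gaussian_totally_bounded(1)[OF gauss[OF T] mean] by simp
qed (rule norming)

end

section \<open>Completeness of square-integrable controls and closedness of the set of
  responses\<close>

lemma L2_complete:
  fixes u :: "nat \<Rightarrow> real \<Rightarrow> 'h::{real_inner, complete_space, second_countable_topology}"
  assumes m[measurable]: "\<And>n. u n \<in> borel_measurable lborel"
    and supp: "\<And>n s. s \<notin> {0..T} \<Longrightarrow> u n s = 0" and "T \<ge> 0"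
    and cauchy: "\<And>\<epsilon>. \<epsilon> > 0 \<Longrightarrow> \<exists>N. \<forall>n\<ge>N. \<forall>k\<ge>N. (\<integral>\<^sup>+s. ennreal ((norm (u n s - u k s))\<^sup>2) \<partial>lborel) \<le> ennreal \<epsilon>"
  shows "\<exists>w. w \<in> borel_measurable lborel \<and> (\<forall>\<epsilon>>0. \<exists>N. \<forall>n\<ge>N. (\<integral>\<^sup>+s. ennreal ((norm (u n s - w s))\<^sup>2) \<partial>lborel) \<le> ennreal \<epsilon>)"
proof -
  have "\<forall>i. \<exists>N. \<forall>n\<ge>N. \<forall>k\<ge>N. (\<integral>\<^sup>+s. ennreal ((norm (u n s - u k s))\<^sup>2) \<partial>lborel) \<le> ennreal ((1/4)^i)"
    using cauchy by simp
  then obtain N where N: "\<And>i n k. n \<ge> N i \<Longrightarrow> k \<ge> N i \<Longrightarrow>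
      (\<integral>\<^sup>+s. ennreal ((norm (u n s - u k s))\<^sup>2) \<partial>lborel) \<le> ennreal ((1/4)^i)" by metis
  \<comment> \<open>The sum dominates \<open>N i\<close> and is monotone in \<open>i\<close>; the
    added \<open>i\<close> makes the indices tend to infinity.\<close>
  define k where "k i = (\<Sum>j\<le>i. N j) + i" for i
  have k_ge: "k i \<ge> N i" "k i \<ge> i" and k_Suc: "k (Suc i) \<ge> k i" for i
    by (auto simp: k_def intro: trans_le_add1 member_le_sum)
  define d where "d i s = norm (u (k (Suc i)) s - u (k i) s)" for i s
  have [measurable]: "d i \<in> borel_measurable lborel" for i unfolding d_def by measurable
  have d_int: "(\<integral>\<^sup>+s. ennreal (d i s) \<partial>lborel) \<le> ennreal ((T + 1) * (1/2)^i)" for i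
  proof -
    \<comment> \<open>Either d <= 2^-i or 2^i * d >= 1. Since squared distances are at most 4^-i,
      integration over the bounded interval yields a summable bound for the L1 distances, hence
      almost everywhere convergence.\<close>
    have pt: "ennreal (d i s) \<le> ennreal ((1/2)^i) * indicator {0..T} s + ennreal (2^i) * ennreal ((d i s)\<^sup>2)" for s
    proof (cases "s \<in> {0..T}")
      case True
      have "d i s \<le> (1/2)^i + 2^i * (d i s)\<^sup>2"
      proof (cases "d i s \<le> (1/2)^i")
        case False
        then have "d i s * 1 \<le> d i s * (2^i * d i s)"
          by (intro mult_left_mono) (auto simp: d_def field_simps power_one_over)
        then have "d i s \<le> 2^i * (d i s)\<^sup>2" by (simp add: power2_eq_square mult_ac)
        then show ?thesis by (rule order_trans) simp
      qed (auto intro: add_increasing2)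
      then have "ennreal (d i s) \<le> ennreal ((1/2)^i + 2^i * (d i s)\<^sup>2)" by (rule ennreal_leI)
      then show ?thesis using True by (simp add: ennreal_plus ennreal_mult)
    next
      case False
      then show ?thesis using supp[OF False] by (simp add: d_def)
    qed
    have "(\<integral>\<^sup>+s. ennreal (d i s) \<partial>lborel) \<le>
        (\<integral>\<^sup>+s. ennreal ((1/2)^i) * indicator {0..T} s + ennreal (2^i) * ennreal ((d i s)\<^sup>2) \<partial>lborel)"
      by (intro nn_integral_mono pt)
    also have "\<dots> = ennreal ((1/2)^i) * ennreal T + ennreal (2^i) * (\<integral>\<^sup>+s. ennreal ((d i s)\<^sup>2) \<partial>lborel)"
      using \<open>T \<ge> 0\<close> by (simp add: nn_integral_add nn_integral_cmult nn_integral_cmult_indicator)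
    also have "\<dots> \<le> ennreal ((1/2)^i) * ennreal T + ennreal (2^i) * ennreal ((1/4)^i)"
      unfolding d_def using k_ge(1)[of i] k_Suc[of i] by (intro add_left_mono mult_left_mono N) auto
    also have "\<dots> = ennreal ((T + 1) * (1/2)^i)"
    proof -
      have "2^i * (1/4)^i = (1/2::real)^i" by (simp add: power_mult_distrib[symmetric])
      then show ?thesis using \<open>T \<ge> 0\<close>
        by (simp add: ennreal_mult[symmetric] flip: ennreal_plus) (simp add: algebra_simps)
    qed
    finally show ?thesis .
  qed
  have "(\<integral>\<^sup>+s. (\<Sum>i. ennreal (d i s)) \<partial>lborel) = (\<Sum>i. \<integral>\<^sup>+s. ennreal (d i s) \<partial>lborel)"
    by (rule nn_integral_suminf) simp
  also have "\<dots> \<le> (\<Sum>i. ennreal ((T + 1) * (1/2)^i))"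
    by (intro suminf_le summableI d_int)
  also have "\<dots> < \<top>"
  proof -
    have "summable (\<lambda>i. (T + 1) * (1/2)^i :: real)" by (intro summable_mult summable_geometric) simp
    then have "(\<Sum>i. ennreal ((T + 1) * (1/2)^i)) = ennreal (\<Sum>i. (T + 1) * (1/2)^i)"
      using \<open>T \<ge> 0\<close> by (intro suminf_ennreal2) auto
    then show ?thesis by simp
  qed
  finally have "AE s in lborel. (\<Sum>i. ennreal (d i s)) \<noteq> \<infinity>"
    by (intro nn_integral_PInf_AE) auto
  then have conv: "AE s in lborel. Cauchy (\<lambda>i. u (k i) s)"
  proof eventually_elim
    fix s assume "(\<Sum>i. ennreal (d i s)) \<noteq> \<infinity>"
    then have "summable (\<lambda>i. d i s)" by (intro summable_suminf_not_top) (auto simp: d_def)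
    then have cD: "Cauchy (\<lambda>n. \<Sum>i<n. d i s)"
      by (simp add: summable_iff_convergent convergent_Cauchy)
    have le: "norm (u (k m) s - u (k n) s) \<le> (\<Sum>i<m. d i s) - (\<Sum>i<n. d i s)" if "n \<le> m" for n m
      using that
    proof (induction m rule: dec_induct)
      case (step m)
      have "norm (u (k (Suc m)) s - u (k n) s) \<le> d m s + norm (u (k m) s - u (k n) s)"
        unfolding d_def using norm_triangle_ineq[of "u (k (Suc m)) s - u (k m) s" "u (k m) s - u (k n) s"] by simp
      then show ?case using step.IH by simp
    qed simp
    show "Cauchy (\<lambda>i. u (k i) s)"
    proof (rule metric_CauchyI)
      fix \<epsilon> :: real assume "\<epsilon> > 0"
      from metric_CauchyD[OF cD this] obtain M where
        M: "\<And>m n. m \<ge> M \<Longrightarrow> n \<ge> M \<Longrightarrow> dist (\<Sum>i<m. d i s) (\<Sum>i<n. d i s) < \<epsilon>" by blast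
      have *: "dist (u (k m) s) (u (k n) s) < \<epsilon>" if "n \<ge> M" "n \<le> m" for m n
        using le[OF that(2)] M[of m n] that by (simp add: dist_norm)
      have "dist (u (k m) s) (u (k n) s) < \<epsilon>" if "m \<ge> M" "n \<ge> M" for m n
        using *[of n m] *[of m n] that by (cases "n \<le> m") (auto simp: dist_commute)
      then show "\<exists>M. \<forall>m\<ge>M. \<forall>n\<ge>M. dist (u (k m) s) (u (k n) s) < \<epsilon>" by blast
    qed
  qed
  \<comment> \<open>The value 0 on the set without convergence keeps \<open>w\<close>
    measurable.\<close>
  define w where "w s = (if Cauchy (\<lambda>i. u (k i) s) then lim (\<lambda>i. u (k i) s) else 0)" for s
  have w_lim: "(\<lambda>i. u (k i) s) \<longlonglongrightarrow> w s" if "Cauchy (\<lambda>i. u (k i) s)" for s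
    using that by (simp add: w_def Cauchy_convergent_iff convergent_LIMSEQ_iff)
  have wm[measurable]: "w \<in> borel_measurable lborel"
  proof (rule borel_measurable_LIMSEQ_metric)
    have [measurable]: "Measurable.pred lborel (\<lambda>s. Cauchy (\<lambda>i. u (k i) s))"
      unfolding pred_def by (rule sets_Collect_Cauchy) simp
    show "(\<lambda>s. if Cauchy (\<lambda>i. u (k i) s) then u (k n) s else 0) \<in> borel_measurable lborel" for n by measurable
    show "(\<lambda>n. if Cauchy (\<lambda>i. u (k i) s) then u (k n) s else 0) \<longlonglongrightarrow> w s" for s
      using w_lim[of s] by (cases "Cauchy (\<lambda>i. u (k i) s)") (auto simp: w_def)
  qed
  have "\<exists>N. \<forall>n\<ge>N. (\<integral>\<^sup>+s. ennreal ((norm (u n s - w s))\<^sup>2) \<partial>lborel) \<le> ennreal \<epsilon>" if \<epsilon>: "\<epsilon> > 0" for \<epsilon>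
  proof -
    obtain M where M: "\<And>n k. n \<ge> M \<Longrightarrow> k \<ge> M \<Longrightarrow> (\<integral>\<^sup>+s. ennreal ((norm (u n s - u k s))\<^sup>2) \<partial>lborel) \<le> ennreal \<epsilon>"
      using cauchy[OF \<epsilon>] by blast
    have "(\<integral>\<^sup>+s. ennreal ((norm (u n s - w s))\<^sup>2) \<partial>lborel) \<le> ennreal \<epsilon>" if n: "n \<ge> M" for n
    proof -
      \<comment> \<open>Fatou's lemma along the subsequence carries the Cauchy estimate of the whole
        sequence over to the limit.\<close>
      have "(\<integral>\<^sup>+s. ennreal ((norm (u n s - w s))\<^sup>2) \<partial>lborel) =
          (\<integral>\<^sup>+s. liminf (\<lambda>i. ennreal ((norm (u n s - u (k i) s))\<^sup>2)) \<partial>lborel)"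
      proof (rule nn_integral_cong_AE)
        show "AE s in lborel. ennreal ((norm (u n s - w s))\<^sup>2) = liminf (\<lambda>i. ennreal ((norm (u n s - u (k i) s))\<^sup>2))"
          using conv
        proof eventually_elim
          fix s assume "Cauchy (\<lambda>i. u (k i) s)"
          from w_lim[OF this] have "(\<lambda>i. ennreal ((norm (u n s - u (k i) s))\<^sup>2)) \<longlonglongrightarrow> ennreal ((norm (u n s - w s))\<^sup>2)"
            by (intro tendsto_intros)
          then show "ennreal ((norm (u n s - w s))\<^sup>2) = liminf (\<lambda>i. ennreal ((norm (u n s - u (k i) s))\<^sup>2))"
            by (rule lim_imp_Liminf[OF sequentially_bot, symmetric])
        qed
      qed
      also have "\<dots> \<le> liminf (\<lambda>i. \<integral>\<^sup>+s. ennreal ((norm (u n s - u (k i) s))\<^sup>2) \<partial>lborel)"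
        by (rule nn_integral_liminf) simp
      also have "\<dots> \<le> ennreal \<epsilon>"
      proof -
        have "\<forall>\<^sub>F i in sequentially. (\<integral>\<^sup>+s. ennreal ((norm (u n s - u (k i) s))\<^sup>2) \<partial>lborel) \<le> ennreal \<epsilon>"
          using eventually_ge_at_top[of M]
        proof eventually_elim
          fix i assume "i \<ge> M"
          then show "(\<integral>\<^sup>+s. ennreal ((norm (u n s - u (k i) s))\<^sup>2) \<partial>lborel) \<le> ennreal \<epsilon>"
            using k_ge(2)[of i] by (intro M n) simp
        qed
        then have "liminf (\<lambda>i. \<integral>\<^sup>+s. ennreal ((norm (u n s - u (k i) s))\<^sup>2) \<partial>lborel) \<le> liminf (\<lambda>i::nat. ennreal \<epsilon>)"
          by (rule Liminf_mono)
        then show ?thesis by (simp add: Liminf_const)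
      qed
      finally show ?thesis .
    qed
    then show ?thesis by blast
  qed
  with wm show ?thesis by blast
qed

lemma has_weak_integral_linear:
  assumes "has_weak_integral B f y" "has_weak_integral B g z"
  shows "has_weak_integral B (\<lambda>s. a *\<^sub>R f s + b *\<^sub>R g s) (a *\<^sub>R y + b *\<^sub>R z)"
  using assms unfolding has_weak_integral_def
  by (auto simp: blinfun.add_right blinfun.scaleR_right set_integral_add)

context noise_semigroup begin

text \<open>The map (s, h) -> \<open>SQ s h\<close> is jointly continuous for s > 0, by factoring
  through half the time, so composition with a measurable control is measurable.\<close>

lemma SQ_pairing_measurable:
  fixes x :: "'e \<Rightarrow>\<^sub>L real"
  assumes w: "w \<in> borel_measurable lborel"
  shows "set_borel_measurable lborel {a..t} (\<lambda>s. x (SQ (t - s) (w s)))"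
proof -
  have "continuous_on ({0<..} \<times> UNIV) (\<lambda>p. SQ (fst p) (snd p))"
  proof (subst continuous_on_eq_continuous_at)
    show "open ({0<..} \<times> (UNIV :: 'h set) :: (real \<times> 'h) set)" by (intro open_Times) auto
    show "\<forall>p\<in>{0<..} \<times> UNIV. isCont (\<lambda>p. SQ (fst p) (snd p)) p"
    proof
      fix p :: "real \<times> 'h" assume p: "p \<in> {0<..} \<times> UNIV"
      define \<delta> where "\<delta> = fst p / 2"
      have \<delta>: "\<delta> > 0" "fst p > \<delta>" using p by (auto simp: \<delta>_def)
      have "continuous_on ({\<delta><..} \<times> UNIV) (\<lambda>p. S (fst p - \<delta>) (SQ \<delta> (snd p)))"
        by (intro continuous_on_S continuous_intros) auto
      then have "continuous_on ({\<delta><..} \<times> UNIV) (\<lambda>p. SQ (fst p) (snd p))"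
        by (rule continuous_on_eq) (use \<delta> in \<open>auto simp: S_SQ\<close>)
      moreover have "open ({\<delta><..} \<times> (UNIV :: 'h set) :: (real \<times> 'h) set)" by (intro open_Times) auto
      moreover have "p \<in> {\<delta><..} \<times> UNIV" using \<delta> by (cases p) auto
      ultimately show "isCont (\<lambda>p. SQ (fst p) (snd p)) p"
        using continuous_on_eq_continuous_at by blast
    qed
  qed
  then have "continuous_on ({0<..} \<times> UNIV) (\<lambda>p. x (SQ (fst p) (snd p)))"
    by (intro bounded_linear.continuous_on[OF blinfun.bounded_linear_right])
  moreover have "{0<..} \<times> UNIV \<in> sets (borel :: (real \<times> 'h) measure)"
    by (intro borel_open open_Times) auto
  ultimately have "(\<lambda>p. indicator ({0<..} \<times> UNIV) p *\<^sub>R x (SQ (fst p) (snd p))) \<in> borel_measurable borel"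
    by (intro borel_measurable_continuous_on_indicator)
  moreover have "(\<lambda>s. (t - s, w s)) \<in> borel_measurable borel"
    using w by (intro borel_measurable_Pair) auto
  ultimately have "(\<lambda>s. indicator ({0<..} \<times> UNIV) (t - s, w s) *\<^sub>R x (SQ (fst (t - s, w s)) (snd (t - s, w s)))) \<in> borel_measurable borel"
    by (rule measurable_compose_rev)
  then have [measurable]: "(\<lambda>s. indicator {..<t} s * x (SQ (t - s) (w s))) \<in> borel_measurable borel"
    by (simp add: indicator_times indicator_def)
  \<comment> \<open>At the single point s = t the operator is \<open>SQ 0\<close>; its contribution
    is split off as a multiple of the indicator of a point.\<close>
  have "indicator {a..t} s *\<^sub>R x (SQ (t - s) (w s)) =
      indicator {a..t} s * (indicator {..<t} s * x (SQ (t - s) (w s))) + indicator ({t} \<inter> {a..}) s * x (SQ 0 (w t))" for s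
    by (auto simp: indicator_def)
  then show ?thesis by (simp add: set_borel_measurable_def)
qed

lemma energy_ennreal:
  assumes "L2_control T \<psi>"
  shows "(\<integral>\<^sup>+s. ennreal ((norm (indicator {0..T} s *\<^sub>R \<psi> s))\<^sup>2) \<partial>lborel) = ennreal (energy 0 T \<psi>)"
proof -
  have "integrable lborel (\<lambda>s. indicator {0..T} s *\<^sub>R (norm (\<psi> s))\<^sup>2)"
    using assms by (simp add: L2_control_def set_integrable_def)
  from nn_integral_eq_integral[OF this]
  have "(\<integral>\<^sup>+s. ennreal (indicator {0..T} s *\<^sub>R (norm (\<psi> s))\<^sup>2) \<partial>lborel) = ennreal (energy 0 T \<psi>)"
    by (simp add: energy_def set_lebesgue_integral_def)
  moreover have "(norm (indicator {0..T} s *\<^sub>R \<psi> s))\<^sup>2 = indicator {0..T} s *\<^sub>R (norm (\<psi> s))\<^sup>2" for s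
    by (simp add: indicator_def)
  ultimately show ?thesis by simp
qed

lemma L2_controlI:
  assumes m: "set_borel_measurable lborel {0..T} \<psi>"
    and fin: "(\<integral>\<^sup>+s. ennreal ((norm (indicator {0..T} s *\<^sub>R \<psi> s))\<^sup>2) \<partial>lborel) \<le> ennreal E"
  shows "L2_control T \<psi>"
proof -
  have m': "(\<lambda>s. indicator {0..T} s *\<^sub>R \<psi> s) \<in> borel_measurable lborel" using m by (simp add: set_borel_measurable_def)
  have "integrable lborel (\<lambda>s. (norm (indicator {0..T} s *\<^sub>R \<psi> s))\<^sup>2)"
  proof (rule integrableI_bounded)
    show "(\<lambda>s. (norm (indicator {0..T} s *\<^sub>R \<psi> s))\<^sup>2) \<in> borel_measurable lborel" using m' by measurable
    show "(\<integral>\<^sup>+s. ennreal (norm ((norm (indicator {0..T} s *\<^sub>R \<psi> s))\<^sup>2)) \<partial>lborel) < \<infinity>"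
      using le_less_trans[OF fin ennreal_less_top] by simp
  qed
  moreover have "(norm (indicator {0..T} s *\<^sub>R \<psi> s))\<^sup>2 = indicator {0..T} s *\<^sub>R (norm (\<psi> s))\<^sup>2" for s
    by (simp add: indicator_def)
  ultimately show ?thesis using m by (simp add: L2_control_def set_integrable_def)
qed

lemma L2_control_linear:
  assumes "L2_control T \<psi>" "L2_control T \<psi>'"
  shows "L2_control T (\<lambda>s. a *\<^sub>R \<psi> s + b *\<^sub>R \<psi>' s)"
proof -
  have m: "(\<lambda>s. indicator {0..T} s *\<^sub>R \<psi> s) \<in> borel_measurable lborel"
    "(\<lambda>s. indicator {0..T} s *\<^sub>R \<psi>' s) \<in> borel_measurable lborel"
    using assms by (auto simp: L2_control_def set_borel_measurable_def)
  have e: "indicator {0..T} s *\<^sub>R (a *\<^sub>R \<psi> s + b *\<^sub>R \<psi>' s) =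
      a *\<^sub>R (indicator {0..T} s *\<^sub>R \<psi> s) + b *\<^sub>R (indicator {0..T} s *\<^sub>R \<psi>' s)" for s
    by (simp add: scaleR_add_right mult.commute)
  have m': "set_borel_measurable lborel {0..T} (\<lambda>s. a *\<^sub>R \<psi> s + b *\<^sub>R \<psi>' s)"
    unfolding set_borel_measurable_def e using m by measurable
  have i: "integrable lborel (\<lambda>s. indicator {0..T} s *\<^sub>R (norm (\<psi> s))\<^sup>2)"
    "integrable lborel (\<lambda>s. indicator {0..T} s *\<^sub>R (norm (\<psi>' s))\<^sup>2)"
    using assms by (auto simp: L2_control_def set_integrable_def)
  have "integrable lborel (\<lambda>s. indicator {0..T} s *\<^sub>R (norm (a *\<^sub>R \<psi> s + b *\<^sub>R \<psi>' s))\<^sup>2)"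
  proof (rule Bochner_Integration.integrable_bound)
    show "integrable lborel (\<lambda>s. 2 * a\<^sup>2 * (indicator {0..T} s *\<^sub>R (norm (\<psi> s))\<^sup>2) +
        2 * b\<^sup>2 * (indicator {0..T} s *\<^sub>R (norm (\<psi>' s))\<^sup>2))"
      using i by auto
    have "(norm (indicator {0..T} s *\<^sub>R (a *\<^sub>R \<psi> s + b *\<^sub>R \<psi>' s)))\<^sup>2 =
      indicator {0..T} s *\<^sub>R (norm (a *\<^sub>R \<psi> s + b *\<^sub>R \<psi>' s))\<^sup>2" for s by (simp add: indicator_def)
    moreover have "(\<lambda>s. (norm (indicator {0..T} s *\<^sub>R (a *\<^sub>R \<psi> s + b *\<^sub>R \<psi>' s)))\<^sup>2) \<in> borel_measurable lborel"
      using m' unfolding set_borel_measurable_def by measurable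
    ultimately show "(\<lambda>s. indicator {0..T} s *\<^sub>R (norm (a *\<^sub>R \<psi> s + b *\<^sub>R \<psi>' s))\<^sup>2) \<in> borel_measurable lborel"
      by simp
    have "(norm (a *\<^sub>R \<psi> s + b *\<^sub>R \<psi>' s))\<^sup>2 \<le> 2 * a\<^sup>2 * (norm (\<psi> s))\<^sup>2 + 2 * b\<^sup>2 * (norm (\<psi>' s))\<^sup>2" for s
    proof -
      have "norm (a *\<^sub>R \<psi> s + b *\<^sub>R \<psi>' s) \<le> \<bar>a\<bar> * norm (\<psi> s) + \<bar>b\<bar> * norm (\<psi>' s)"
        by (rule order_trans[OF norm_triangle_ineq]) simp
      then have "(norm (a *\<^sub>R \<psi> s + b *\<^sub>R \<psi>' s))\<^sup>2 \<le> (\<bar>a\<bar> * norm (\<psi> s) + \<bar>b\<bar> * norm (\<psi>' s))\<^sup>2"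
        by (intro power_mono) auto
      also have "\<dots> \<le> 2 * (\<bar>a\<bar> * norm (\<psi> s))\<^sup>2 + 2 * (\<bar>b\<bar> * norm (\<psi>' s))\<^sup>2" by (rule square_add_le)
      finally show ?thesis by (simp add: power_mult_distrib)
    qed
    then show "AE s in lborel. norm (indicator {0..T} s *\<^sub>R (norm (a *\<^sub>R \<psi> s + b *\<^sub>R \<psi>' s))\<^sup>2) \<le>
        norm (2 * a\<^sup>2 * (indicator {0..T} s *\<^sub>R (norm (\<psi> s))\<^sup>2) + 2 * b\<^sup>2 * (indicator {0..T} s *\<^sub>R (norm (\<psi>' s))\<^sup>2))"
      by (intro AE_I2) (auto simp: indicator_def intro: order_trans)
  qed
  with m' show ?thesis by (simp add: L2_control_def set_integrable_def)
qed

lemma energy_parallelogram: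
  assumes "L2_control T \<psi>" "L2_control T \<psi>'"
  shows "energy 0 T (\<lambda>s. \<psi> s - \<psi>' s) + 4 * energy 0 T (\<lambda>s. (1/2) *\<^sub>R \<psi> s + (1/2) *\<^sub>R \<psi>' s) =
    2 * energy 0 T \<psi> + 2 * energy 0 T \<psi>'"
proof -
  have i: "integrable lborel (\<lambda>s. indicator {0..T} s * (norm (\<phi> s))\<^sup>2)" if "L2_control T \<phi>" for \<phi> :: "real \<Rightarrow> 'h"
    using that by (simp add: L2_control_def set_integrable_def)
  have c: "L2_control T (\<lambda>s. \<psi> s - \<psi>' s)" using L2_control_linear[OF assms, of 1 "-1"] by simp
  note c' = L2_control_linear[OF assms, of "1/2" "1/2"]
  have pt: "(norm (a - b))\<^sup>2 + 4 * (norm ((1/2) *\<^sub>R a + (1/2) *\<^sub>R b))\<^sup>2 = 2 * (norm a)\<^sup>2 + 2 * (norm b)\<^sup>2" for a b :: 'h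
    by (simp add: power2_norm_eq_inner inner_diff_left inner_diff_right inner_add_left inner_add_right inner_commute algebra_simps)
  have "energy 0 T (\<lambda>s. \<psi> s - \<psi>' s) + 4 * energy 0 T (\<lambda>s. (1/2) *\<^sub>R \<psi> s + (1/2) *\<^sub>R \<psi>' s) =
      (\<integral>s. indicator {0..T} s * (norm (\<psi> s - \<psi>' s))\<^sup>2 +
        4 * (indicator {0..T} s * (norm ((1/2) *\<^sub>R \<psi> s + (1/2) *\<^sub>R \<psi>' s))\<^sup>2) \<partial>lborel)"
    using i[OF c] i[OF c'] by (simp add: energy_def set_lebesgue_integral_def)
  also have "\<dots> = (\<integral>s. 2 * (indicator {0..T} s * (norm (\<psi> s))\<^sup>2) + 2 * (indicator {0..T} s * (norm (\<psi>' s))\<^sup>2) \<partial>lborel)"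
    using pt[of "\<psi> _" "\<psi>' _"] by (intro Bochner_Integration.integral_cong) (auto simp: indicator_def)
  also have "\<dots> = 2 * energy 0 T \<psi> + 2 * energy 0 T \<psi>'"
    using i[OF assms(1)] i[OF assms(2)] by (simp add: energy_def set_lebesgue_integral_def)
  finally show ?thesis .
qed

lemma responds_midpoint:
  assumes "responds T \<psi> z" "responds T \<psi>' z'"
  shows "responds T (\<lambda>s. (1/2) *\<^sub>R \<psi> s + (1/2) *\<^sub>R \<psi>' s) (\<lambda>t. (1/2) *\<^sub>R z t + (1/2) *\<^sub>R z' t)"
  unfolding responds_def
proof (intro conjI ballI)
  show "L2_control T (\<lambda>s. (1/2) *\<^sub>R \<psi> s + (1/2) *\<^sub>R \<psi>' s)"
    using assms by (intro L2_control_linear) (auto simp: responds_def)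
  fix t assume "t \<in> {0..T}"
  then have "has_weak_integral {0..t} (\<lambda>s. (1/2) *\<^sub>R SQ (t - s) (\<psi> s) + (1/2) *\<^sub>R SQ (t - s) (\<psi>' s))
      ((1/2) *\<^sub>R z t + (1/2) *\<^sub>R z' t)"
    using assms by (intro has_weak_integral_linear) (auto simp: responds_def)
  then show "has_weak_integral {0..t} (\<lambda>s. SQ (t - s) ((1/2) *\<^sub>R \<psi> s + (1/2) *\<^sub>R \<psi>' s))
      ((1/2) *\<^sub>R z t + (1/2) *\<^sub>R z' t)"
    by (simp add: blinfun.add_right blinfun.scaleR_right)
qed

end

context noise_semigroup begin

lemma L2_control_diff: "L2_control T \<psi> \<Longrightarrow> L2_control T \<psi>' \<Longrightarrow> L2_control T (\<lambda>s. \<psi> s - \<psi>' s)"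
  using L2_control_linear[of T \<psi> \<psi>' 1 "-1"] by simp

text \<open>Young's inequality with weight \<eta>. Letting first the distance and then \<eta> tend
  to 0 shows that energy does not jump up in a mean-square limit of controls.\<close>

lemma energy_le_perturbed:
  assumes c: "L2_control T \<psi>" "L2_control T \<psi>'" and \<eta>: "\<eta> > 0"
  shows "energy 0 T \<psi>' \<le> (1 + \<eta>) * energy 0 T \<psi> + (1 + 1/\<eta>) * energy 0 T (\<lambda>s. \<psi> s - \<psi>' s)"
proof -
  have i: "integrable lborel (\<lambda>s. indicator {0..T} s * (norm (\<phi> s))\<^sup>2)" if "L2_control T \<phi>" for \<phi> :: "real \<Rightarrow> 'h"
    using that by (simp add: L2_control_def set_integrable_def)
  have pt: "(norm b)\<^sup>2 \<le> (1 + \<eta>) * (norm a)\<^sup>2 + (1 + 1/\<eta>) * (norm (a - b))\<^sup>2" for a b :: 'h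
  proof -
    define r s where "r = norm a" "s = norm (a - b)"
    have "norm b \<le> r + s" using norm_triangle_ineq4[of a "a - b"] by (simp add: r_s_def)
    then have "(norm b)\<^sup>2 \<le> (r + s)\<^sup>2" by (intro power_mono) auto
    moreover have "0 \<le> (sqrt \<eta> * r - s / sqrt \<eta>)\<^sup>2" by simp
    then have "2 * r * s \<le> \<eta> * r\<^sup>2 + s\<^sup>2 / \<eta>"
      using \<eta> by (simp add: power2_diff power_mult_distrib power_divide)
    ultimately show ?thesis by (simp add: r_s_def[symmetric] power2_sum algebra_simps)
  qed
  have "energy 0 T \<psi>' \<le> (\<integral>s. (1 + \<eta>) * (indicator {0..T} s * (norm (\<psi> s))\<^sup>2) +
      (1 + 1/\<eta>) * (indicator {0..T} s * (norm (\<psi> s - \<psi>' s))\<^sup>2) \<partial>lborel)"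
    unfolding energy_def set_lebesgue_integral_def
    using i[OF c(1)] i[OF c(2)] i[OF L2_control_diff[OF c]] pt
    by (intro integral_mono) (auto simp: indicator_def)
  also have "\<dots> = (1 + \<eta>) * energy 0 T \<psi> + (1 + 1/\<eta>) * energy 0 T (\<lambda>s. \<psi> s - \<psi>' s)"
    using i[OF c(1)] i[OF L2_control_diff[OF c]] by (simp add: energy_def set_lebesgue_integral_def)
  finally show ?thesis .
qed

end

context noise_system begin

lemma V_finite:
  assumes "T > 0"
  shows "\<exists>v\<ge>0. V T x \<le> ennreal v"
proof -
  obtain B where "\<forall>x. V T x \<le> ennreal (B * (norm x)\<^sup>2)" using V_bounded[OF assms] by blast
  then have "V T x \<le> ennreal (max 0 (B * (norm x)\<^sup>2))" by (rule_tac order_trans) auto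
  then show ?thesis by (intro exI[of _ "max 0 (B * (norm x)\<^sup>2)"]) simp
qed

text \<open>For \<open>w\<close> only scalar pairings appear, since it is not yet known that its
  weak integral has a value in the Banach space; the lemma is what identifies that value in the
  limit.\<close>

lemma energy_controls_response:
  fixes x :: "'e \<Rightarrow>\<^sub>L real"
  assumes \<psi>: "responds T \<psi> z" and w: "L2_control T w" "w \<in> borel_measurable lborel"
    and t: "t \<in> {0..T}" and v: "V T x \<le> ennreal v" "v \<ge> 0"
  shows "set_integrable lborel {0..t} (\<lambda>s. x (SQ (t - s) (w s)))"
    and "\<bar>(LINT s:{0..t}|lborel. x (SQ (t - s) (w s))) - x (z t)\<bar> \<le> sqrt (energy 0 T (\<lambda>s. \<psi> s - w s) * v)"
proof -
  have \<psi>c: "L2_control T \<psi>" using \<psi> by (simp add: responds_def)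
  have vt: "V (t - 0) x \<le> ennreal v" using V_mono[of t T x] t v(1) by simp
  have t': "0 \<le> (0::real)" "t \<le> T" using t by auto
  show wi: "set_integrable lborel {0..t} (\<lambda>s. x (SQ (t - s) (w s)))"
    by (rule pairing_bound(1)[OF SQ_pairing_measurable[OF w(2)] L2_control_integrable[OF w(1) t'] vt v(2)])
  have "has_weak_integral {0..t} (\<lambda>s. SQ (t - s) (\<psi> s)) (z t)" using \<psi> t by (auto simp: responds_def)
  then have \<psi>i: "set_integrable lborel {0..t} (\<lambda>s. x (SQ (t - s) (\<psi> s)))"
    "(LINT s:{0..t}|lborel. x (SQ (t - s) (\<psi> s))) = x (z t)"
    unfolding has_weak_integral_def by blast+
  have d: "set_integrable lborel {0..t} (\<lambda>s. x (SQ (t - s) (\<psi> s - w s)))"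
    "(LINT s:{0..t}|lborel. x (SQ (t - s) (\<psi> s - w s))) = x (z t) - (LINT s:{0..t}|lborel. x (SQ (t - s) (w s)))"
    using set_integral_diff[OF \<psi>i(1) wi] \<psi>i(2) by (simp_all add: blinfun.diff_right)
  have dc: "L2_control T (\<lambda>s. \<psi> s - w s)" by (rule L2_control_diff[OF \<psi>c w(1)])
  have "set_borel_measurable lborel {0..t} (\<lambda>s. x (SQ (t - s) (\<psi> s - w s)))"
    using d(1) unfolding set_integrable_def set_borel_measurable_def by (rule borel_measurable_integrable)
  from pairing_bound(2)[OF this L2_control_integrable[OF dc t'] vt v(2)]
  have "(x (z t) - (LINT s:{0..t}|lborel. x (SQ (t - s) (w s))))\<^sup>2 \<le> energy 0 t (\<lambda>s. \<psi> s - w s) * v"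
    unfolding d(2) by (simp add: energy_def)
  also have "\<dots> \<le> energy 0 T (\<lambda>s. \<psi> s - w s) * v"
    using energy_mono[OF dc, of 0 t] t v(2) by (intro mult_right_mono) auto
  finally show "\<bar>(LINT s:{0..t}|lborel. x (SQ (t - s) (w s))) - x (z t)\<bar> \<le> sqrt (energy 0 T (\<lambda>s. \<psi> s - w s) * v)"
    by (intro real_le_rsqrt) (simp add: power2_commute)
qed

text \<open>The controls whose response is \<open>\<delta>\<close>-close to \<open>z0\<close> form a convex set, so by the parallelogram
  law near-minimisers of the energy are Cauchy as \<open>\<delta> \<rightarrow> 0\<close>; this replaces weak compactness.\<close>

lemma responses_closed:
  assumes T: "T > 0"
    and approx: "\<And>\<delta>. \<delta> > 0 \<Longrightarrow> \<exists>z\<in>responses T (E + \<delta>). \<forall>t\<in>{0..T}. norm (z t - z0 t) \<le> \<delta>"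
  shows "z0 \<in> responses T E"
proof -
  define \<C> where "\<C> \<delta> = {\<psi>. \<exists>z. responds T \<psi> z \<and> (\<forall>t\<in>{0..T}. norm (z t - z0 t) \<le> \<delta>)}" for \<delta>
  define c where "c \<delta> = Inf (energy 0 T ` \<C> \<delta>)" for \<delta>
  have near: "\<exists>\<psi>\<in>\<C> \<delta>. energy 0 T \<psi> \<le> E + \<delta>'" if \<delta>: "\<delta> > 0" "\<delta>' > 0" for \<delta> \<delta>'
  proof -
    have "min \<delta> \<delta>' > 0" using \<delta> by simp
    from approx[OF this] obtain z where z: "z \<in> responses T (E + min \<delta> \<delta>')"
      "\<forall>t\<in>{0..T}. norm (z t - z0 t) \<le> min \<delta> \<delta>'" by blast
    obtain \<psi> where \<psi>: "responds T \<psi> z" "energy 0 T \<psi> \<le> E + min \<delta> \<delta>'" using z(1) by (auto simp: responses_def)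
    have "\<forall>t\<in>{0..T}. norm (z t - z0 t) \<le> \<delta>" using z(2) by simp
    with \<psi>(1) have "\<psi> \<in> \<C> \<delta>" unfolding \<C>_def by (intro CollectI exI[of _ z] conjI)
    moreover have "energy 0 T \<psi> \<le> E + \<delta>'" using \<psi>(2) by simp
    ultimately show ?thesis by (intro bexI[of _ \<psi>])
  qed
  have bdd: "bdd_below (energy 0 T ` \<C> \<delta>)" for \<delta>
    by (rule bdd_belowI[of _ 0]) (auto simp: energy_nonneg)
  have c_le: "c \<delta> \<le> energy 0 T \<psi>" if "\<psi> \<in> \<C> \<delta>" for \<delta> \<psi>
    unfolding c_def using that bdd by (intro cInf_lower) auto
  have cE: "c \<delta> \<le> E" if "\<delta> > 0" for \<delta>
  proof (rule field_le_epsilon)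
    fix \<delta>' :: real assume "\<delta>' > 0"
    from near[OF that this] obtain \<psi> where "\<psi> \<in> \<C> \<delta>" "energy 0 T \<psi> \<le> E + \<delta>'" by (elim bexE)
    then show "c \<delta> \<le> E + \<delta>'" using c_le[of \<psi> \<delta>] by linarith
  qed
  have \<C>_mono: "\<C> \<delta> \<subseteq> \<C> \<delta>'" if "\<delta> \<le> \<delta>'" for \<delta> \<delta>'
  proof
    fix \<psi> assume "\<psi> \<in> \<C> \<delta>"
    then obtain z where "responds T \<psi> z" "\<forall>t\<in>{0..T}. norm (z t - z0 t) \<le> \<delta>" unfolding \<C>_def by blast
    moreover from this(2) have "\<forall>t\<in>{0..T}. norm (z t - z0 t) \<le> \<delta>'" using that by (meson order_trans)
    ultimately show "\<psi> \<in> \<C> \<delta>'" unfolding \<C>_def by blast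
  qed
  have c_mono: "c \<delta>' \<le> c \<delta>" if "0 < \<delta>" "\<delta> \<le> \<delta>'" for \<delta> \<delta>'
    unfolding c_def using near[OF that(1) zero_less_one] \<C>_mono[OF that(2)] bdd
    by (intro cInf_superset_mono) auto
  define \<delta> where "\<delta> n = 1 / real (Suc n)" for n
  have \<delta>: "\<delta> n > 0" for n by (simp add: \<delta>_def)
  have \<delta>_mono: "\<delta> m \<le> \<delta> n" if "n \<le> m" for n m using that by (simp add: \<delta>_def frac_le)
  have \<delta>_lim: "\<delta> \<longlonglongrightarrow> 0" unfolding \<delta>_def by (rule LIMSEQ_Suc[OF lim_1_over_n])
  have "\<exists>\<psi>\<in>\<C> (\<delta> n). energy 0 T \<psi> < c (\<delta> n) + \<delta> n" for n
  proof -
    have "energy 0 T ` \<C> (\<delta> n) \<noteq> {}" using near[OF \<delta> zero_less_one] by auto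
    moreover have "Inf (energy 0 T ` \<C> (\<delta> n)) < c (\<delta> n) + \<delta> n" using \<delta>[of n] by (simp add: c_def)
    ultimately obtain y where "y \<in> energy 0 T ` \<C> (\<delta> n)" "y < c (\<delta> n) + \<delta> n" using cInf_lessD by metis
    then show ?thesis by (elim imageE) (rule bexI, auto)
  qed
  then obtain \<psi> where \<psi>: "\<And>n. \<psi> n \<in> \<C> (\<delta> n)" "\<And>n. energy 0 T (\<psi> n) < c (\<delta> n) + \<delta> n" by metis
  have "\<exists>z. responds T (\<psi> n) z \<and> (\<forall>t\<in>{0..T}. norm (z t - z0 t) \<le> \<delta> n)" for n
    using \<psi>(1)[of n] by (simp add: \<C>_def)
  then obtain z where z: "\<And>n. responds T (\<psi> n) (z n)" "\<And>n t. t \<in> {0..T} \<Longrightarrow> norm (z n t - z0 t) \<le> \<delta> n" by metis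
  have ctrl: "L2_control T (\<psi> n)" for n using z(1) by (simp add: responds_def)
  obtain c0 where c0: "(\<lambda>n. c (\<delta> n)) \<longlonglongrightarrow> c0" "\<And>n. c (\<delta> n) \<le> c0"
    using incseq_convergent[of "\<lambda>n. c (\<delta> n)" E] c_mono \<delta> \<delta>_mono cE by (auto simp: incseq_def)
  \<comment> \<open>The midpoint of the two controls lies in \<C> (\<delta> n), so its energy is at
    least c (\<delta> n). The parallelogram law leaves 2 * (c (\<delta> m) - c (\<delta> n)) plus
    the two minimisation errors, and c (\<delta> m) <= c0.\<close>
  have diff: "energy 0 T (\<lambda>s. \<psi> n s - \<psi> m s) \<le> 2 * (c0 - c (\<delta> n)) + 4 * \<delta> n" if "n \<le> m" for n m
  proof -
    have "(\<lambda>s. (1/2) *\<^sub>R \<psi> n s + (1/2) *\<^sub>R \<psi> m s) \<in> \<C> (\<delta> n)"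
    proof -
      have "norm ((1/2) *\<^sub>R z n t + (1/2) *\<^sub>R z m t - z0 t) \<le> \<delta> n" if t: "t \<in> {0..T}" for t
      proof -
        have "(1/2) *\<^sub>R z n t + (1/2) *\<^sub>R z m t - z0 t = (1/2) *\<^sub>R (z n t - z0 t) + (1/2) *\<^sub>R (z m t - z0 t)"
          by (simp add: algebra_simps flip: scaleR_add_left)
        also have "norm \<dots> \<le> norm (z n t - z0 t) / 2 + norm (z m t - z0 t) / 2"
          by (rule order_trans[OF norm_triangle_ineq]) simp
        also have "\<dots> \<le> \<delta> n / 2 + \<delta> n / 2"
          using z(2)[OF t, of n] z(2)[OF t, of m] \<delta>_mono[OF \<open>n \<le> m\<close>] by (intro add_mono) auto
        finally show ?thesis by simp
      qed
      then show ?thesis unfolding \<C>_def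
        by (intro CollectI exI[of _ "\<lambda>t. (1/2) *\<^sub>R z n t + (1/2) *\<^sub>R z m t"] conjI responds_midpoint z(1) ballI)
    qed
    from c_le[OF this] energy_parallelogram[OF ctrl ctrl, of n m] \<psi>(2)[of n] \<psi>(2)[of m] c0(2)[of m] \<delta>_mono[OF that]
    show ?thesis by argo
  qed
  have bound_lim: "(\<lambda>n. 2 * (c0 - c (\<delta> n)) + 4 * \<delta> n) \<longlonglongrightarrow> 2 * (c0 - c0) + 4 * 0"
    by (intro tendsto_intros c0 \<delta>_lim)
  have cauchy: "\<exists>N. \<forall>n\<ge>N. \<forall>m\<ge>N. energy 0 T (\<lambda>s. \<psi> n s - \<psi> m s) \<le> \<epsilon>" if "\<epsilon> > 0" for \<epsilon>
  proof -
    have "\<forall>\<^sub>F n in sequentially. 2 * (c0 - c (\<delta> n)) + 4 * \<delta> n < \<epsilon>"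
      using bound_lim that by (intro order_tendstoD(2)) auto
    then obtain N where N: "\<And>n. n \<ge> N \<Longrightarrow> 2 * (c0 - c (\<delta> n)) + 4 * \<delta> n < \<epsilon>" by (auto simp: eventually_sequentially)
    have "energy 0 T (\<lambda>s. \<psi> n s - \<psi> m s) \<le> \<epsilon>" if "n \<ge> N" "m \<ge> N" for n m
    proof (cases "n \<le> m")
      case True
      then show ?thesis using diff[OF True] N[OF that(1)] by linarith
    next
      case False
      then have "energy 0 T (\<lambda>s. \<psi> m s - \<psi> n s) \<le> \<epsilon>" using diff[of m n] N[OF that(2)] by linarith
      then show ?thesis by (simp add: energy_def norm_minus_commute)
    qed
    then show ?thesis by blast
  qed
  define u where "u n s = indicator {0..T} s *\<^sub>R \<psi> n s" for n s
  have um: "u n \<in> borel_measurable lborel" for n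
    using ctrl[of n] by (simp add: L2_control_def set_borel_measurable_def u_def[abs_def])
  have u_diff: "(\<integral>\<^sup>+s. ennreal ((norm (u n s - u k s))\<^sup>2) \<partial>lborel) = ennreal (energy 0 T (\<lambda>s. \<psi> n s - \<psi> k s))" for n k
    using energy_ennreal[OF L2_control_diff[OF ctrl ctrl]] by (simp only: u_def scaleR_diff_right)
  have "\<exists>w. w \<in> borel_measurable lborel \<and> (\<forall>\<epsilon>>0. \<exists>N. \<forall>n\<ge>N. (\<integral>\<^sup>+s. ennreal ((norm (u n s - w s))\<^sup>2) \<partial>lborel) \<le> ennreal \<epsilon>)"
  proof (rule L2_complete[of u T, OF um])
    fix \<epsilon> :: real assume "\<epsilon> > 0"
    from cauchy[OF this] obtain N where "\<forall>n\<ge>N. \<forall>m\<ge>N. energy 0 T (\<lambda>s. \<psi> n s - \<psi> m s) \<le> \<epsilon>" by blast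
    then show "\<exists>N. \<forall>n\<ge>N. \<forall>k\<ge>N. (\<integral>\<^sup>+s. ennreal ((norm (u n s - u k s))\<^sup>2) \<partial>lborel) \<le> ennreal \<epsilon>"
      unfolding u_diff by (intro exI[of _ N] allI impI ennreal_leI) simp
  qed (use T in \<open>auto simp: u_def\<close>)
  then obtain w where wm[measurable]: "w \<in> borel_measurable lborel"
    and w: "\<And>\<epsilon>. \<epsilon> > 0 \<Longrightarrow> \<exists>N. \<forall>n\<ge>N. (\<integral>\<^sup>+s. ennreal ((norm (u n s - w s))\<^sup>2) \<partial>lborel) \<le> ennreal \<epsilon>" by blast
  have dw: "L2_control T (\<lambda>s. \<psi> n s - w s)" "energy 0 T (\<lambda>s. \<psi> n s - w s) \<le> \<epsilon>"
    if le: "(\<integral>\<^sup>+s. ennreal ((norm (u n s - w s))\<^sup>2) \<partial>lborel) \<le> ennreal \<epsilon>" and "\<epsilon> > 0" for n \<epsilon>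
  proof -
    have "(\<integral>\<^sup>+s. ennreal ((norm (indicator {0..T} s *\<^sub>R (\<psi> n s - w s)))\<^sup>2) \<partial>lborel) \<le>
        (\<integral>\<^sup>+s. ennreal ((norm (u n s - w s))\<^sup>2) \<partial>lborel)"
      by (intro nn_integral_mono) (auto simp: u_def indicator_def)
    then have fin: "(\<integral>\<^sup>+s. ennreal ((norm (indicator {0..T} s *\<^sub>R (\<psi> n s - w s)))\<^sup>2) \<partial>lborel) \<le> ennreal \<epsilon>"
      using le by (rule order_trans)
    have "(\<lambda>s. u n s - indicator {0..T} s *\<^sub>R w s) \<in> borel_measurable lborel" using um[of n] by measurable
    then have m: "set_borel_measurable lborel {0..T} (\<lambda>s. \<psi> n s - w s)"
      by (simp add: set_borel_measurable_def u_def scaleR_diff_right)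
    show ctl: "L2_control T (\<lambda>s. \<psi> n s - w s)" by (rule L2_controlI[OF m fin])
    show "energy 0 T (\<lambda>s. \<psi> n s - w s) \<le> \<epsilon>"
      using fin energy_ennreal[OF ctl] \<open>\<epsilon> > 0\<close> by simp
  qed
  have wc: "L2_control T w"
  proof -
    obtain n where "(\<integral>\<^sup>+s. ennreal ((norm (u n s - w s))\<^sup>2) \<partial>lborel) \<le> ennreal 1" using w[of 1] by force
    from L2_control_diff[OF ctrl[of n] dw(1)[OF this]] show ?thesis by simp
  qed
  have e_lim: "(\<lambda>n. energy 0 T (\<lambda>s. \<psi> n s - w s)) \<longlonglongrightarrow> 0"
  proof (rule LIMSEQ_I)
    fix \<epsilon> :: real assume \<epsilon>: "\<epsilon> > 0"
    then have \<epsilon>2: "\<epsilon> / 2 > 0" by simp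
    from w[OF this] obtain N where
      N: "\<forall>n\<ge>N. (\<integral>\<^sup>+s. ennreal ((norm (u n s - w s))\<^sup>2) \<partial>lborel) \<le> ennreal (\<epsilon> / 2)" by blast
    have "norm (energy 0 T (\<lambda>s. \<psi> n s - w s) - 0) < \<epsilon>" if "n \<ge> N" for n
    proof -
      have "energy 0 T (\<lambda>s. \<psi> n s - w s) \<le> \<epsilon> / 2" using N that by (intro dw(2) \<epsilon>2) blast
      then show ?thesis using energy_nonneg[of 0 T "\<lambda>s. \<psi> n s - w s"] \<epsilon> by simp
    qed
    then show "\<exists>N. \<forall>n\<ge>N. norm (energy 0 T (\<lambda>s. \<psi> n s - w s) - 0) < \<epsilon>" by blast
  qed
  have "energy 0 T w \<le> (1 + \<eta>) * E" if \<eta>: "\<eta> > 0" for \<eta>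
  proof (rule LIMSEQ_le[OF tendsto_const])
    show "(\<lambda>n. (1 + \<eta>) * (E + \<delta> n) + (1 + 1/\<eta>) * energy 0 T (\<lambda>s. \<psi> n s - w s)) \<longlonglongrightarrow> (1 + \<eta>) * E"
      using tendsto_add[OF tendsto_mult[OF tendsto_const tendsto_add[OF tendsto_const \<delta>_lim]] tendsto_mult[OF tendsto_const e_lim]]
      by simp
    have "energy 0 T w \<le> (1 + \<eta>) * (E + \<delta> n) + (1 + 1/\<eta>) * energy 0 T (\<lambda>s. \<psi> n s - w s)" for n
    proof -
      have "energy 0 T (\<psi> n) \<le> E + \<delta> n" using \<psi>(2)[of n] cE[OF \<delta>, of n] by simp
      then have "(1 + \<eta>) * energy 0 T (\<psi> n) \<le> (1 + \<eta>) * (E + \<delta> n)" using \<eta> by (intro mult_left_mono) auto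
      then show ?thesis using energy_le_perturbed[OF ctrl[of n] wc \<eta>] by linarith
    qed
    then show "\<exists>N. \<forall>n\<ge>N. energy 0 T w \<le> (1 + \<eta>) * (E + \<delta> n) + (1 + 1/\<eta>) * energy 0 T (\<lambda>s. \<psi> n s - w s)" by blast
  qed
  then have "energy 0 T w \<le> (1 + \<delta> n) * E" for n using \<delta> by blast
  moreover have "(\<lambda>n. (1 + \<delta> n) * E) \<longlonglongrightarrow> (1 + 0) * E" by (intro tendsto_intros \<delta>_lim)
  ultimately have "energy 0 T w \<le> (1 + 0) * E" by (intro LIMSEQ_le_const) auto
  then have wE: "energy 0 T w \<le> E" by simp
  have "responds T w z0"
    unfolding responds_def has_weak_integral_def
  proof (intro conjI ballI allI wc)
    fix t x assume t: "t \<in> {0..T}"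
    obtain v where v: "V T x \<le> ennreal v" "v \<ge> 0" using V_finite[OF T] by blast
    show "set_integrable lborel {0..t} (\<lambda>s. blinfun_apply x (SQ (t - s) (w s)))"
      by (rule energy_controls_response(1)[OF z(1)[of 0] wc wm t v])
    \<comment> \<open>Two errors vanish: exchanging \<open>w\<close> for \<psi> n is bounded through
      the energy of the difference, exchanging z n t for z0 t by norm x * \<delta> n.\<close>
    have "\<bar>(LINT s:{0..t}|lborel. blinfun_apply x (SQ (t - s) (w s))) - blinfun_apply x (z0 t)\<bar> \<le> 0"
    proof (rule LIMSEQ_le[OF tendsto_const])
      show "(\<lambda>n. sqrt (energy 0 T (\<lambda>s. \<psi> n s - w s) * v) + norm x * \<delta> n) \<longlonglongrightarrow> 0"
        using tendsto_add[OF tendsto_real_sqrt[OF tendsto_mult[OF e_lim tendsto_const[of v]]] tendsto_mult[OF tendsto_const[of "norm x"] \<delta>_lim]]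
        by simp
      have "\<bar>(LINT s:{0..t}|lborel. blinfun_apply x (SQ (t - s) (w s))) - blinfun_apply x (z0 t)\<bar> \<le>
          sqrt (energy 0 T (\<lambda>s. \<psi> n s - w s) * v) + norm x * \<delta> n" for n
      proof -
        have "\<bar>blinfun_apply x (z n t) - blinfun_apply x (z0 t)\<bar> \<le> norm x * \<delta> n"
          using norm_blinfun[of x "z n t - z0 t"] mult_left_mono[OF z(2)[OF t, of n] norm_ge_zero[of x]]
          by (simp add: blinfun.diff_right)
        then show ?thesis using energy_controls_response(2)[OF z(1)[of n] wc wm t v] by linarith
      qed
      then show "\<exists>N. \<forall>n\<ge>N. \<bar>(LINT s:{0..t}|lborel. blinfun_apply x (SQ (t - s) (w s))) - blinfun_apply x (z0 t)\<bar> \<le>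
          sqrt (energy 0 T (\<lambda>s. \<psi> n s - w s) * v) + norm x * \<delta> n" by blast
    qed
    then show "(LINT s:{0..t}|lborel. blinfun_apply x (SQ (t - s) (w s))) = blinfun_apply x (z0 t)" by simp
  qed
  then show ?thesis using wE by (auto simp: responses_def)
qed

end

section \<open>Dissipative comparison\<close>

lemma integral_average_close:
  fixes g :: "real \<Rightarrow> 'e::banach"
  assumes "a < b" "continuous_on {a..b} g" and close: "\<And>s. s \<in> {a..b} \<Longrightarrow> norm (g s - w) \<le> \<epsilon>"
  shows "norm (integral {a..b} g /\<^sub>R (b - a) - w) \<le> \<epsilon>"
proof -
  have "integral {a..b} (\<lambda>s. g s - w) = integral {a..b} g - (b - a) *\<^sub>R w"
    using assms by (subst integral_diff) (auto intro: integrable_continuous_interval)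
  then have "integral {a..b} g /\<^sub>R (b - a) - w = integral {a..b} (\<lambda>s. g s - w) /\<^sub>R (b - a)"
    using assms(1) by (simp add: scaleR_diff_right)
  also have "norm \<dots> = norm (integral {a..b} (\<lambda>s. g s - w)) / (b - a)"
    using assms(1) by (simp add: divide_inverse mult.commute)
  also have "norm (integral {a..b} (\<lambda>s. g s - w)) \<le> \<epsilon> * (b - a)"
    using assms(1) close by (intro integral_bound continuous_intros assms(2)) auto
  then have "norm (integral {a..b} (\<lambda>s. g s - w)) / (b - a) \<le> \<epsilon>"
    using assms(1) by (simp add: divide_le_eq)
  finally show ?thesis .
qed

text \<open>Compare \<open>g\<close> with the exact solution \<open>G\<close>, raised by \<eta>. At
  a maximum of g - G over 0..t1 left difference quotients are nonnegative, and left ones remain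
  available if the maximum is at \<open>t1\<close>. A positive maximum would make them
  negative.\<close>

lemma exp_decay_if_left_dini:
  fixes g :: "real \<Rightarrow> real"
  assumes cont: "continuous_on {0..T} g" and \<kappa>: "\<kappa> > 0" and c: "c \<ge> 0"
    and dini: "\<And>t \<eta>. 0 < t \<Longrightarrow> t \<le> T \<Longrightarrow> \<eta> > 0 \<Longrightarrow>
      \<forall>\<^sub>F k in at_right 0. (g t - g (t - k)) / k \<le> - \<kappa> * g t + c + \<eta>"
    and t1: "t1 \<in> {0..T}"
  shows "g t1 \<le> exp (- \<kappa> * t1) * g 0 + c / \<kappa>"
proof (rule field_le_epsilon)
  fix \<eta> :: real assume \<eta>: "\<eta> > 0"
  define G where "G t = exp (- \<kappa> * t) * g 0 + c / \<kappa> + \<eta>" for t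
  define u where "u t = g t - G t" for t
  have u_cont: "continuous_on {0..t1} u" unfolding u_def G_def
    using t1 by (intro continuous_intros continuous_on_subset[OF cont]) auto
  show "g t1 \<le> exp (- \<kappa> * t1) * g 0 + c / \<kappa> + \<eta>"
  proof (rule ccontr)
    assume "\<not> ?thesis"
    then have u1: "u t1 > 0" by (simp add: u_def G_def)
    have "compact {0..t1}" "{0..t1} \<noteq> {}" using t1 by auto
    from continuous_attains_sup[OF this u_cont] obtain t where
      t: "t \<in> {0..t1}" "\<And>s. s \<in> {0..t1} \<Longrightarrow> u s \<le> u t" by blast
    have ut: "u t > 0" using t(2)[of t1] u1 t1 by simp
    have "c / \<kappa> \<ge> 0" using \<kappa> c by simp
    then have "u 0 < 0" using \<eta> by (simp add: u_def G_def)
    then have "t \<noteq> 0" using ut by auto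
    then have t0: "0 < t" "t \<le> T" using t(1) t1 by auto
    have "(G has_real_derivative (- \<kappa> * exp (- \<kappa> * t) * g 0)) (at t)"
      unfolding G_def by (auto intro!: derivative_eq_intros)
    from DERIV_D[OF this]
    have "((\<lambda>h. (G (t + h) - G t) / h) \<longlongrightarrow> - \<kappa> * exp (- \<kappa> * t) * g 0) (at 0)" .
    moreover have "filterlim (\<lambda>k. - k :: real) (at 0) (at_right 0)"
      by (auto simp: filterlim_at eventually_at_filter intro!: tendsto_eq_intros)
    ultimately have "((\<lambda>k. (G (t + - k) - G t) / - k) \<longlongrightarrow> - \<kappa> * exp (- \<kappa> * t) * g 0) (at_right 0)"
      by (rule filterlim_compose)
    moreover have "- \<kappa> * exp (- \<kappa> * t) * g 0 = - \<kappa> * G t + c + \<kappa> * \<eta>"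
      using \<kappa> by (simp add: G_def field_simps)
    \<comment> \<open>Raising \<open>G\<close> by \<eta> creates the slack \<kappa> * \<eta>: one
      half pays for the limit defining the derivative of \<open>G\<close>, the other for the Dini
      estimate of \<open>g\<close>.\<close>
    moreover have "- \<kappa> * G t + c + \<kappa> * \<eta> > - \<kappa> * G t + c + \<kappa> * \<eta> / 2" using \<kappa> \<eta> by simp
    ultimately have ev1: "\<forall>\<^sub>F k in at_right 0. (G (t + - k) - G t) / - k > - \<kappa> * G t + c + \<kappa> * \<eta> / 2"
      by (auto intro: order_tendstoD)
    have "\<kappa> * \<eta> / 2 > 0" using \<kappa> \<eta> by simp
    from dini[OF t0 this]
    have ev2: "\<forall>\<^sub>F k in at_right 0. (g t - g (t - k)) / k \<le> - \<kappa> * g t + c + \<kappa> * \<eta> / 2" .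
    have ev3: "\<forall>\<^sub>F k in at_right 0. k \<in> {0<..<t}" using eventually_at_right_less[of 0] t0(1)
      by (auto simp: eventually_at_right_field)
    from eventually_happens[OF eventually_conj[OF ev1 eventually_conj[OF ev2 ev3]]]
    obtain k where k: "(G (t + - k) - G t) / - k > - \<kappa> * G t + c + \<kappa> * \<eta> / 2"
      "(g t - g (t - k)) / k \<le> - \<kappa> * g t + c + \<kappa> * \<eta> / 2" "0 < k" "k < t" by auto
    have "(G (t + - k) - G t) / - k = (G t - G (t - k)) / k" using k(3) by (simp add: field_simps)
    moreover have "(u t - u (t - k)) / k = (g t - g (t - k)) / k - (G t - G (t - k)) / k"
      unfolding u_def by (simp add: diff_divide_distrib)
    moreover have "- \<kappa> * g t + \<kappa> * G t = - (\<kappa> * u t)" by (simp add: u_def algebra_simps)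
    moreover have "\<kappa> * u t > 0" using \<kappa> ut by simp
    ultimately have "(u t - u (t - k)) / k < 0" using k(1,2) by linarith
    then have "u t < u (t - k)" using k(3) by (simp add: divide_less_0_iff)
    moreover have "u (t - k) \<le> u t" by (rule t(2)) (use k t in auto)
    ultimately show False by linarith
  qed
qed

section \<open>Duhamel formula and orbit averages\<close>

context bounded_semigroup begin

lemma S_integral:
  fixes a b :: real
  assumes "continuous_on {a..b} f"
  shows "S k (integral {a..b} f) = integral {a..b} (\<lambda>s. S k (f s))"
  using integral_linear[OF integrable_continuous_interval[OF assms] blinfun.bounded_linear_right[of "S k"]]
  by (simp add: o_def)

lemma convolution_continuous:
  assumes "continuous_on {a..b} f" "b \<le> t"
  shows "continuous_on {a..b} (\<lambda>s. S (t - s) (f s))"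
  using assms by (intro continuous_on_S continuous_intros) auto

lemma duhamel_restart:
  assumes f: "continuous_on {0..T} f"
    and v: "\<And>t. t \<in> {0..T} \<Longrightarrow> v t = S t v0 + integral {0..t} (\<lambda>s. S (t - s) (f s))"
    and st: "0 \<le> s" "s \<le> t" "t \<le> T"
  shows "v t = S (t - s) (v s) + integral {s..t} (\<lambda>r. S (t - r) (f r))"
proof -
  have fs: "continuous_on {0..s} f" "continuous_on {0..t} f"
    using st by (auto intro: continuous_on_subset[OF f])
  have "S (t - s) (integral {0..s} (\<lambda>r. S (s - r) (f r))) = integral {0..s} (\<lambda>r. S (t - s) (S (s - r) (f r)))"
    by (intro S_integral convolution_continuous fs) simp
  also have "\<dots> = integral {0..s} (\<lambda>r. S (t - r) (f r))"
  proof (rule integral_cong)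
    fix r assume "r \<in> {0..s}"
    then show "S (t - s) (S (s - r) (f r)) = S (t - r) (f r)"
      using S_add[of "t - s" "s - r" "f r"] st by simp
  qed
  finally have "S (t - s) (v s) = S t v0 + integral {0..s} (\<lambda>r. S (t - r) (f r))"
    using v[of s] st S_add[of "t - s" s v0] by (simp add: blinfun.add_right)
  moreover have "integral {0..s} (\<lambda>r. S (t - r) (f r)) + integral {s..t} (\<lambda>r. S (t - r) (f r)) =
      integral {0..t} (\<lambda>r. S (t - r) (f r))"
    using st by (intro Henstock_Kurzweil_Integration.integral_combine integrable_continuous_interval
        convolution_continuous fs) auto
  ultimately show ?thesis using v[of t] st by simp
qed

text \<open>A regularisation that commutes with \<open>S\<close>, takes values in the domain of the
  generator and tends to the identity as h decreases to 0.\<close>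

definition avg :: "real \<Rightarrow> 'e \<Rightarrow> 'e" where
  "avg h x = integral {0..h} (\<lambda>s. S s x) /\<^sub>R h"

lemma orbit_continuous: "continuous_on {0..h} (\<lambda>s. S s x)"
  by (intro continuous_on_S continuous_intros) auto

lemma avg_diff: "avg h (x - y) = avg h x - avg h y"
  unfolding avg_def blinfun.diff_right
  by (subst integral_diff) (auto intro: integrable_continuous_interval orbit_continuous simp: scaleR_diff_right)

lemma avg_scaleR: "avg h (a *\<^sub>R x) = a *\<^sub>R avg h x"
  unfolding avg_def blinfun.scaleR_right by simp

lemma norm_avg_le:
  assumes "h > 0"
  shows "norm (avg h x) \<le> C * norm x"
proof -
  have "norm (integral {0..h} (\<lambda>s. S s x)) \<le> (C * norm x) * (h - 0)"
    using assms norm_S_le by (intro integral_bound orbit_continuous) auto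
  then show ?thesis using assms by (simp add: avg_def field_simps)
qed

lemma avg_close:
  assumes "h > 0" "\<And>s. s \<in> {0..h} \<Longrightarrow> norm (S s x - x) \<le> \<epsilon>"
  shows "norm (avg h x - x) \<le> \<epsilon>"
  using integral_average_close[OF assms(1) orbit_continuous assms(2)] by (simp add: avg_def)

text \<open>A continuous path on a compact interval has compact range, on which strong continuity at
  time 0 is uniform; here via uniform continuity on a rectangle.\<close>

lemma S_uniformly_close:
  fixes a b :: real
  assumes u: "continuous_on {a..b} u" and "\<epsilon> > 0"
  shows "\<exists>d>0. \<forall>s\<in>{0..d}. \<forall>t\<in>{a..b}. norm (S s (u t) - u t) \<le> \<epsilon>"
proof -
  have "continuous_on ({0..1} \<times> {a..b}) (\<lambda>p. S (fst p) (u (snd p)))"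
    by (intro continuous_on_S continuous_intros continuous_on_compose2[OF u]) auto
  then have "uniformly_continuous_on ({0..1} \<times> {a..b}) (\<lambda>p. S (fst p) (u (snd p)))"
    by (intro compact_uniformly_continuous compact_Times) auto
  then obtain d where d: "d > 0" "\<And>p p'. p \<in> {0..1} \<times> {a..b} \<Longrightarrow> p' \<in> {0..1} \<times> {a..b} \<Longrightarrow>
      dist p' p < d \<Longrightarrow> dist (S (fst p') (u (snd p'))) (S (fst p) (u (snd p))) < \<epsilon>"
    using \<open>\<epsilon> > 0\<close> unfolding uniformly_continuous_on_def by metis
  have "norm (S s (u t) - u t) \<le> \<epsilon>" if "s \<in> {0..min 1 (d/2)}" "t \<in> {a..b}" for s t
  proof -
    have "dist (s, t) (0, t) < d" using that d(1) by (auto simp: dist_Pair_Pair)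
    then show ?thesis using d(2)[of "(0, t)" "(s, t)"] that by (auto simp: dist_norm)
  qed
  then show ?thesis using d(1) by (intro exI[of _ "min 1 (d/2)"]) auto
qed

lemma avg_tendsto: "((\<lambda>h. avg h x) \<longlongrightarrow> x) (at_right 0)"
proof (rule tendstoI)
  fix \<epsilon> :: real assume "\<epsilon> > 0"
  then obtain d where d: "d > 0" "\<And>s. s \<in> {0..d} \<Longrightarrow> norm (S s x - x) \<le> \<epsilon> / 2"
    using S_uniformly_close[of 0 0 "\<lambda>_. x" "\<epsilon> / 2"] by auto
  have "dist (avg h x) x < \<epsilon>" if "0 < h" "h < d" for h
    using avg_close[of h x "\<epsilon> / 2"] d(2) that \<open>\<epsilon> > 0\<close> by (force simp: dist_norm)
  then show "\<forall>\<^sub>F h in at_right 0. dist (avg h x) x < \<epsilon>"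
    using d(1) by (auto simp: eventually_at_right_field)
qed

text \<open>Both sides equal \<open>(S k - 1) (S h - 1)\<close> applied to a primitive of the orbit, divided by \<open>h k\<close>.\<close>

lemma avg_difference_quotient:
  assumes "h > 0" "k > 0"
  shows "(S k (avg h x) - avg h x) /\<^sub>R k = (S h (avg k x) - avg k x) /\<^sub>R h"
proof -
  define J where "J a b = integral {a..b} (\<lambda>s. S s x)" for a b
  have shift: "S a (J 0 b) = J a (a + b)" if "a \<ge> 0" "b \<ge> 0" for a b
  proof -
    have "S a (J 0 b) = integral {0..b} (\<lambda>s. S a (S s x))"
      unfolding J_def by (intro S_integral orbit_continuous)
    also have "\<dots> = integral {0..b} (\<lambda>s. S (s + a) x)"
    proof (rule integral_cong)
      fix s assume "s \<in> {0..b}"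
      then show "S a (S s x) = S (s + a) x" using S_add[of a s x] that by (simp add: add.commute)
    qed
    also have "\<dots> = integral {0 + a..b + a} (\<lambda>s. S s x)"
      using integral_shift_real_ivl[where f = "\<lambda>s. S s x" and a = a and b = "b + a" and c = a] by simp
    finally show ?thesis by (simp add: J_def add.commute)
  qed
  have comb: "J 0 a + J a (a + b) = J 0 (a + b)" if "a \<ge> 0" "b \<ge> 0" for a b
    unfolding J_def using that
    by (intro Henstock_Kurzweil_Integration.integral_combine integrable_continuous_interval orbit_continuous) auto
  have "S k (J 0 h) - J 0 h = S h (J 0 k) - J 0 k"
    using shift[of k h] shift[of h k] comb[of k h] comb[of h k] assms by (simp add: algebra_simps)
  then show ?thesis
    unfolding avg_def J_def[symmetric] blinfun.scaleR_right scaleR_diff_right[symmetric]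
    by (simp add: mult.commute)
qed

end

section \<open>Generator, dissipativity and the comparison estimate\<close>

locale dissipative_semigroup = bounded_semigroup S C for S :: "real \<Rightarrow> 'e::banach \<Rightarrow>\<^sub>L 'e" and C +
  fixes D :: "'e set" and A :: "'e \<Rightarrow> 'e" and F :: "'e \<Rightarrow> 'e" and \<kappa> :: real
  assumes generator: "is_generator S D A"
    and F_uniform: "\<And>B. bounded B \<Longrightarrow> uniformly_continuous_on B F"
    and F_zero: "F 0 = 0"
    and \<kappa>: "\<kappa> > 0"
    and dissipative: "\<And>x y. x \<in> D \<Longrightarrow> y \<in> D \<Longrightarrow>
         \<exists>xs \<in> norm_subdiff (x - y).
           blinfun_apply xs (A (x - y) + F x - F y) \<le> - \<kappa> * norm (x - y)"
begin

lemma generator_I: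
  assumes "((\<lambda>h. (S h x - x) /\<^sub>R h) \<longlongrightarrow> y) (at_right 0)"
  shows "x \<in> D" "A x = y"
proof -
  show "x \<in> D" using generator assms unfolding is_generator_def by blast
  then have "((\<lambda>h. (S h x - x) /\<^sub>R h) \<longlongrightarrow> A x) (at_right 0)"
    using generator by (simp add: is_generator_def)
  then show "A x = y" using assms by (intro tendsto_unique[of "at_right (0::real)"]) auto
qed

text \<open>\<open>avg_difference_quotient\<close> exchanges the roles of the two times, so the
  limit in \<open>k\<close> only involves \<open>avg k x\<close>, which tends to
  \<open>x\<close>.\<close>

lemma avg_generator:
  assumes "h > 0"
  shows "avg h x \<in> D" "A (avg h x) = (S h x - x) /\<^sub>R h"
proof -
  have "((\<lambda>k. (S h (avg k x) - avg k x) /\<^sub>R h) \<longlongrightarrow> (S h x - x) /\<^sub>R h) (at_right 0)"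
    by (intro tendsto_intros avg_tendsto bounded_linear.tendsto[OF blinfun.bounded_linear_right])
  moreover have "\<forall>\<^sub>F k in at_right 0. (S h (avg k x) - avg k x) /\<^sub>R h = (S k (avg h x) - avg h x) /\<^sub>R k"
    using eventually_at_right_less[of 0] by eventually_elim (simp add: avg_difference_quotient assms)
  ultimately have "((\<lambda>k. (S k (avg h x) - avg h x) /\<^sub>R k) \<longlongrightarrow> (S h x - x) /\<^sub>R h) (at_right 0)"
    by (rule Lim_transform_eventually)
  then show "avg h x \<in> D" "A (avg h x) = (S h x - x) /\<^sub>R h" by (auto intro: generator_I)
qed

lemma D_add: "x \<in> D \<Longrightarrow> y \<in> D \<Longrightarrow> x + y \<in> D"
proof -
  assume "x \<in> D" "y \<in> D"
  then have "((\<lambda>h. (S h x - x) /\<^sub>R h + (S h y - y) /\<^sub>R h) \<longlongrightarrow> A x + A y) (at_right 0)"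
    using generator unfolding is_generator_def by (intro tendsto_add) auto
  then show "x + y \<in> D"
    by (intro generator_I(1)[of _ "A x + A y"]) (simp add: blinfun.add_right algebra_simps)
qed

lemma zero_in_D: "0 \<in> D"
  by (rule generator_I(1)[of _ 0]) (simp add: blinfun.zero_right)

lemma F_continuous: "continuous_on X F"
proof -
  have "isCont F x" for x
    using uniformly_continuous_imp_continuous[OF F_uniform[OF bounded_ball[of x 1]]]
    by (simp add: continuous_on_eq_continuous_at)
  then show ?thesis by (simp add: continuous_at_imp_continuous_on)
qed

text \<open>Dissipativity provides a norming functional for each element of the dense set \<open>D\<close>, so that no
  Hahn-Banach theorem is needed.\<close>

lemma dissipative_norming:
  assumes "\<And>x :: 'e \<Rightarrow>\<^sub>L real. norm x \<le> 1 \<Longrightarrow> blinfun_apply x y \<le> c"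
  shows "norm y \<le> c"
proof (rule field_le_epsilon)
  fix \<eta> :: real assume \<eta>: "\<eta> > 0"
  have "\<forall>\<^sub>F h in at_right 0. dist (avg h y) y < \<eta> / 2" using \<eta> by (intro tendstoD avg_tendsto) simp
  then have "\<forall>\<^sub>F h in at_right 0. dist (avg h y) y < \<eta> / 2 \<and> h > 0"
    using eventually_at_right_less[of 0] by eventually_elim simp
  then obtain h where h: "dist (avg h y) y < \<eta> / 2" "h > 0"
    by (auto dest: eventually_happens)
  obtain x where x: "x \<in> norm_subdiff (avg h y - 0)"
    using dissipative[OF avg_generator(1)[OF h(2)] zero_in_D, of y] by blast
  then have nx: "norm x = 1" "blinfun_apply x (avg h y) = norm (avg h y)" by (auto simp: norm_subdiff_def)
  have "norm (avg h y) = blinfun_apply x y + blinfun_apply x (avg h y - y)"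
    using nx by (simp add: blinfun.diff_right)
  also have "\<dots> \<le> c + norm (avg h y - y)"
    using assms[of x] nx(1) norm_blinfun[of x "avg h y - y"] by (intro add_mono) auto
  finally have "norm (avg h y) \<le> c + \<eta> / 2" using h(1) by (simp add: dist_norm)
  moreover have "norm y \<le> norm (avg h y) + norm (avg h y - y)"
    using norm_triangle_ineq4[of "avg h y" "avg h y - y"] by simp
  ultimately show "norm y \<le> c + \<eta>" using h(1) by (simp add: dist_norm)
qed

text \<open>Dissipativity compares two points of \<open>D\<close>, while \<open>y\<close> is
  arbitrary. It is applied to avg h y + p and avg h y: their difference \<open>p\<close>, and with
  it the term A p, does not depend on h, and continuity of \<open>F\<close> leaves the error
  \<epsilon>.\<close>

lemma dissipative_shift:
  assumes p: "p \<in> D" and \<epsilon>: "\<epsilon> > 0"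
  shows "\<exists>xs\<in>norm_subdiff p. blinfun_apply xs (A p + F (y + p) - F y) \<le> - \<kappa> * norm p + \<epsilon>"
proof -
  have "continuous_on UNIV (\<lambda>z. F (z + p) - F z)"
    by (intro continuous_intros continuous_on_compose2[OF F_continuous[of UNIV]]) auto
  then have "isCont (\<lambda>z. F (z + p) - F z) y" by (simp add: continuous_on_eq_continuous_at)
  then have "((\<lambda>h. F (avg h y + p) - F (avg h y)) \<longlongrightarrow> F (y + p) - F y) (at_right 0)"
    using avg_tendsto by (rule isCont_tendsto_compose)
  then have "\<forall>\<^sub>F h in at_right 0. dist (F (avg h y + p) - F (avg h y)) (F (y + p) - F y) < \<epsilon>"
    using \<epsilon> by (rule tendstoD)
  then have "\<forall>\<^sub>F h in at_right 0. dist (F (avg h y + p) - F (avg h y)) (F (y + p) - F y) < \<epsilon> \<and> h > 0"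
    using eventually_at_right_less[of 0] by eventually_elim simp
  then obtain h where h: "dist (F (avg h y + p) - F (avg h y)) (F (y + p) - F y) < \<epsilon>" "h > 0"
    by (auto dest: eventually_happens)
  have yD: "avg h y \<in> D" by (rule avg_generator(1)[OF h(2)])
  obtain xs where xs: "xs \<in> norm_subdiff p"
    "blinfun_apply xs (A p + F (avg h y + p) - F (avg h y)) \<le> - \<kappa> * norm p"
    using dissipative[OF D_add[OF yD p] yD] by auto
  have n: "norm xs = 1" using xs(1) by (simp add: norm_subdiff_def)
  have "A p + F (y + p) - F y = (A p + F (avg h y + p) - F (avg h y)) +
      ((F (y + p) - F y) - (F (avg h y + p) - F (avg h y)))" by simp
  then have "blinfun_apply xs (A p + F (y + p) - F y) = blinfun_apply xs (A p + F (avg h y + p) - F (avg h y)) +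
      blinfun_apply xs ((F (y + p) - F y) - (F (avg h y + p) - F (avg h y)))"
    by (metis blinfun.add_right)
  also have "\<dots> \<le> - \<kappa> * norm p + norm ((F (y + p) - F y) - (F (avg h y + p) - F (avg h y)))"
    using norm_blinfun[of xs "(F (y + p) - F y) - (F (avg h y + p) - F (avg h y))"] n xs(2)
    by (intro add_mono) auto
  also have "\<dots> \<le> - \<kappa> * norm p + \<epsilon>" using h(1) by (simp add: dist_norm norm_minus_commute)
  finally show ?thesis using xs(1) by blast
qed

text \<open>The averages \<open>avg h (v t)\<close> lie in \<open>D\<close> and have a left derivative in \<open>t\<close>, even though \<open>v\<close> has none.\<close>

lemma avg_left_derivative:
  assumes f: "continuous_on {0..T} f" and vc: "continuous_on {0..T} v"
    and v: "\<And>t. t \<in> {0..T} \<Longrightarrow> v t = S t v0 + integral {0..t} (\<lambda>s. S (t - s) (f s))"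
    and h: "h > 0" and t: "0 < t" "t \<le> T"
  shows "((\<lambda>k. (avg h (v t) - avg h (v (t - k))) /\<^sub>R k) \<longlongrightarrow> A (avg h (v t)) + avg h (f t)) (at_right 0)"
proof -
  have small: "\<forall>\<^sub>F k in at_right 0. 0 < k \<and> k < d" if "d > 0" for d :: real
    using that by (auto simp: eventually_at_right_field)
  \<comment> \<open>The increment of \<open>v\<close> splits into v t - S k (v (t - k)), whose
    quotient tends to f t, and (S k - 1) applied to v (t - k). After averaging,
    \<open>avg_difference_quotient\<close> rewrites the quotient of the latter with the fixed time h
    in place of k.\<close>
  have "((\<lambda>k. (v t - S k (v (t - k))) /\<^sub>R k) \<longlongrightarrow> f t) (at_right 0)"
  proof (rule tendstoI)
    fix \<epsilon> :: real assume \<epsilon>: "\<epsilon> > 0"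
    then obtain d1 where d1: "d1 > 0" "\<And>s r. s \<in> {0..d1} \<Longrightarrow> r \<in> {0..T} \<Longrightarrow> norm (S s (f r) - f r) \<le> \<epsilon> / 3"
      using S_uniformly_close[OF f, of "\<epsilon> / 3"] by auto
    obtain d2 where d2: "d2 > 0" "\<And>r. r \<in> {0..T} \<Longrightarrow> dist r t < d2 \<Longrightarrow> dist (f r) (f t) < \<epsilon> / 3"
      using f t \<epsilon> unfolding continuous_on_iff by (metis atLeastAtMost_iff divide_pos_pos less_imp_le zero_less_numeral)
    have "dist ((v t - S k (v (t - k))) /\<^sub>R k) (f t) < \<epsilon>" if k: "0 < k" "k < min (min d1 d2) t" for k
    proof -
      have "v t - S k (v (t - k)) = integral {t - k..t} (\<lambda>r. S (t - r) (f r))"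
        using duhamel_restart[OF f v, of "t - k" t] k t by simp
      moreover have "norm (integral {t - k..t} (\<lambda>r. S (t - r) (f r)) /\<^sub>R (t - (t - k)) - f t) \<le> \<epsilon> / 3 + \<epsilon> / 3"
      proof (rule integral_average_close)
        show "continuous_on {t - k..t} (\<lambda>r. S (t - r) (f r))"
          using k t by (intro convolution_continuous continuous_on_subset[OF f]) auto
        fix r assume r: "r \<in> {t - k..t}"
        have "norm (S (t - r) (f r) - f r) \<le> \<epsilon> / 3" using d1(2) r k t by auto
        moreover have "norm (f r - f t) \<le> \<epsilon> / 3" using d2(2)[of r] r k t by (auto simp: dist_norm)
        ultimately show "norm (S (t - r) (f r) - f t) \<le> \<epsilon> / 3 + \<epsilon> / 3"
          using norm_triangle_ineq[of "S (t - r) (f r) - f r" "f r - f t"] by simp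
      qed (use k in auto)
      ultimately show ?thesis using \<epsilon> by (simp add: dist_norm)
    qed
    moreover have "min (min d1 d2) t > 0" using d1 d2 t by simp
    ultimately show "\<forall>\<^sub>F k in at_right 0. dist ((v t - S k (v (t - k))) /\<^sub>R k) (f t) < \<epsilon>"
      by (intro eventually_mono[OF small[of "min (min d1 d2) t"]]) auto
  qed
  moreover have "((\<lambda>k. avg k (v (t - k))) \<longlongrightarrow> v t) (at_right 0)"
  proof (rule tendstoI)
    fix \<epsilon> :: real assume \<epsilon>: "\<epsilon> > 0"
    then obtain d1 where d1: "d1 > 0" "\<And>s r. s \<in> {0..d1} \<Longrightarrow> r \<in> {0..T} \<Longrightarrow> norm (S s (v r) - v r) \<le> \<epsilon> / 3"
      using S_uniformly_close[OF vc, of "\<epsilon> / 3"] by auto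
    obtain d2 where d2: "d2 > 0" "\<And>r. r \<in> {0..T} \<Longrightarrow> dist r t < d2 \<Longrightarrow> dist (v r) (v t) < \<epsilon> / 3"
      using vc t \<epsilon> unfolding continuous_on_iff by (metis atLeastAtMost_iff divide_pos_pos less_imp_le zero_less_numeral)
    have "dist (avg k (v (t - k))) (v t) < \<epsilon>" if k: "0 < k" "k < min (min d1 d2) t" for k
    proof -
      have "norm (avg k (v (t - k)) - v (t - k)) \<le> \<epsilon> / 3"
        using d1(2) k t by (intro avg_close) auto
      moreover have "norm (v (t - k) - v t) < \<epsilon> / 3" using d2(2)[of "t - k"] k t by (auto simp: dist_norm)
      ultimately show ?thesis using \<epsilon>
          norm_triangle_ineq[of "avg k (v (t - k)) - v (t - k)" "v (t - k) - v t"] by (simp add: dist_norm)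
    qed
    moreover have "min (min d1 d2) t > 0" using d1 d2 t by simp
    ultimately show "\<forall>\<^sub>F k in at_right 0. dist (avg k (v (t - k))) (v t) < \<epsilon>"
      by (intro eventually_mono[OF small[of "min (min d1 d2) t"]]) auto
  qed
  moreover have avg_lim: "((\<lambda>k. avg h (g k)) \<longlongrightarrow> avg h l) (at_right 0)" if "(g \<longlongrightarrow> l) (at_right 0)" for g :: "real \<Rightarrow> 'e" and l
  proof (rule LIM_zero_cancel, rule Lim_null_comparison)
    show "\<forall>\<^sub>F k in at_right 0. norm (avg h (g k) - avg h l) \<le> C * norm (g k - l)"
      using norm_avg_le[OF h] by (auto simp: avg_diff[symmetric])
    show "((\<lambda>k. C * norm (g k - l)) \<longlongrightarrow> 0) (at_right 0)"
      using that by (intro tendsto_mult_right_zero tendsto_norm_zero LIM_zero)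
  qed
  ultimately have "((\<lambda>k. (S h (avg k (v (t - k))) - avg k (v (t - k))) /\<^sub>R h + avg h ((v t - S k (v (t - k))) /\<^sub>R k))
      \<longlongrightarrow> (S h (v t) - v t) /\<^sub>R h + avg h (f t)) (at_right 0)"
    by (intro tendsto_intros bounded_linear.tendsto[OF blinfun.bounded_linear_right]) auto
  moreover have "\<forall>\<^sub>F k in at_right 0. (S h (avg k (v (t - k))) - avg k (v (t - k))) /\<^sub>R h +
      avg h ((v t - S k (v (t - k))) /\<^sub>R k) = (avg h (v t) - avg h (v (t - k))) /\<^sub>R k"
    using eventually_at_right_less[of 0]
  proof eventually_elim
    fix k :: real assume k: "0 < k"
    have "avg h (S k w) = S k (avg h w)" for w
      unfolding avg_def blinfun.scaleR_right using k
      by (subst S_integral[OF orbit_continuous]) (auto intro!: arg_cong[of _ _ "\<lambda>x. x /\<^sub>R h"] integral_cong S_comm)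
    then show "(S h (avg k (v (t - k))) - avg k (v (t - k))) /\<^sub>R h +
      avg h ((v t - S k (v (t - k))) /\<^sub>R k) = (avg h (v t) - avg h (v (t - k))) /\<^sub>R k"
      using avg_difference_quotient[OF h k, of "v (t - k)", symmetric]
      by (simp add: avg_scaleR avg_diff scaleR_diff_right)
  qed
  ultimately have "((\<lambda>k. (avg h (v t) - avg h (v (t - k))) /\<^sub>R k)
      \<longlongrightarrow> (S h (v t) - v t) /\<^sub>R h + avg h (f t)) (at_right 0)" by (rule Lim_transform_eventually)
  then show ?thesis by (simp add: avg_generator(2)[OF h])
qed

text \<open>Here \<open>v\<close> solves v' = A v + f, with f within c of F (y + v) - F y. The
  average p = avg h v has a left derivative, and a supporting functional of p t chosen by
  \<open>dissipative_shift\<close> yields a left Dini inequality for norm p; the errors vanish with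
  h. Both the growth bound and the closeness of two paths are instances, for different choices of
  y.\<close>

lemma comparison:
  assumes f: "continuous_on {0..T} f" and vc: "continuous_on {0..T} v" and y: "continuous_on {0..T} y"
    and v: "\<And>t. t \<in> {0..T} \<Longrightarrow> v t = S t v0 + integral {0..t} (\<lambda>s. S (t - s) (f s))"
    and c: "\<And>t. t \<in> {0..T} \<Longrightarrow> norm (f t - (F (y t + v t) - F (y t))) \<le> c"
    and t1: "t1 \<in> {0..T}"
  shows "norm (v t1) \<le> exp (- \<kappa> * t1) * norm v0 + c / \<kappa>"
proof -
  have c0: "c \<ge> 0" using c[OF t1] norm_ge_zero order_trans by blast
  have v00: "v 0 = v0" using v[of 0] t1 by simp
  have "\<exists>R. \<forall>t\<in>{0..T}. norm (u t) \<le> R" if "continuous_on {0..T} u" for u :: "real \<Rightarrow> 'e"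
    using compact_imp_bounded[OF compact_continuous_image[OF that compact_Icc]] by (auto simp: bounded_iff)
  from this[OF y] this[OF vc] obtain Ry Rv where
    R: "\<And>t. t \<in> {0..T} \<Longrightarrow> norm (y t) \<le> Ry" "\<And>t. t \<in> {0..T} \<Longrightarrow> norm (v t) \<le> Rv" by metis
  have Rv0: "Rv \<ge> 0" using R(2)[OF t1] norm_ge_zero order_trans by blast
  \<comment> \<open>Error budget: 3 * \<eta> in the Dini inequality (averaging f, replacing v by p
    inside F, and \<open>dissipative_shift\<close>), which is divided by \<kappa>, plus \<eta> each
    for replacing v by p at times 0 and t1.\<close>
  have main: "norm (v t1) \<le> exp (- \<kappa> * t1) * norm v0 + c / \<kappa> + (2 + 3 / \<kappa>) * \<eta>" if \<eta>: "\<eta> > 0" for \<eta>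
  proof -
    \<comment> \<open>The ball contains both y + v and y + p, as averaging enlarges norms by at most
      the factor \<open>C\<close>.\<close>
    have "uniformly_continuous_on (cball 0 (Ry + (C + 1) * Rv)) F" by (intro F_uniform) simp
    then obtain d where d: "d > 0" and "\<forall>b\<in>cball 0 (Ry + (C + 1) * Rv). \<forall>a\<in>cball 0 (Ry + (C + 1) * Rv).
        dist a b < d \<longrightarrow> dist (F a) (F b) < \<eta>"
      using \<eta> unfolding uniformly_continuous_on_def by blast
    then have F_close: "norm (F a - F b) < \<eta>"
      if "norm a \<le> Ry + (C + 1) * Rv" "norm b \<le> Ry + (C + 1) * Rv" "norm (a - b) < d" for a b
      using that by (simp add: dist_norm)
    define \<epsilon> where "\<epsilon> = min (d / 2) \<eta>"
    have \<epsilon>: "\<epsilon> > 0" "\<epsilon> < d" "\<epsilon> \<le> \<eta>" using d \<eta> by (auto simp: \<epsilon>_def min_def)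
    obtain h1 where h1: "h1 > 0" "\<forall>s\<in>{0..h1}. \<forall>t\<in>{0..T}. norm (S s (v t) - v t) \<le> \<epsilon>"
      using S_uniformly_close[OF vc \<epsilon>(1)] by blast
    obtain h2 where h2: "h2 > 0" "\<forall>s\<in>{0..h2}. \<forall>t\<in>{0..T}. norm (S s (f t) - f t) \<le> \<eta>"
      using S_uniformly_close[OF f \<eta>] by blast
    define h where "h = min h1 h2"
    have h: "h > 0" using h1 h2 by (simp add: h_def)
    define p where "p t = avg h (v t)" for t
    have pv: "norm (p t - v t) \<le> \<epsilon>" if "t \<in> {0..T}" for t
      unfolding p_def using h1(2) that by (intro avg_close h) (auto simp: h_def)
    have ff: "norm (avg h (f t) - f t) \<le> \<eta>" if "t \<in> {0..T}" for t
      using h2(2) that by (intro avg_close h) (auto simp: h_def)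
    have g_bound: "norm (p t1) \<le> exp (- \<kappa> * t1) * norm (p 0) + (c + 3 * \<eta>) / \<kappa>"
    proof (rule exp_decay_if_left_dini[where T = T])
      show "continuous_on {0..T} (\<lambda>t. norm (p t))"
      proof (rule continuous_on_norm, unfold continuous_on_iff, intro ballI allI impI)
        fix t e :: real assume t: "t \<in> {0..T}" and e: "e > 0"
        then obtain r where r: "r > 0" "\<And>s. s \<in> {0..T} \<Longrightarrow> dist s t < r \<Longrightarrow> dist (v s) (v t) < e / (C + 1)"
          using vc C_nonneg unfolding continuous_on_iff by (metis add_nonneg_pos divide_pos_pos zero_less_one)
        have "dist (p s) (p t) < e" if "s \<in> {0..T}" "dist s t < r" for s
        proof -
          have "dist (p s) (p t) \<le> C * dist (v s) (v t)"
            using norm_avg_le[OF h, of "v s - v t"] by (simp add: p_def dist_norm avg_diff)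
          also have "\<dots> \<le> C * (e / (C + 1))" using r(2)[OF that] C_nonneg by (intro mult_left_mono) auto
          also have "\<dots> < e" using C_nonneg e by (simp add: field_simps)
          finally show ?thesis .
        qed
        then show "\<exists>d>0. \<forall>x'\<in>{0..T}. dist x' t < d \<longrightarrow> dist (p x') (p t) < e" using r(1) by blast
      qed
      fix t \<eta>' :: real assume t: "0 < t" "t \<le> T" and \<eta>': "\<eta>' > 0"
      have tT: "t \<in> {0..T}" using t by simp
      have pD: "p t \<in> D" unfolding p_def by (rule avg_generator(1)[OF h])
      obtain xs where xs: "xs \<in> norm_subdiff (p t)"
        "blinfun_apply xs (A (p t) + F (y t + p t) - F (y t)) \<le> - \<kappa> * norm (p t) + \<eta>"
        using dissipative_shift[OF pD \<eta>] by blast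
      have n: "norm xs = 1" "blinfun_apply xs (p t) = norm (p t)" using xs(1) by (auto simp: norm_subdiff_def)
      have le: "blinfun_apply xs w \<le> norm w" for w using norm_blinfun[of xs w] n(1) by simp
      have "norm (p t) \<le> C * Rv"
        using norm_avg_le[OF h, of "v t"] mult_left_mono[OF R(2)[OF tT] C_nonneg] by (simp add: p_def)
      then have nb: "norm (y t + v t) \<le> Ry + (C + 1) * Rv" "norm (y t + p t) \<le> Ry + (C + 1) * Rv"
        using norm_triangle_ineq[of "y t" "v t"] norm_triangle_ineq[of "y t" "p t"] R[OF tT] Rv0
          mult_nonneg_nonneg[OF C_nonneg Rv0] by (auto simp: algebra_simps)
      have "norm (F (y t + v t) - F (y t + p t)) < \<eta>"
        using F_close[OF nb] pv[OF tT] \<epsilon>(2) by (simp add: norm_minus_commute)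
      then have err: "norm (avg h (f t) - (F (y t + p t) - F (y t))) \<le> c + 2 * \<eta>"
        using norm_triangle_ineq[of "avg h (f t) - f t" "(f t - (F (y t + v t) - F (y t))) + (F (y t + v t) - F (y t + p t))"]
          norm_triangle_ineq[of "f t - (F (y t + v t) - F (y t))" "F (y t + v t) - F (y t + p t)"]
          ff[OF tT] c[OF tT] by (simp add: algebra_simps)
      have "A (p t) + avg h (f t) = (A (p t) + F (y t + p t) - F (y t)) + (avg h (f t) - (F (y t + p t) - F (y t)))"
        by simp
      then have "blinfun_apply xs (A (p t) + avg h (f t)) = blinfun_apply xs (A (p t) + F (y t + p t) - F (y t)) +
          blinfun_apply xs (avg h (f t) - (F (y t + p t) - F (y t)))" by (metis blinfun.add_right)
      then have L: "blinfun_apply xs (A (p t) + avg h (f t)) \<le> - \<kappa> * norm (p t) + (c + 3 * \<eta>)"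
        using xs(2) le[of "avg h (f t) - (F (y t + p t) - F (y t))"] err by linarith
      have "((\<lambda>k. blinfun_apply xs ((p t - p (t - k)) /\<^sub>R k)) \<longlongrightarrow> blinfun_apply xs (A (p t) + avg h (f t))) (at_right 0)"
        unfolding p_def
        by (intro bounded_linear.tendsto[OF blinfun.bounded_linear_right] avg_left_derivative[OF f vc v h t])
      then have "\<forall>\<^sub>F k in at_right 0. blinfun_apply xs ((p t - p (t - k)) /\<^sub>R k) < blinfun_apply xs (A (p t) + avg h (f t)) + \<eta>'"
        using \<eta>' by (intro order_tendstoD(2)) auto
      then show "\<forall>\<^sub>F k in at_right 0. (norm (p t) - norm (p (t - k))) / k \<le> - \<kappa> * norm (p t) + (c + 3 * \<eta>) + \<eta>'"
        using eventually_at_right_less[of 0]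
      proof eventually_elim
        fix k :: real assume k: "blinfun_apply xs ((p t - p (t - k)) /\<^sub>R k) < blinfun_apply xs (A (p t) + avg h (f t)) + \<eta>'" "0 < k"
        \<comment> \<open>The functional attains the norm at p t and stays below it at p (t - k), so
          the quotient of norms is bounded above for left increments.\<close>
        have "(norm (p t) - norm (p (t - k))) / k \<le> (blinfun_apply xs (p t) - blinfun_apply xs (p (t - k))) / k"
          using n(2) le[of "p (t - k)"] k(2) by (intro divide_right_mono) auto
        also have "\<dots> = blinfun_apply xs ((p t - p (t - k)) /\<^sub>R k)"
          by (simp add: blinfun.scaleR_right blinfun.diff_right divide_inverse mult.commute)
        finally show "(norm (p t) - norm (p (t - k))) / k \<le> - \<kappa> * norm (p t) + (c + 3 * \<eta>) + \<eta>'"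
          using k(1) L by linarith
      qed
    qed (use \<kappa> c0 \<eta> t1 in auto)
    have "0 \<in> {0..T}" using t1 by auto
    then have "norm (p 0) \<le> norm v0 + \<eta>"
      using pv[of 0] \<epsilon>(3) norm_triangle_ineq[of v0 "p 0 - v0"] v00 by simp
    then have "exp (- \<kappa> * t1) * norm (p 0) \<le> exp (- \<kappa> * t1) * (norm v0 + \<eta>)"
      by (intro mult_left_mono) auto
    also have "\<dots> \<le> exp (- \<kappa> * t1) * norm v0 + \<eta>"
      using \<kappa> t1 \<eta> by (simp add: distrib_left mult_left_le_one_le)
    finally have "norm (p t1) \<le> exp (- \<kappa> * t1) * norm v0 + \<eta> + (c + 3 * \<eta>) / \<kappa>"
      using g_bound by linarith
    moreover have "norm (v t1) \<le> norm (p t1) + \<eta>"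
      using norm_triangle_ineq4[of "p t1" "p t1 - v t1"] pv[OF t1] \<epsilon>(3) by simp
    ultimately show ?thesis by (simp add: algebra_simps add_divide_distrib)
  qed
  show ?thesis
  proof (rule field_le_epsilon)
    fix \<epsilon> :: real assume "\<epsilon> > 0"
    have pos: "2 + 3 / \<kappa> > 0" using \<kappa> by (simp add: add_pos_pos)
    then have "\<epsilon> / (2 + 3 / \<kappa>) > 0" using \<open>\<epsilon> > 0\<close> by simp
    from main[OF this] pos show "norm (v t1) \<le> exp (- \<kappa> * t1) * norm v0 + c / \<kappa> + \<epsilon>" by simp
  qed
qed

end

section \<open>Controlled paths\<close>

context bounded_semigroup begin

text \<open>Restarting at a time \<open>r\<close> slightly before \<open>t0\<close> compares both v
  s and v t0 with the continuous orbit of v r; the remaining integrals run over an interval of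
  length at most 2 * d.\<close>

lemma duhamel_continuous:
  assumes f: "continuous_on {0..T} f"
    and v: "\<And>t. t \<in> {0..T} \<Longrightarrow> v t = S t v0 + integral {0..t} (\<lambda>s. S (t - s) (f s))"
  shows "continuous_on {0..T} v"
  unfolding continuous_on_iff
proof (intro ballI allI impI)
  fix t0 \<epsilon> :: real assume t0: "t0 \<in> {0..T}" and \<epsilon>: "\<epsilon> > 0"
  have "\<exists>B. \<forall>t\<in>{0..T}. norm (f t) \<le> B"
    using compact_imp_bounded[OF compact_continuous_image[OF f compact_Icc]] by (auto simp: bounded_iff)
  then obtain B0 where B0: "\<And>t. t \<in> {0..T} \<Longrightarrow> norm (f t) \<le> B0" by metis
  define B where "B = C * B0"
  have B: "B \<ge> 0" using B0[OF t0] C_nonneg norm_ge_zero[of "f t0"] unfolding B_def by (intro mult_nonneg_nonneg) linarith+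
  define d where "d = \<epsilon> / (8 * (B + 1))"
  have d: "d > 0" "B * (2 * d) \<le> \<epsilon> / 4" using \<epsilon> B by (auto simp: d_def field_simps)
  define r where "r = max 0 (t0 - d)"
  have r: "0 \<le> r" "r \<le> t0" using t0 d by (auto simp: r_def)
  define w where "w s = S (s - r) (v r)" for s
  have "continuous_on {r..} w" unfolding w_def by (intro continuous_on_S continuous_intros) auto
  then obtain d' where d': "d' > 0" "\<And>s. s \<in> {r..} \<Longrightarrow> dist s t0 < d' \<Longrightarrow> dist (w s) (w t0) < \<epsilon> / 4"
    unfolding continuous_on_iff using r \<epsilon> by (metis atLeast_iff divide_pos_pos zero_less_numeral)
  have vw: "norm (v s - w s) \<le> \<epsilon> / 4" if "r \<le> s" "s \<le> T" "s - r \<le> 2 * d" for s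
  proof -
    have "v s - w s = integral {r..s} (\<lambda>x. S (s - x) (f x))"
      using duhamel_restart[OF f v r(1) that(1,2)] by (simp add: w_def)
    also have "norm \<dots> \<le> B * (s - r)"
    proof (rule integral_bound[OF that(1)])
      show "continuous_on {r..s} (\<lambda>x. S (s - x) (f x))"
        using that r by (intro convolution_continuous continuous_on_subset[OF f]) auto
      fix x assume x: "x \<in> {r..s}"
      then have "norm (f x) \<le> B0" using that r by (intro B0) auto
      then show "norm (S (s - x) (f x)) \<le> B"
        using norm_S_le[of "s - x" "f x"] mult_left_mono[OF _ C_nonneg] x unfolding B_def by (force intro: order_trans)
    qed
    also have "\<dots> \<le> B * (2 * d)" using that B by (intro mult_left_mono) auto
    finally show ?thesis using d(2) by linarith
  qed
  have "dist (v s) (v t0) < \<epsilon>" if s: "s \<in> {0..T}" "dist s t0 < min d d'" for s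
  proof -
    have sr: "r \<le> s" "s - r \<le> 2 * d" "t0 - r \<le> 2 * d" using s d r by (auto simp: r_def dist_real_def)
    have "norm (v s - w s) \<le> \<epsilon> / 4" by (rule vw) (use sr s in auto)
    moreover have "norm (v t0 - w t0) \<le> \<epsilon> / 4" by (rule vw) (use sr r t0 in auto)
    moreover have "norm (w s - w t0) < \<epsilon> / 4" using d'(2)[of s] sr s by (auto simp: dist_norm)
    moreover have "norm (v s - v t0) \<le> norm (v s - w s) + norm (w s - w t0) + norm (v t0 - w t0)"
      using norm_triangle_ineq[of "v s - w s" "w s - w t0"] norm_triangle_ineq4[of "(v s - w s) + (w s - w t0)" "v t0 - w t0"]
      by simp
    ultimately show ?thesis using \<epsilon> by (simp add: dist_norm)
  qed
  then show "\<exists>d>0. \<forall>s\<in>{0..T}. dist s t0 < d \<longrightarrow> dist (v s) (v t0) < \<epsilon>"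
    using d d' by (intro exI[of _ "min d d'"]) auto
qed

end

text \<open>The index counts unit steps into the past, so the recursion is iterated towards minus
  infinity. The bound \<open>B\<close> is multiplied by q^n and disappears from the result.\<close>

lemma contraction_iterate_bound:
  fixes x :: "nat \<Rightarrow> real"
  assumes q: "0 \<le> q" "q < 1" and x: "\<And>j. j \<ge> J \<Longrightarrow> x j \<le> q * x (Suc j) + d"
    and B: "\<And>j. x j \<le> B" and j: "j \<ge> J"
  shows "x j \<le> d / (1 - q)"
proof (rule LIMSEQ_le[OF tendsto_const])
  have "x j \<le> q ^ n * x (j + n) + d * (1 - q ^ n) / (1 - q)" for n
  proof (induction n)
    case (Suc n)
    have "x j \<le> q ^ n * (q * x (Suc (j + n)) + d) + d * (1 - q ^ n) / (1 - q)"
      using Suc x[of "j + n"] j q mult_left_mono[of "x (j + n)" "q * x (Suc (j + n)) + d" "q ^ n"] by simp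
    also have "\<dots> = q ^ Suc n * x (j + Suc n) + d * (1 - q ^ Suc n) / (1 - q)"
      using q by (simp add: field_simps)
    finally show ?case .
  qed simp
  moreover have "q ^ n * x (j + n) \<le> q ^ n * B" for n using q B by (intro mult_left_mono) auto
  ultimately have "x j \<le> q ^ n * B + d * (1 - q ^ n) / (1 - q)" for n
    by (meson add_right_mono order_trans)
  then show "\<exists>N. \<forall>n\<ge>N. x j \<le> q ^ n * B + d * (1 - q ^ n) / (1 - q)" by blast
  have "(\<lambda>n. q ^ n) \<longlonglongrightarrow> 0" using q by (intro LIMSEQ_realpow_zero) auto
  then have "(\<lambda>n. q ^ n * B + d * (1 - q ^ n) / (1 - q)) \<longlonglongrightarrow> 0 * B + d * (1 - 0) / (1 - q)"
    using q by (intro tendsto_intros) auto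
  then show "(\<lambda>n. q ^ n * B + d * (1 - q ^ n) / (1 - q)) \<longlonglongrightarrow> d / (1 - q)" by simp
qed

section \<open>Splitting a controlled path into drift and response\<close>

locale controlled_system = noise_system S C SQ K e + dissipative_semigroup S C D A F \<kappa>
  for S :: "real \<Rightarrow> 'e::banach \<Rightarrow>\<^sub>L 'e" and C
    and SQ :: "real \<Rightarrow> 'h::{real_inner, complete_space, second_countable_topology} \<Rightarrow>\<^sub>L 'e" and K e
    and D A F \<kappa>
begin

definition residual :: "(real \<Rightarrow> 'e) \<Rightarrow> real \<Rightarrow> 'e" where
  "residual X t = X t - S t (X 0) - integral {0..t} (\<lambda>s. S (t - s) (F (X s)))"

definition driven :: "real \<Rightarrow> real \<Rightarrow> (real \<Rightarrow> 'e) \<Rightarrow> bool" where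
  "driven T E X \<longleftrightarrow> continuous_on {0..T} X \<and> residual X \<in> responses T E"

text \<open>The equation leaves a single candidate for the weak integral, namely what remains of X
  after removing the drift.\<close>

lemma mild_solution_iff_responds:
  assumes "L2_control T \<psi>"
  shows "mild_solution S F SQ T (X 0) \<psi> X \<longleftrightarrow> continuous_on {0..T} X \<and> responds T \<psi> (residual X)"
proof -
  have "(\<exists>y. P y \<and> X t = S t (X 0) + integral {0..t} (\<lambda>s. S (t - s) (F (X s))) + y) \<longleftrightarrow> P (residual X t)" for P t
  proof -
    have "X t = S t (X 0) + integral {0..t} (\<lambda>s. S (t - s) (F (X s))) + y \<longleftrightarrow> y = residual X t" for y
      unfolding residual_def by (auto simp: algebra_simps)
    then show ?thesis by simp
  qed
  then show ?thesis using assms by (simp add: mild_solution_def responds_def)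
qed

text \<open>Energy is twice the action, hence the factor 2. The inequality is strict because the
  infimum in the action need not be known to be attained at this point.\<close>

lemma driven_if_action0_le:
  assumes "action0 S F SQ T X \<le> ereal r" "2 * r < E"
  shows "driven T E X"
proof -
  have "action0 S F SQ T X < ereal (E / 2)" by (rule le_less_trans[OF assms(1)]) (use assms(2) in simp)
  then obtain \<psi> where \<psi>: "L2_control T \<psi>" "mild_solution S F SQ T (X 0) \<psi> X"
    "ereal (1/2 * (LINT s:{0..T}|lborel. (norm (\<psi> s))\<^sup>2)) < ereal (E / 2)"
    unfolding action0_def INF_less_iff by blast
  then show ?thesis
    using mild_solution_iff_responds[OF \<psi>(1), of X] unfolding driven_def responses_def energy_def by auto
qed

lemma action0_le_if_driven:
  assumes "driven T (2 * r) X"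
  shows "action0 S F SQ T X \<le> ereal r"
proof -
  obtain \<psi> where \<psi>: "responds T \<psi> (residual X)" "energy 0 T \<psi> \<le> 2 * r"
    using assms by (auto simp: driven_def responses_def)
  then have c: "L2_control T \<psi>" by (simp add: responds_def)
  have "mild_solution S F SQ T (X 0) \<psi> X"
    using mild_solution_iff_responds[OF c] \<psi>(1) assms by (simp add: driven_def)
  then show ?thesis unfolding action0_def
    using c \<psi>(2) by (intro INF_lower2[of \<psi>]) (auto simp: energy_def)
qed

lemma responses_mono: "z \<in> responses T E \<Longrightarrow> E \<le> E' \<Longrightarrow> z \<in> responses T E'"
  unfolding responses_def by force

lemma F_path_continuous: "continuous_on X u \<Longrightarrow> continuous_on X (\<lambda>s. F (u s))"
  by (rule continuous_on_compose2[OF F_continuous[of UNIV]]) auto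

definition drift :: "(real \<Rightarrow> 'e) \<Rightarrow> real \<Rightarrow> 'e" where
  "drift X t = S t (X 0) + integral {0..t} (\<lambda>s. S (t - s) (F (X s)))"

lemma residual_drift: "residual X t = X t - drift X t"
  by (simp add: residual_def drift_def)

lemma drift_continuous: "continuous_on {0..T} X \<Longrightarrow> continuous_on {0..T} (drift X)"
  by (rule duhamel_continuous[OF F_path_continuous]) (auto simp: drift_def)

lemma residual_continuous: "continuous_on {0..T} X \<Longrightarrow> continuous_on {0..T} (residual X)"
  unfolding residual_drift[abs_def] by (intro continuous_intros drift_continuous)

lemma residual_restart:
  assumes X: "continuous_on {0..T} X" and a: "0 \<le> a" and t: "0 \<le> t" "t + a \<le> T"
  shows "residual (\<lambda>s. X (s + a)) t = residual X (t + a) - S t (residual X a)"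
proof -
  have "drift X (t + a) = S (t + a - a) (drift X a) + integral {a..t + a} (\<lambda>r. S (t + a - r) (F (X r)))"
    by (rule duhamel_restart[OF F_path_continuous[OF X]]) (use a t in \<open>auto simp: drift_def\<close>)
  also have "integral {a..t + a} (\<lambda>r. S (t + a - r) (F (X r))) = integral {0..t} (\<lambda>s. S (t - s) (F (X (s + a))))"
    using integral_shift_real_ivl[where f = "\<lambda>r. S (t + a - r) (F (X r))" and a = a and b = "t + a" and c = a] by simp
  finally show ?thesis
    by (simp add: residual_drift[of X] residual_def[of "\<lambda>s. X (s + a)"] blinfun.diff_right)
qed

text \<open>Cutting at time \<open>a\<close> leaves the increment of the old residual after
  transport by \<open>S\<close>, which \<open>responds_increment\<close> represents over the
  remaining interval; the rest is translation of integrals.\<close>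

lemma responds_shift:
  assumes X: "continuous_on {0..T} X" and \<psi>: "responds T \<psi> (residual X)" and ab: "0 \<le> a" "a \<le> b" "b \<le> T"
  shows "responds (b - a) (\<lambda>s. \<psi> (s + a)) (residual (\<lambda>s. X (s + a)))"
    and "energy 0 (b - a) (\<lambda>s. \<psi> (s + a)) = energy a b \<psi>"
proof -
  have c: "L2_control T \<psi>" using \<psi> by (simp add: responds_def)
  have ind: "indicator {0..t} s = (indicator {a..t + a} (a + 1 * s) :: real)" for s t by (simp add: indicator_def)
  have "integrable lborel (\<lambda>s. indicator {a..b} s *\<^sub>R (norm (\<psi> s))\<^sup>2)"
    using L2_control_integrable[OF c, of a b] ab by (simp add: set_integrable_def)
  then have "integrable lborel (\<lambda>s. indicator {a..b} (a + 1 * s) *\<^sub>R (norm (\<psi> (a + 1 * s)))\<^sup>2)"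
    by (subst lborel_integrable_real_affine_iff) simp_all
  then have i: "set_integrable lborel {0..b - a} (\<lambda>s. (norm (\<psi> (s + a)))\<^sup>2)"
    using ind[of "b - a"] by (simp add: set_integrable_def add.commute)
  have mT: "(\<lambda>s. indicator {0..T} s *\<^sub>R \<psi> s) \<in> borel_measurable borel"
    using c by (simp add: L2_control_def set_borel_measurable_def)
  have "(\<lambda>s. indicator {a..b} s *\<^sub>R (indicator {0..T} s *\<^sub>R \<psi> s)) \<in> borel_measurable borel"
    by (rule borel_measurable_scaleR[OF borel_measurable_indicator mT]) simp
  moreover have "(\<lambda>s. indicator {a..b} s *\<^sub>R (indicator {0..T} s *\<^sub>R \<psi> s)) = (\<lambda>s. indicator {a..b} s *\<^sub>R \<psi> s)"
    using ab by (intro ext) (auto simp: indicator_def)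
  ultimately have "(\<lambda>s. indicator {a..b} s *\<^sub>R \<psi> s) \<in> borel_measurable borel" by (simp only:)
  then have "(\<lambda>s. indicator {a..b} (a + 1 * s) *\<^sub>R \<psi> (a + 1 * s)) \<in> borel_measurable borel"
    by (rule measurable_compose[rotated]) simp
  then have m: "set_borel_measurable lborel {0..b - a} (\<lambda>s. \<psi> (s + a))"
    using ind[of "b - a"] by (simp add: set_borel_measurable_def add.commute)
  have w: "has_weak_integral {0..t} (\<lambda>s. SQ (t - s) (\<psi> (s + a))) (residual (\<lambda>s. X (s + a)) t)" if t: "t \<in> {0..b - a}" for t
  proof -
    have "has_weak_integral {a..t + a} (\<lambda>r. SQ (t + a - r) (\<psi> r)) (residual X (t + a) - S (t + a - a) (residual X a))"
      by (rule responds_increment[OF \<psi>]) (use ab t in auto)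
    then have W: "has_weak_integral {a..t + a} (\<lambda>r. SQ (t + a - r) (\<psi> r)) (residual (\<lambda>s. X (s + a)) t)"
      using residual_restart[OF X ab(1), of t] t ab by simp
    show ?thesis unfolding has_weak_integral_def
    proof (intro allI conjI)
      fix x :: "'e \<Rightarrow>\<^sub>L real"
      define f where "f r = indicator {a..t + a} r *\<^sub>R blinfun_apply x (SQ (t + a - r) (\<psi> r))" for r
      have f: "integrable lborel f" "integral\<^sup>L lborel f = blinfun_apply x (residual (\<lambda>s. X (s + a)) t)"
        using W unfolding has_weak_integral_def set_integrable_def set_lebesgue_integral_def f_def[abs_def] by blast+
      have e: "indicator {0..t} s *\<^sub>R blinfun_apply x (SQ (t - s) (\<psi> (s + a))) = f (a + 1 * s)" for s
        using ind[of t s] by (simp add: f_def add.commute)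
      show "set_integrable lborel {0..t} (\<lambda>s. blinfun_apply x (SQ (t - s) (\<psi> (s + a))))"
        unfolding set_integrable_def e using f(1) by (subst lborel_integrable_real_affine_iff) simp_all
      show "(LINT s:{0..t}|lborel. blinfun_apply x (SQ (t - s) (\<psi> (s + a)))) = blinfun_apply x (residual (\<lambda>s. X (s + a)) t)"
        unfolding set_lebesgue_integral_def e using lborel_integral_real_affine[of 1 f a] f(2) by simp
    qed
  qed
  show "responds (b - a) (\<lambda>s. \<psi> (s + a)) (residual (\<lambda>s. X (s + a)))"
    unfolding responds_def L2_control_def using m i w by blast
  show "energy 0 (b - a) (\<lambda>s. \<psi> (s + a)) = energy a b \<psi>"
    using lborel_integral_real_affine[of 1 "\<lambda>s. indicator {a..b} s *\<^sub>R (norm (\<psi> s))\<^sup>2" a] ind[of "b - a"]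
    by (simp add: energy_def set_lebesgue_integral_def add.commute)
qed

lemma driven_restrict:
  assumes "driven T E X" "0 \<le> b" "b \<le> T"
  shows "driven b E X"
proof -
  obtain \<psi> where \<psi>: "responds T \<psi> (residual X)" "energy 0 T \<psi> \<le> E" and X: "continuous_on {0..T} X"
    using assms(1) by (auto simp: driven_def responses_def)
  from responds_shift[OF X \<psi>(1), of 0 b] assms(2,3)
  have r: "responds b \<psi> (residual X)" by simp
  have "energy 0 b \<psi> \<le> E"
    using energy_mono[of T \<psi> 0 b] \<psi> assms(3) by (auto simp: responds_def)
  then show ?thesis using r X assms(3) by (auto simp: driven_def responses_def intro: continuous_on_subset)
qed

text \<open>Apply \<open>comparison\<close> to the drift with y the residual. The forcing F X is F
  (y + v), so it misses the required difference exactly by F y, which is bounded because the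
  residual is.\<close>

lemma driven_bound:
  assumes X: "continuous_on {0..T} X" and b: "\<And>t. t \<in> {0..T} \<Longrightarrow> norm (residual X t) \<le> b"
    and c: "\<And>z. norm z \<le> b \<Longrightarrow> norm (F z) \<le> c" and t: "t \<in> {0..T}"
  shows "norm (X t) \<le> exp (- \<kappa> * t) * norm (X 0) + (c / \<kappa> + b)"
proof -
  have "norm (drift X t) \<le> exp (- \<kappa> * t) * norm (X 0) + c / \<kappa>"
  proof (rule comparison[OF F_path_continuous[OF X] drift_continuous[OF X] residual_continuous[OF X] _ _ t])
    fix t assume t: "t \<in> {0..T}"
    show "drift X t = S t (X 0) + integral {0..t} (\<lambda>s. S (t - s) (F (X s)))" by (simp add: drift_def)
    have "residual X t + drift X t = X t" by (simp add: residual_drift)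
    then show "norm (F (X t) - (F (residual X t + drift X t) - F (residual X t))) \<le> c"
      using c[OF b[OF t]] by simp
  qed
  moreover have "norm (X t) \<le> norm (drift X t) + norm (residual X t)"
    using norm_triangle_ineq[of "drift X t" "residual X t"] by (simp add: residual_drift)
  ultimately show ?thesis using b[OF t] by simp
qed

text \<open>Balls need not be compact, so boundedness is obtained by walking from 0 to z in N steps
  shorter than d, each of which changes \<open>F\<close> by less than 1.\<close>

lemma F_bounded_on_ball: "\<exists>B. \<forall>z. norm z \<le> R \<longrightarrow> norm (F z) \<le> B"
proof -
  have "uniformly_continuous_on (cball 0 R) F" by (rule F_uniform) simp
  then obtain d where d: "d > 0" "\<forall>a\<in>cball 0 R. \<forall>b\<in>cball 0 R. dist b a < d \<longrightarrow> dist (F b) (F a) < 1"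
    unfolding uniformly_continuous_on_def using zero_less_one by blast
  obtain N :: nat where N: "\<bar>R\<bar> / d < real N" using reals_Archimedean2 by blast
  have N0: "N > 0" by (rule gr0I) (use N d in \<open>auto simp: divide_less_0_iff\<close>)
  have "norm (F z) \<le> real N" if z: "norm z \<le> R" for z
  proof -
    have "norm (F ((real i / real N) *\<^sub>R z)) \<le> real i" if "i \<le> N" for i
      using that
    proof (induction i)
      case 0
      then show ?case by (simp add: F_zero)
    next
      case (Suc i)
      have le: "(real j / real N) * norm z \<le> R" if "j \<le> N" for j
        using that z N0 mult_right_mono[of "real j / real N" 1 "norm z"] by simp
      have "(real (Suc i) / real N) *\<^sub>R z - (real i / real N) *\<^sub>R z = (1 / real N) *\<^sub>R z"
        by (simp add: scaleR_diff_left[symmetric] diff_divide_distrib[symmetric])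
      then have "dist ((real (Suc i) / real N) *\<^sub>R z) ((real i / real N) *\<^sub>R z) = norm z / real N"
        by (simp add: dist_norm)
      also have "\<dots> < d"
      proof -
        have "norm z < real N * d" using N z d(1) by (simp add: divide_less_eq)
        then show ?thesis using N0 by (simp add: divide_less_eq mult.commute)
      qed
      finally have "dist (F ((real (Suc i) / real N) *\<^sub>R z)) (F ((real i / real N) *\<^sub>R z)) < 1"
        using d(2) le[of "Suc i"] le[of i] Suc.prems by (simp add: abs_of_nonneg)
      then show ?case using Suc norm_triangle_ineq2[of "F ((real (Suc i) / real N) *\<^sub>R z)" "F ((real i / real N) *\<^sub>R z)"]
        by (simp add: dist_norm)
    qed
    from this[of N] show ?thesis using N0 by simp
  qed
  then show ?thesis by blast
qed

lemma unit_growth: "\<exists>d. \<forall>X. driven 1 E X \<longrightarrow> (\<forall>t\<in>{0..1}. norm (X t) \<le> exp (- \<kappa> * t) * norm (X 0) + d)"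
proof -
  obtain B where B: "\<And>E z t. z \<in> responses 1 E \<Longrightarrow> t \<in> {0..1} \<Longrightarrow> norm (z t) \<le> sqrt (E * B)"
    using responses_bounded[OF zero_less_one] by metis
  obtain c where c: "\<And>z. norm z \<le> sqrt (E * B) \<Longrightarrow> norm (F z) \<le> c" using F_bounded_on_ball by metis
  show ?thesis
  proof (intro exI allI impI ballI)
    fix X t assume X: "driven 1 E X" and t: "t \<in> {0..1::real}"
    show "norm (X t) \<le> exp (- \<kappa> * t) * norm (X 0) + (c / \<kappa> + sqrt (E * B))"
      by (rule driven_bound[OF _ B[of "residual X" E] c t]) (use X in \<open>auto simp: driven_def\<close>)
  qed
qed

text \<open>Since \<open>F\<close> vanishes at 0 and is continuous there, a small residual adds
  little both directly and through the forcing in \<open>driven_bound\<close>.\<close>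

lemma unit_growth_small:
  assumes "\<eta> > 0"
  shows "\<exists>E>0. \<forall>X. driven 1 E X \<longrightarrow> (\<forall>t\<in>{0..1}. norm (X t) \<le> exp (- \<kappa> * t) * norm (X 0) + \<eta>)"
proof -
  obtain B where B0: "B \<ge> 0" and B: "\<And>E z t. z \<in> responses 1 E \<Longrightarrow> t \<in> {0..1} \<Longrightarrow> norm (z t) \<le> sqrt (E * B)"
    using responses_bounded[OF zero_less_one] by metis
  have "isCont F 0" using F_continuous[of UNIV] by (simp add: continuous_on_eq_continuous_at)
  moreover have "\<eta> * \<kappa> / 2 > 0" using assms \<kappa> by simp
  ultimately obtain \<rho> where \<rho>: "\<rho> > 0" "\<forall>z. dist z 0 < \<rho> \<longrightarrow> dist (F z) (F 0) < \<eta> * \<kappa> / 2"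
    unfolding continuous_at_eps_delta by blast
  \<comment> \<open>Half of \<eta> is reserved for the residual, the other half for the forcing
    divided by \<kappa>; \<open>E\<close> is then chosen so that sqrt (E * B) is at most b.\<close>
  define b where "b = min (\<rho> / 2) (\<eta> / 2)"
  have b: "b > 0" "b < \<rho>" "b \<le> \<eta> / 2" using \<rho>(1) assms by (auto simp: b_def min_def)
  define E where "E = b\<^sup>2 / (B + 1)"
  have E: "E > 0" using b B0 by (simp add: E_def)
  have "E * B = b\<^sup>2 * (B / (B + 1))" by (simp add: E_def)
  also have "\<dots> \<le> b\<^sup>2 * 1" using B0 by (intro mult_left_mono) auto
  finally have "sqrt (E * B) \<le> b" using b(1) by (intro real_le_lsqrt) auto
  then have z: "norm (residual X t) \<le> b" if "driven 1 E X" "t \<in> {0..1}" for X t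
    using B[of "residual X" E t] that by (auto simp: driven_def)
  have Fb: "norm (F z) \<le> \<eta> * \<kappa> / 2" if "norm z \<le> b" for z
  proof -
    have "dist z 0 < \<rho>" using that b(2) by simp
    then have "dist (F z) (F 0) < \<eta> * \<kappa> / 2" using \<rho>(2) by blast
    then show ?thesis by (simp add: F_zero)
  qed
  have "norm (X t) \<le> exp (- \<kappa> * t) * norm (X 0) + \<eta>" if X: "driven 1 E X" and t: "t \<in> {0..1}" for X t
  proof -
    have "norm (X t) \<le> exp (- \<kappa> * t) * norm (X 0) + (\<eta> * \<kappa> / 2 / \<kappa> + b)"
      using X t z[OF X] Fb by (intro driven_bound[where T = 1]) (auto simp: driven_def)
    also have "\<eta> * \<kappa> / 2 / \<kappa> = \<eta> / 2" using \<kappa> by simp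
    finally show ?thesis using b(3) by simp
  qed
  then show ?thesis using E by blast
qed

end

section \<open>Compactness criterion for locally uniform convergence\<close>

lemma compactin_local_uniform_topologyI:
  fixes \<K> :: "(real \<Rightarrow> 'e::complete_space) set"
  assumes sub: "\<K> \<subseteq> neg_paths"
    and tb: "\<And>m \<epsilon>. m > 0 \<Longrightarrow> \<epsilon> > 0 \<Longrightarrow> \<exists>c :: (real \<Rightarrow> 'e) \<Rightarrow> nat. finite (c ` \<K>) \<and>
      (\<forall>\<phi>\<in>\<K>. \<forall>\<eta>\<in>\<K>. c \<phi> = c \<eta> \<longrightarrow> (\<forall>t\<in>{-m..0}. dist (\<phi> t) (\<eta> t) \<le> \<epsilon>))"
    and closed: "\<And>f \<phi>. (\<And>n. f n \<in> \<K>) \<Longrightarrow> \<phi> \<in> neg_paths \<Longrightarrow>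
      (\<And>m \<epsilon>. m > 0 \<Longrightarrow> \<epsilon> > 0 \<Longrightarrow> \<exists>n::nat. \<forall>t\<in>{-m..0}. dist (f n t) (\<phi> t) \<le> \<epsilon>) \<Longrightarrow> \<phi> \<in> \<K>"
  shows "compactin local_uniform_topology \<K>"
  unfolding compactin_def topspace_local_uniform_topology
proof (intro conjI sub allI impI)
  fix \<U> :: "(real \<Rightarrow> 'e) set set"
  assume \<U>: "(\<forall>U\<in>\<U>. openin local_uniform_topology U) \<and> \<K> \<subseteq> \<Union>\<U>"
  \<comment> \<open>Heine-Borel by subdivision: a set without finite subcover splits into finitely
    many small pieces, one of which again has none. The nested pieces shrink to a path of the set,
    and a single open set around it covers a late piece.\<close>
  define cov where "cov A \<longleftrightarrow> (\<exists>\<F>. finite \<F> \<and> \<F> \<subseteq> \<U> \<and> A \<subseteq> \<Union>\<F>)" for A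
  define small where "small n A \<longleftrightarrow> (\<forall>\<phi>\<in>A. \<forall>\<eta>\<in>A. \<forall>t\<in>{- real (Suc n)..0}. dist (\<phi> t) (\<eta> t) \<le> 1 / real (Suc n))"
    for n and A :: "(real \<Rightarrow> 'e) set"
  have cov_Union: "cov (\<Union>\<A>)" if "finite \<A>" "\<And>A. A \<in> \<A> \<Longrightarrow> cov A" for \<A>
    using that
  proof (induction \<A>)
    case empty
    then show ?case unfolding cov_def by (intro exI[of _ "{}"]) auto
  next
    case (insert A \<A>)
    then have "cov A" "cov (\<Union>\<A>)" by auto
    then obtain \<F> \<G> where "finite \<F>" "\<F> \<subseteq> \<U>" "A \<subseteq> \<Union>\<F>" "finite \<G>" "\<G> \<subseteq> \<U>" "\<Union>\<A> \<subseteq> \<Union>\<G>"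
      unfolding cov_def by (elim exE conjE)
    then show ?case unfolding cov_def by (intro exI[of _ "\<F> \<union> \<G>"]) auto
  qed
  have split: "\<exists>B. (B \<subseteq> \<K> \<and> \<not> cov B \<and> small n B) \<and> B \<subseteq> A" if A: "A \<subseteq> \<K>" "\<not> cov A" for A n
  proof -
    have "real (Suc n) > 0" "1 / real (Suc n) > 0" by auto
    from tb[OF this] obtain c :: "(real \<Rightarrow> 'e) \<Rightarrow> nat" where c: "finite (c ` \<K>)"
      "\<forall>\<phi>\<in>\<K>. \<forall>\<eta>\<in>\<K>. c \<phi> = c \<eta> \<longrightarrow> (\<forall>t\<in>{- real (Suc n)..0}. dist (\<phi> t) (\<eta> t) \<le> 1 / real (Suc n))"
      by (elim exE conjE)
    define P where "P i = {\<phi>\<in>A. c \<phi> = i}" for i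
    have "finite (c ` A)" using c(1) A(1) by (meson finite_subset image_mono)
    then have "finite (P ` (c ` A))" by simp
    moreover have "A = \<Union>(P ` (c ` A))" by (auto simp: P_def)
    ultimately obtain i where i: "\<not> cov (P i)" using cov_Union[of "P ` (c ` A)"] A(2) by auto
    have "small n (P i)" unfolding small_def
    proof (intro ballI)
      fix \<phi> \<eta> t assume "\<phi> \<in> P i" "\<eta> \<in> P i" "t \<in> {- real (Suc n)..0}"
      then show "dist (\<phi> t) (\<eta> t) \<le> 1 / real (Suc n)" using c(2) A(1) by (auto simp: P_def subset_iff)
    qed
    then show ?thesis using i A(1) by (intro exI[of _ "P i"]) (auto simp: P_def)
  qed
  have "cov \<K>"
  proof (rule ccontr)
    assume n: "\<not> cov \<K>"
    have "\<exists>f. \<forall>n. (f n \<subseteq> \<K> \<and> \<not> cov (f n) \<and> small n (f n)) \<and> f (Suc n) \<subseteq> f n"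
    proof (rule dependent_nat_choice)
      show "\<exists>x. x \<subseteq> \<K> \<and> \<not> cov x \<and> small 0 x" using split[OF order_refl n, of 0] by blast
      fix x n assume "x \<subseteq> \<K> \<and> \<not> cov x \<and> small n x"
      then show "\<exists>y. (y \<subseteq> \<K> \<and> \<not> cov y \<and> small (Suc n) y) \<and> y \<subseteq> x" by (intro split) auto
    qed
    then obtain Cs where Cs: "\<And>n. Cs n \<subseteq> \<K>" "\<And>n. \<not> cov (Cs n)" "\<And>n. small n (Cs n)" "\<And>n. Cs (Suc n) \<subseteq> Cs n"
      by metis
    have "Cs n \<noteq> {}" for n
    proof
      assume "Cs n = {}"
      then have "cov (Cs n)" unfolding cov_def by (intro exI[of _ "{}"]) auto
      then show False using Cs(2) by blast
    qed
    then have "\<forall>n. \<exists>\<phi>. \<phi> \<in> Cs n" by blast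
    then obtain g where g: "\<And>n. g n \<in> Cs n" by metis
    have dec: "Cs k \<subseteq> Cs n" if "n \<le> k" for n k using that Cs(4) by (rule lift_Suc_antimono_le[rotated])
    have g_close: "dist (\<eta> t) (g k t) \<le> 1 / real (Suc n)" if "n \<le> k" "\<eta> \<in> Cs n" "- real (Suc n) \<le> t" "t \<le> 0" for n k \<eta> t
      using Cs(3)[of n] dec[OF that(1)] g[of k] that unfolding small_def by auto
    have small_n: "\<exists>n. m \<le> real (Suc n) \<and> 1 / real (Suc n) < \<epsilon>" if "\<epsilon> > 0" for m \<epsilon> :: real
    proof -
      obtain n :: nat where "max m (1 / \<epsilon>) < real n" using reals_Archimedean2 by blast
      then have "m \<le> real (Suc n)" "1 / \<epsilon> < real (Suc n)" by auto
      then show ?thesis using that by (intro exI[of _ n]) (auto simp: field_simps)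
    qed
    \<comment> \<open>Restriction makes the limit extensional, as membership in
      \<open>neg_paths\<close> demands.\<close>
    define \<phi> where "\<phi> = restrict (\<lambda>t. lim (\<lambda>n. g n t)) {..0}"
    have lim: "(\<lambda>n. g n t) \<longlonglongrightarrow> \<phi> t" if t: "t \<le> 0" for t
    proof -
      have "Cauchy (\<lambda>n. g n t)"
      proof (rule metric_CauchyI)
        fix \<epsilon> :: real assume "\<epsilon> > 0"
        then have "\<epsilon> / 2 > 0" by simp
        from small_n[OF this, of "- t"] obtain n where n: "- t \<le> real (Suc n)" "1 / real (Suc n) < \<epsilon> / 2" by blast
        have "dist (g j t) (g k t) < \<epsilon>" if "j \<ge> n" "k \<ge> n" for j k
        proof -
          have "dist (g n t) (g j t) \<le> 1 / real (Suc n)" "dist (g n t) (g k t) \<le> 1 / real (Suc n)"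
            using g_close[OF that(1) g, of t] g_close[OF that(2) g, of t] n(1) t by auto
          then show ?thesis using n(2) dist_triangle3[of "g j t" "g k t" "g n t"] by linarith
        qed
        then show "\<exists>M. \<forall>m\<ge>M. \<forall>n\<ge>M. dist (g m t) (g n t) < \<epsilon>" by blast
      qed
      then show ?thesis using t by (simp add: \<phi>_def Cauchy_convergent_iff convergent_LIMSEQ_iff)
    qed
    have \<phi>_close: "dist (\<eta> t) (\<phi> t) \<le> 1 / real (Suc n)" if "\<eta> \<in> Cs n" "- real (Suc n) \<le> t" "t \<le> 0" for n \<eta> t
    proof (rule LIMSEQ_le_const2)
      show "(\<lambda>k. dist (\<eta> t) (g k t)) \<longlonglongrightarrow> dist (\<eta> t) (\<phi> t)" by (intro tendsto_intros lim that)
      show "\<exists>N. \<forall>k\<ge>N. dist (\<eta> t) (g k t) \<le> 1 / real (Suc n)" using g_close that by blast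
    qed
    have "continuous_on {..0} \<phi>"
      unfolding continuous_on_iff
    proof (intro ballI allI impI)
      fix t0 \<epsilon> :: real assume t0: "t0 \<in> {..0}" and \<epsilon>: "\<epsilon> > 0"
      then have "\<epsilon> / 4 > 0" by simp
      \<comment> \<open>The window reaches one unit to the left of \<open>t0\<close>, so it contains
        all points at distance below 1 that are considered.\<close>
      from small_n[OF this, of "1 - t0"] obtain n where n: "1 - t0 \<le> real (Suc n)" "1 / real (Suc n) < \<epsilon> / 4" by blast
      have "continuous_on {..0} (g n)" using g[of n] Cs(1)[of n] sub by (auto simp: neg_paths_def)
      then obtain d where d: "d > 0" "\<And>t. t \<in> {..0} \<Longrightarrow> dist t t0 < d \<Longrightarrow> dist (g n t) (g n t0) < \<epsilon> / 4"
        unfolding continuous_on_iff using t0 \<open>\<epsilon> / 4 > 0\<close> by blast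
      have "dist (\<phi> t) (\<phi> t0) < \<epsilon>" if t: "t \<in> {..0}" "dist t t0 < min d 1" for t
      proof -
        have "dist (g n t) (\<phi> t) \<le> 1 / real (Suc n)"
          using t n(1) by (intro \<phi>_close g) (auto simp: dist_real_def)
        moreover have "dist (g n t0) (\<phi> t0) \<le> 1 / real (Suc n)"
          using t0 n(1) by (intro \<phi>_close g) auto
        moreover have "dist (g n t) (g n t0) < \<epsilon> / 4" using d(2) t by simp
        moreover have "dist (\<phi> t) (\<phi> t0) \<le> dist (g n t) (\<phi> t) + dist (g n t) (g n t0) + dist (g n t0) (\<phi> t0)"
          using dist_triangle3[of "\<phi> t" "\<phi> t0" "g n t"] dist_triangle[of "g n t" "\<phi> t0" "g n t0"] by simp
        ultimately show ?thesis using n(2) \<epsilon> by linarith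
      qed
      then show "\<exists>d>0. \<forall>t\<in>{..0}. dist t t0 < d \<longrightarrow> dist (\<phi> t) (\<phi> t0) < \<epsilon>"
        using d(1) by (intro exI[of _ "min d 1"]) auto
    qed
    then have \<phi>_path: "\<phi> \<in> neg_paths" by (simp add: neg_paths_def \<phi>_def)
    have "\<phi> \<in> \<K>"
    proof (rule closed[OF _ \<phi>_path])
      show "g n \<in> \<K>" for n using g Cs(1) by blast
      fix m \<epsilon> :: real assume "m > 0" "\<epsilon> > 0"
      from small_n[OF this(2), of m] obtain n where n: "m \<le> real (Suc n)" "1 / real (Suc n) < \<epsilon>" by blast
      have "dist (g n t) (\<phi> t) \<le> \<epsilon>" if "t \<in> {-m..0}" for t
        using \<phi>_close[OF g, of n t] n that by auto
      then show "\<exists>n. \<forall>t\<in>{-m..0}. dist (g n t) (\<phi> t) \<le> \<epsilon>" by blast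
    qed
    then obtain U where U: "U \<in> \<U>" "\<phi> \<in> U" using \<U> by blast
    then obtain T \<epsilon> where T: "T > 0" "\<epsilon> > 0" "neg_paths_ball \<phi> T \<epsilon> \<subseteq> U"
      using \<U> unfolding openin_local_uniform_topology by meson
    from small_n[OF T(2), of T] obtain n where n: "T \<le> real (Suc n)" "1 / real (Suc n) < \<epsilon>" by blast
    have "Cs n \<subseteq> neg_paths_ball \<phi> T \<epsilon>"
    proof
      fix \<eta> assume \<eta>: "\<eta> \<in> Cs n"
      have "dist (\<eta> t) (\<phi> t) < \<epsilon>" if "t \<in> {-T..0}" for t
        using \<phi>_close[OF \<eta>, of t] n that by auto
      then show "\<eta> \<in> neg_paths_ball \<phi> T \<epsilon>" using \<eta> Cs(1) sub by (auto simp: neg_paths_ball_def)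
    qed
    then have "cov (Cs n)" unfolding cov_def using U(1) T(3) by (intro exI[of _ "{U}"]) auto
    then show False using Cs(2) by blast
  qed
  then show "\<exists>\<F>. finite \<F> \<and> \<F> \<subseteq> \<U> \<and> \<K> \<subseteq> \<Union>\<F>" by (simp add: cov_def)
qed

section \<open>Paths of bounded action on the half-line\<close>

context controlled_system begin

lemma energy_split:
  assumes c: "L2_control T \<psi>" and n: "real n \<le> T"
  shows "energy 0 (real n) \<psi> = (\<Sum>i<n. energy (real i) (real (Suc i)) \<psi>)"
  using n
proof (induction n)
  case 0
  have "AE s in lborel. s \<noteq> (0::real)" by (rule AE_lborel_singleton)
  then have "(\<integral>s. indicator {0..0} s *\<^sub>R (norm (\<psi> s))\<^sup>2 \<partial>lborel) = (\<integral>s. 0 \<partial>(lborel :: real measure))"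
  proof (intro integral_cong_AE)
    show "(\<lambda>s. indicator {0..0} s *\<^sub>R (norm (\<psi> s))\<^sup>2) \<in> borel_measurable lborel"
      using L2_control_integrable[OF c, of 0 0] 0 by (auto simp: set_integrable_def)
  qed (auto elim: eventually_mono)
  then show ?case by (simp add: energy_def set_lebesgue_integral_def)
next
  case (Suc n)
  have i: "integrable lborel (\<lambda>s. indicator {a..b} s *\<^sub>R (norm (\<psi> s))\<^sup>2)" if "0 \<le> a" "b \<le> T" for a b
    using L2_control_integrable[OF c that] by (simp add: set_integrable_def)
  have "AE s in lborel. s \<noteq> real n" by (rule AE_lborel_singleton)
  then have "AE s in lborel. indicator {0..real n} s *\<^sub>R (norm (\<psi> s))\<^sup>2 + indicator {real n..real (Suc n)} s *\<^sub>R (norm (\<psi> s))\<^sup>2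
      = indicator {0..real (Suc n)} s *\<^sub>R (norm (\<psi> s))\<^sup>2"
    by eventually_elim (auto simp: indicator_def)
  then have "(\<integral>s. indicator {0..real n} s *\<^sub>R (norm (\<psi> s))\<^sup>2 + indicator {real n..real (Suc n)} s *\<^sub>R (norm (\<psi> s))\<^sup>2 \<partial>lborel)
      = (\<integral>s. indicator {0..real (Suc n)} s *\<^sub>R (norm (\<psi> s))\<^sup>2 \<partial>lborel)"
    using i[of 0 "real n"] i[of "real n" "real (Suc n)"] i[of 0 "real (Suc n)"] Suc.prems
    by (intro integral_cong_AE) auto
  then have "energy 0 (real (Suc n)) \<psi> = energy 0 (real n) \<psi> + energy (real n) (real (Suc n)) \<psi>"
    using i[of 0 "real n"] i[of "real n" "real (Suc n)"] Suc.prems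
    by (simp add: energy_def set_lebesgue_integral_def)
  then show ?case using Suc by simp
qed

text \<open>Bounded energy on all windows ending at time 0, with decay at minus infinity left out:
  decay does not pass to locally uniform limits by itself and is recovered in
  \<open>admissible_bounded_decays\<close>.\<close>

definition admissible :: "real \<Rightarrow> (real \<Rightarrow> 'e) \<Rightarrow> bool" where
  "admissible E \<phi> \<longleftrightarrow> continuous_on {..0} \<phi> \<and> (\<forall>T>0. driven T E (\<lambda>s. \<phi> (s - T)))"

lemma K_minf_iff:
  "\<phi> \<in> K_minf S F SQ r \<longleftrightarrow> \<phi> \<in> neg_paths \<and> ((\<lambda>t. norm (\<phi> t)) \<longlongrightarrow> 0) at_bot \<and>
     (\<forall>T>0. action0 S F SQ T (\<lambda>s. \<phi> (s - T)) \<le> ereal r)"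
proof -
  have "action_minf S F SQ \<phi> \<le> ereal r \<longleftrightarrow> (\<forall>t<0. action0 S F SQ (- t) (\<lambda>s. \<phi> (s + t)) \<le> ereal r)"
    by (simp add: action_minf_def action_def SUP_le_iff Ball_def)
  also have "\<dots> \<longleftrightarrow> (\<forall>T>0. action0 S F SQ T (\<lambda>s. \<phi> (s - T)) \<le> ereal r)"
  proof (intro iffI allI impI)
    fix T :: real assume *: "\<forall>t<0. action0 S F SQ (- t) (\<lambda>s. \<phi> (s + t)) \<le> ereal r" "T > 0"
    show "action0 S F SQ T (\<lambda>s. \<phi> (s - T)) \<le> ereal r" using *(1)[rule_format, of "- T"] *(2) by simp
  next
    fix t :: real assume *: "\<forall>T>0. action0 S F SQ T (\<lambda>s. \<phi> (s - T)) \<le> ereal r" "t < 0"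
    show "action0 S F SQ (- t) (\<lambda>s. \<phi> (s + t)) \<le> ereal r" using *(1)[rule_format, of "- t"] *(2) by simp
  qed
  finally show ?thesis by (simp add: K_minf_def)
qed

lemma K_minf_admissible:
  assumes "\<phi> \<in> K_minf S F SQ r" "2 * r < E"
  shows "admissible E \<phi>"
  using assms unfolding K_minf_iff admissible_def neg_paths_def by (auto intro: driven_if_action0_le)

text \<open>Unit intervals are numbered backwards: number \<open>j\<close> is the interval from -(j
  + 1) to -j.\<close>

lemma admissible_unit:
  assumes "admissible E \<phi>"
  shows "driven 1 E (\<lambda>s. \<phi> (s - real (Suc j)))"
proof -
  have "driven (real (Suc j)) E (\<lambda>s. \<phi> (s - real (Suc j)))"
    using assms unfolding admissible_def by (meson of_nat_0_less_iff zero_less_Suc)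
  then show ?thesis by (rule driven_restrict) auto
qed

text \<open>Integer times are handled by the contraction iterated from minus infinity; one further
  partial step reaches \<open>t\<close>.\<close>

lemma unit_growth_iterate:
  assumes growth: "\<And>j t. j \<ge> J \<Longrightarrow> t \<in> {0..1} \<Longrightarrow>
      norm (\<phi> (t - real (Suc j))) \<le> exp (- \<kappa> * t) * norm (\<phi> (- real (Suc j))) + d"
    and B: "\<And>j. norm (\<phi> (- real j)) \<le> B" and t: "t \<le> - real J"
  shows "norm (\<phi> t) \<le> d / (1 - exp (- \<kappa>)) + d"
proof -
  have x: "norm (\<phi> (- real j)) \<le> d / (1 - exp (- \<kappa>))" if "j \<ge> J" for j
  proof (rule contraction_iterate_bound[where x = "\<lambda>j. norm (\<phi> (- real j))"])
    fix j assume "j \<ge> J"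
    then show "norm (\<phi> (- real j)) \<le> exp (- \<kappa>) * norm (\<phi> (- real (Suc j))) + d"
      using growth[of j 1] by simp
  qed (use \<kappa> B that in auto)
  define j where "j = nat \<lfloor>- t\<rfloor>"
  have "- t \<ge> 0" using t by (meson neg_le_0_iff_le of_nat_0_le_iff order_trans neg_0_le_iff_le)
  then have j: "real j \<le> - t" "- t < real j + 1" unfolding j_def by linarith+
  have jJ: "j \<ge> J" unfolding j_def using t by (simp add: le_nat_iff le_floor_iff)
  have s: "t + real (Suc j) \<in> {0..1}" using j by auto
  have "norm (\<phi> t) \<le> exp (- \<kappa> * (t + real (Suc j))) * norm (\<phi> (- real (Suc j))) + d"
    using growth[OF jJ s] by simp
  also have "\<dots> \<le> 1 * norm (\<phi> (- real (Suc j))) + d"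
    using \<kappa> s by (intro add_right_mono mult_right_mono) auto
  also have "\<dots> \<le> d / (1 - exp (- \<kappa>)) + d" using x[of "Suc j"] jJ by simp
  finally show ?thesis .
qed

text \<open>Decay serves to make the values at integer times bounded. That bound depends on the path
  but drops out of \<open>unit_growth_iterate\<close>, so the result depends on E only.\<close>

lemma admissible_uniformly_bounded:
  "\<exists>R. \<forall>\<phi>. admissible E \<phi> \<and> ((\<lambda>t. norm (\<phi> t)) \<longlongrightarrow> 0) at_bot \<longrightarrow> (\<forall>t\<le>0. norm (\<phi> t) \<le> R)"
proof -
  obtain d where d: "\<And>X t. driven 1 E X \<Longrightarrow> t \<in> {0..1} \<Longrightarrow> norm (X t) \<le> exp (- \<kappa> * t) * norm (X 0) + d"
    using unit_growth[of E] by metis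
  have "norm (\<phi> t) \<le> d / (1 - exp (- \<kappa>)) + d"
    if \<phi>: "admissible E \<phi>" "((\<lambda>t. norm (\<phi> t)) \<longlongrightarrow> 0) at_bot" and t: "t \<le> 0" for \<phi> t
  proof -
    have "filterlim (\<lambda>j. - real j) at_bot sequentially"
      using filterlim_real_sequentially by (simp add: filterlim_uminus_at_bot)
    from filterlim_compose[OF \<phi>(2) this] have "(\<lambda>j. norm (\<phi> (- real j))) \<longlonglongrightarrow> 0" .
    then have "Bseq (\<lambda>j. norm (\<phi> (- real j)))" by (intro convergent_imp_Bseq convergentI)
    then obtain B where B: "\<And>j. norm (\<phi> (- real j)) \<le> B" by (auto simp: Bseq_def)
    show ?thesis
    proof (rule unit_growth_iterate[where J = 0 and \<phi> = \<phi> and B = B])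
      fix j t assume "t \<in> {0..1::real}"
      from d[OF admissible_unit[OF \<phi>(1), of j] this]
      show "norm (\<phi> (t - real (Suc j))) \<le> exp (- \<kappa> * t) * norm (\<phi> (- real (Suc j))) + d" by simp
    qed (use t B in simp_all)
  qed
  then show ?thesis by blast
qed

text \<open>Controls on different windows need not agree, so one window containing more than E /
  \<epsilon> bad intervals is fixed together with one control on it. Each bad interval takes at
  least \<epsilon> of its energy.\<close>

lemma finite_energetic_intervals:
  assumes \<phi>: "admissible E \<phi>" and \<epsilon>: "\<epsilon> > 0"
  shows "finite {j. \<not> driven 1 \<epsilon> (\<lambda>s. \<phi> (s - real (Suc j)))}"
proof (rule ccontr)
  let ?bad = "{j. \<not> driven 1 \<epsilon> (\<lambda>s. \<phi> (s - real (Suc j)))}"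
  assume inf: "infinite ?bad"
  obtain N :: nat where N: "E / \<epsilon> < real N" using reals_Archimedean2 by blast
  obtain B where B: "finite B" "card B = N" "B \<subseteq> ?bad" using infinite_arbitrarily_large[OF inf] by blast
  obtain M where M0: "B \<subseteq> {..<M}" using B(1) by (metis finite_nat_iff_bounded)
  define m where "m = Suc M"
  have m: "B \<subseteq> {..<m}" "m > 0" using M0 by (auto simp: m_def)
  define X where "X s = \<phi> (s - real m)" for s
  have "driven (real m) E X" using \<phi> m(2) unfolding admissible_def X_def[abs_def] by simp
  then obtain \<psi> where X: "continuous_on {0..real m} X" and \<psi>: "responds (real m) \<psi> (residual X)"
    "energy 0 (real m) \<psi> \<le> E" unfolding driven_def responses_def by auto
  have c: "L2_control (real m) \<psi>" using \<psi> by (simp add: responds_def)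
  define \<epsilon>' where "\<epsilon>' i = energy (real i) (real (Suc i)) \<psi>" for i
  have bad: "\<epsilon> \<le> \<epsilon>' (m - Suc j)" if j: "j \<in> B" for j
  proof (rule ccontr)
    assume small: "\<not> ?thesis"
    have jm: "j < m" using j m(1) by auto
    \<comment> \<open>Conversion from the backward number of an interval to its starting time in the
      window, which begins at -m.\<close>
    define a where "a = m - Suc j"
    have a: "real a = real m - real (Suc j)" "Suc a \<le> m" using jm by (auto simp: a_def of_nat_diff)
    have am: "real (Suc a) \<le> real m" using a(2) by (simp only: of_nat_le_iff)
    have e: "(\<lambda>s. X (s + real a)) = (\<lambda>s. \<phi> (s - real (Suc j)))" by (simp add: X_def a(1) algebra_simps)
    have "responds 1 (\<lambda>s. \<psi> (s + real a)) (residual (\<lambda>s. X (s + real a)))"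
      "energy 0 1 (\<lambda>s. \<psi> (s + real a)) = energy (real a) (real (Suc a)) \<psi>"
      using responds_shift[OF X \<psi>(1), of "real a" "real (Suc a)"] am by simp_all
    moreover have "continuous_on {0..1} (\<lambda>s. X (s + real a))"
      using am by (intro continuous_on_compose2[OF X] continuous_intros) auto
    ultimately have "driven 1 \<epsilon> (\<lambda>s. X (s + real a))"
      unfolding driven_def responses_def using small by (auto simp: \<epsilon>'_def a_def)
    then show False using j B(3) unfolding e by blast
  qed
  have "real N * \<epsilon> = (\<Sum>j\<in>B. \<epsilon>)" using B by simp
  also have "\<dots> \<le> (\<Sum>j\<in>B. \<epsilon>' (m - Suc j))" by (intro sum_mono bad)
  also have "\<dots> \<le> (\<Sum>j<m. \<epsilon>' (m - Suc j))"
    using m(1) by (intro sum_mono2) (auto simp: \<epsilon>'_def energy_nonneg)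
  also have "\<dots> = (\<Sum>i<m. \<epsilon>' i)" by (rule sum.nat_diff_reindex)
  also have "\<dots> = energy 0 (real m) \<psi>" unfolding \<epsilon>'_def by (rule energy_split[OF c order_refl, symmetric])
  also have "\<dots> \<le> E" by (rule \<psi>(2))
  finally show False using N \<epsilon> by (simp add: field_simps)
qed

text \<open>Before some time every unit interval has energy so low that growth over it is a
  contraction up to \<eta>. Iterating from minus infinity leaves \<eta> / (1 - q) + \<eta>, at most
  half of \<epsilon>.\<close>

lemma admissible_bounded_decays:
  assumes \<phi>: "admissible E \<phi>" and B: "\<And>t. t \<le> 0 \<Longrightarrow> norm (\<phi> t) \<le> B"
  shows "((\<lambda>t. norm (\<phi> t)) \<longlongrightarrow> 0) at_bot"
proof (rule tendstoI)
  fix \<epsilon> :: real assume \<epsilon>: "\<epsilon> > 0"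
  define q where "q = exp (- \<kappa>)"
  have q: "0 < q" "q < 1" using \<kappa> by (auto simp: q_def)
  define \<eta> where "\<eta> = \<epsilon> * (1 - q) / 4"
  have \<eta>: "\<eta> > 0" using \<epsilon> q by (simp add: \<eta>_def)
  have sum: "\<eta> / (1 - q) + \<eta> < \<epsilon>"
  proof -
    have "\<eta> = \<epsilon> / 4 * (1 - q)" by (simp add: \<eta>_def)
    then have "\<eta> / (1 - q) = \<epsilon> / 4" by (subst divide_eq_eq) (use q in simp)
    moreover have "\<eta> \<le> \<epsilon> * 1 / 4" using \<epsilon> q unfolding \<eta>_def by (intro divide_right_mono mult_left_mono) auto
    ultimately show ?thesis using \<epsilon> by simp
  qed
  obtain E' where E': "E' > 0"
    "\<And>X t. driven 1 E' X \<Longrightarrow> t \<in> {0..1} \<Longrightarrow> norm (X t) \<le> exp (- \<kappa> * t) * norm (X 0) + \<eta>"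
    using unit_growth_small[OF \<eta>] by metis
  obtain J where J: "{j. \<not> driven 1 E' (\<lambda>s. \<phi> (s - real (Suc j)))} \<subseteq> {..<J}"
    using finite_energetic_intervals[OF \<phi> E'(1)] by (metis finite_nat_iff_bounded)
  have "norm (\<phi> t) < \<epsilon>" if t: "t \<le> - real J" for t
  proof -
    have "norm (\<phi> t) \<le> \<eta> / (1 - exp (- \<kappa>)) + \<eta>"
    proof (rule unit_growth_iterate[OF _ _ t])
      show "norm (\<phi> (- real j)) \<le> B" for j by (rule B) simp
      fix j t assume j: "j \<ge> J" and t: "t \<in> {0..1::real}"
      have "driven 1 E' (\<lambda>s. \<phi> (s - real (Suc j)))" using J j by (auto simp: subset_iff not_less)
      from E'(2)[OF this t]
      show "norm (\<phi> (t - real (Suc j))) \<le> exp (- \<kappa> * t) * norm (\<phi> (- real (Suc j))) + \<eta>" by simp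
    qed
    then show ?thesis using sum by (simp add: q_def)
  qed
  then show "\<forall>\<^sub>F t in at_bot. dist (norm (\<phi> t)) 0 < \<epsilon>"
    unfolding eventually_at_bot_linorder by (intro exI[of _ "- real J"]) auto
qed

lemma shifted_path_continuous:
  fixes \<phi> :: "real \<Rightarrow> 'e"
  shows "continuous_on {..0} \<phi> \<Longrightarrow> continuous_on {0..T} (\<lambda>s. \<phi> (s - T))"
  by (rule continuous_on_compose2[of "{..0}" \<phi>]) (auto intro!: continuous_on_diff continuous_on_id continuous_on_const)

text \<open>Apply \<open>comparison\<close> to the difference v of the drifts with base path Y.
  Since Y + v differs from X only by the difference of the residuals, the forcing F X - F Y is
  correct up to the modulus of continuity of \<open>F\<close>.\<close>

lemma driven_close:
  assumes X: "continuous_on {0..T} X" and Y: "continuous_on {0..T} Y"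
    and XR: "\<And>s. s \<in> {0..T} \<Longrightarrow> norm (X s) \<le> R" and YR: "\<And>s. s \<in> {0..T} \<Longrightarrow> norm (Y s) \<le> R"
    and z: "\<And>s. s \<in> {0..T} \<Longrightarrow> norm (residual X s - residual Y s) \<le> \<delta>" and \<delta>: "\<delta> \<le> 1"
    and \<rho>: "\<And>a b. norm a \<le> R + 1 \<Longrightarrow> norm b \<le> R + 1 \<Longrightarrow> norm (a - b) \<le> \<delta> \<Longrightarrow> norm (F a - F b) \<le> \<rho>"
    and s: "s \<in> {0..T}"
  shows "norm (X s - Y s) \<le> exp (- \<kappa> * s) * (2 * \<bar>R\<bar>) + \<rho> / \<kappa> + \<delta>"
proof -
  define v where "v s = drift X s - drift Y s" for s
  define f where "f s = F (X s) - F (Y s)" for s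
  have fc: "continuous_on {0..T} f"
    unfolding f_def by (rule continuous_on_diff[OF F_path_continuous[OF X] F_path_continuous[OF Y]])
  have vc: "continuous_on {0..T} v"
    unfolding v_def by (rule continuous_on_diff[OF drift_continuous[OF X] drift_continuous[OF Y]])
  have v: "v s = S s (X 0 - Y 0) + integral {0..s} (\<lambda>r. S (s - r) (f r))" if s: "s \<in> {0..T}" for s
  proof -
    have c: "continuous_on {0..s} (\<lambda>r. S (s - r) (F (W r)))" if "continuous_on {0..T} W" for W
      using s by (intro convolution_continuous F_path_continuous continuous_on_subset[OF that]) auto
    have "integral {0..s} (\<lambda>r. S (s - r) (f r)) =
        integral {0..s} (\<lambda>r. S (s - r) (F (X r))) - integral {0..s} (\<lambda>r. S (s - r) (F (Y r)))"
      unfolding f_def blinfun.diff_right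
      by (rule integral_diff[OF integrable_continuous_interval[OF c[OF X]] integrable_continuous_interval[OF c[OF Y]]])
    then show ?thesis by (simp add: v_def drift_def blinfun.diff_right)
  qed
  have err: "norm (f s - (F (Y s + v s) - F (Y s))) \<le> \<rho>" if s: "s \<in> {0..T}" for s
  proof -
    have e: "Y s + v s = X s - (residual X s - residual Y s)"
      by (simp add: v_def residual_drift)
    have "norm (Y s + v s) \<le> R + 1"
      unfolding e using norm_triangle_ineq4[of "X s" "residual X s - residual Y s"] XR[OF s] z[OF s] \<delta> by linarith
    moreover have "norm (X s) \<le> R + 1" using XR[OF s] by simp
    moreover have "norm (X s - (Y s + v s)) \<le> \<delta>" unfolding e using z[OF s] by simp
    ultimately have "norm (F (X s) - F (Y s + v s)) \<le> \<rho>" by (intro \<rho>)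
    then show ?thesis by (simp add: f_def)
  qed
  have "0 \<in> {0..T}" using s by auto
  then have "norm (X 0 - Y 0) \<le> 2 * \<bar>R\<bar>"
    using norm_triangle_ineq4[of "X 0" "Y 0"] XR[of 0] YR[of 0] by simp
  then have "exp (- \<kappa> * s) * norm (X 0 - Y 0) \<le> exp (- \<kappa> * s) * (2 * \<bar>R\<bar>)"
    by (rule mult_left_mono) simp
  moreover have "norm (v s) \<le> exp (- \<kappa> * s) * norm (X 0 - Y 0) + \<rho> / \<kappa>"
    by (rule comparison[OF fc vc Y v err s])
  moreover have "X s - Y s = v s + (residual X s - residual Y s)" by (simp add: v_def residual_drift)
  then have "norm (X s - Y s) \<le> norm (v s) + norm (residual X s - residual Y s)"
    by (simp only: norm_triangle_ineq)
  ultimately show ?thesis using z[OF s] by linarith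
qed

text \<open>Paths are coloured by their residuals on an interval starting so early that the
  uncontrolled initial values are forgotten by time -m. One third of \<epsilon> each goes to the
  initial value, the forcing and the residuals.\<close>

lemma admissible_totally_bounded:
  assumes bounded: "\<And>\<phi> t. \<phi> \<in> \<K> \<Longrightarrow> t \<le> 0 \<Longrightarrow> norm (\<phi> t) \<le> R"
    and adm: "\<And>\<phi>. \<phi> \<in> \<K> \<Longrightarrow> admissible E \<phi>" and E: "E \<ge> 0" and m: "m > 0" and \<epsilon>: "\<epsilon> > 0"
  shows "\<exists>c :: (real \<Rightarrow> 'e) \<Rightarrow> nat. finite (c ` \<K>) \<and>
    (\<forall>\<phi>\<in>\<K>. \<forall>\<eta>\<in>\<K>. c \<phi> = c \<eta> \<longrightarrow> (\<forall>t\<in>{-m..0}. dist (\<phi> t) (\<eta> t) \<le> \<epsilon>))"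
proof -
  \<comment> \<open>From exp (\<kappa> * t) >= \<kappa> * t: after this time the initial difference,
    at most 2 * |R|, has decayed below a third of \<epsilon>.\<close>
  define T0 where "T0 = 6 * (\<bar>R\<bar> + 1) / (\<kappa> * \<epsilon>)"
  have T0: "exp (- \<kappa> * t) * (2 * \<bar>R\<bar>) < \<epsilon> / 3" if t: "t \<ge> T0" for t
  proof -
    have "6 * (\<bar>R\<bar> + 1) / \<epsilon> = \<kappa> * T0" using \<kappa> by (simp add: T0_def)
    also have "\<dots> \<le> \<kappa> * t" using t \<kappa> by (intro mult_left_mono) auto
    also have "\<dots> \<le> exp (\<kappa> * t)" using exp_ge_add_one_self[of "\<kappa> * t"] by linarith
    finally have "\<epsilon> / 3 * (6 * (\<bar>R\<bar> + 1) / \<epsilon>) \<le> \<epsilon> / 3 * exp (\<kappa> * t)" using \<epsilon> by (intro mult_left_mono) auto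
    moreover have "\<epsilon> / 3 * (6 * (\<bar>R\<bar> + 1) / \<epsilon>) = 2 * \<bar>R\<bar> + 2" using \<epsilon> by simp
    ultimately have "2 * \<bar>R\<bar> < \<epsilon> / 3 * exp (\<kappa> * t)" by linarith
    then have "exp (- \<kappa> * t) * (2 * \<bar>R\<bar>) < exp (- \<kappa> * t) * (\<epsilon> / 3 * exp (\<kappa> * t))"
      by (rule mult_strict_left_mono) simp
    also have "\<dots> = \<epsilon> / 3" by (simp add: exp_minus)
    finally show ?thesis .
  qed
  define T where "T = m + \<bar>T0\<bar>"
  have T: "T > 0" "T - m \<ge> T0" using m by (auto simp: T_def)
  define \<rho> where "\<rho> = \<kappa> * (\<epsilon> / 3)"
  have \<rho>: "\<rho> > 0" using \<kappa> \<epsilon> by (simp add: \<rho>_def)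
  have "uniformly_continuous_on (cball 0 (R + 1)) F" by (rule F_uniform) simp
  then obtain d where d: "d > 0" "\<forall>a\<in>cball 0 (R + 1). \<forall>b\<in>cball 0 (R + 1). dist b a < d \<longrightarrow> dist (F b) (F a) < \<rho>"
    unfolding uniformly_continuous_on_def using \<rho> by blast
  define \<delta> where "\<delta> = min (d / 2) (min 1 (\<epsilon> / 3))"
  have \<delta>: "\<delta> > 0" "\<delta> < d" "\<delta> \<le> 1" "\<delta> \<le> \<epsilon> / 3" using d(1) \<epsilon> by (auto simp: \<delta>_def min_def)
  obtain k :: "(real \<Rightarrow> 'e) \<Rightarrow> nat" where k: "finite (k ` responses T E)"
    "\<forall>z\<in>responses T E. \<forall>z'\<in>responses T E. k z = k z' \<longrightarrow> (\<forall>t\<in>{0..T}. norm (z t - z' t) \<le> \<delta>)"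
    using responses_totally_bounded[OF T(1) E \<delta>(1)] by (elim exE conjE)
  define X where "X \<phi> s = \<phi> (s - T)" for \<phi> :: "real \<Rightarrow> 'e" and s
  define c where "c \<phi> = k (residual (X \<phi>))" for \<phi>
  have X: "continuous_on {0..T} (X \<phi>)" "residual (X \<phi>) \<in> responses T E" if "\<phi> \<in> \<K>" for \<phi>
    using adm[OF that] T(1) by (auto simp: admissible_def driven_def X_def[abs_def])
  have XR: "norm (X \<phi> t) \<le> R" if "\<phi> \<in> \<K>" "t \<in> {0..T}" for \<phi> t
    unfolding X_def using that by (intro bounded) auto
  have "c ` \<K> \<subseteq> k ` responses T E" using X(2) by (auto simp: c_def)
  then have fin: "finite (c ` \<K>)" using k(1) by (rule finite_subset)
  have close: "dist (\<phi> t) (\<eta> t) \<le> \<epsilon>" if \<phi>: "\<phi> \<in> \<K>" and \<eta>: "\<eta> \<in> \<K>" and same: "c \<phi> = c \<eta>" and t: "t \<in> {-m..0}" for \<phi> \<eta> t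
  proof -
    have z: "norm (residual (X \<phi>) s - residual (X \<eta>) s) \<le> \<delta>" if "s \<in> {0..T}" for s
      using k(2)[rule_format, OF X(2)[OF \<phi>] X(2)[OF \<eta>] same[unfolded c_def] that] .
    define s where "s = t + T"
    have s: "s \<in> {0..T}" "s \<ge> T0" using t T m by (auto simp: s_def T_def)
    have "norm (X \<phi> s - X \<eta> s) \<le> exp (- \<kappa> * s) * (2 * \<bar>R\<bar>) + \<rho> / \<kappa> + \<delta>"
    proof (rule driven_close[OF X(1)[OF \<phi>] X(1)[OF \<eta>] XR[OF \<phi>] XR[OF \<eta>] z \<delta>(3) _ s(1)])
      fix a b :: 'e assume "norm a \<le> R + 1" "norm b \<le> R + 1" "norm (a - b) \<le> \<delta>"
      then have "dist (F a) (F b) < \<rho>" using d(2) \<delta>(2) by (simp add: dist_norm)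
      then show "norm (F a - F b) \<le> \<rho>" by (simp add: dist_norm)
    qed
    moreover have "\<rho> / \<kappa> = \<epsilon> / 3" using \<kappa> by (simp add: \<rho>_def)
    moreover have "X \<phi> s - X \<eta> s = \<phi> t - \<eta> t" by (simp add: X_def s_def)
    ultimately show ?thesis using T0[OF s(2)] \<delta>(4) by (simp add: dist_norm)
  qed
  show ?thesis
  proof (intro exI[of _ c] conjI fin ballI impI)
    fix \<phi> \<eta> t assume "\<phi> \<in> \<K>" "\<eta> \<in> \<K>" "c \<phi> = c \<eta>" "t \<in> {-m..0}"
    then show "dist (\<phi> t) (\<eta> t) \<le> \<epsilon>" by (rule close)
  qed
qed

text \<open>The residual depends continuously on the path in the uniform norm, so closedness of
  paths reduces to that of responses.\<close>

lemma driven_closed: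
  assumes T: "T > 0" and X: "continuous_on {0..T} X"
    and approx: "\<And>\<delta>. \<delta> > 0 \<Longrightarrow> \<exists>X'. driven T (E + \<delta>) X' \<and> (\<forall>t\<in>{0..T}. norm (X' t - X t) \<le> \<delta>)"
  shows "driven T E X"
proof -
  have "residual X \<in> responses T E"
  proof (rule responses_closed[OF T])
    fix \<delta> :: real assume \<delta>: "\<delta> > 0"
    have "\<exists>R. \<forall>t\<in>{0..T}. norm (X t) \<le> R"
      using compact_imp_bounded[OF compact_continuous_image[OF X compact_Icc]] by (auto simp: bounded_iff)
    then obtain R where R: "\<And>t. t \<in> {0..T} \<Longrightarrow> norm (X t) \<le> R" by metis
    define \<rho> where "\<rho> = \<delta> / (4 * (C * T + 1))"
    have CT: "C * T \<ge> 0" using C_nonneg T by simp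
    have \<rho>: "\<rho> > 0" "(C * \<rho>) * T \<le> \<delta> / 4" using \<delta> CT by (auto simp: \<rho>_def field_simps)
    have "uniformly_continuous_on (cball 0 (R + 1)) F" by (rule F_uniform) simp
    then obtain d where d: "d > 0" "\<forall>a\<in>cball 0 (R + 1). \<forall>b\<in>cball 0 (R + 1). dist b a < d \<longrightarrow> dist (F b) (F a) < \<rho>"
      unfolding uniformly_continuous_on_def using \<rho> by blast
    \<comment> \<open>The bounds d / 2 and 1 serve the modulus of \<open>F\<close> on the larger
      ball, \<delta> the energy, and the last one the path together with its initial value moved by
      \<open>S\<close>.\<close>
    define \<eta> where "\<eta> = min (min (d / 2) 1) (min \<delta> (\<delta> / (4 * (C + 1))))"
    have \<eta>: "\<eta> > 0" "\<eta> \<le> d / 2" "\<eta> \<le> 1" "\<eta> \<le> \<delta>" "\<eta> \<le> \<delta> / (4 * (C + 1))"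
      unfolding \<eta>_def min_le_iff_disj using d(1) \<delta> C_nonneg by simp_all
    have \<eta>C: "(C + 1) * \<eta> \<le> \<delta> / 4" using \<eta>(5) C_nonneg by (simp add: field_simps)
    obtain X' where X': "driven T (E + \<eta>) X'" "\<And>t. t \<in> {0..T} \<Longrightarrow> norm (X' t - X t) \<le> \<eta>" using approx[OF \<eta>(1)] by blast
    have X'c: "continuous_on {0..T} X'" using X'(1) by (simp add: driven_def)
    have "norm (residual X' t - residual X t) \<le> \<delta>" if t: "t \<in> {0..T}" for t
    proof -
      have cc: "continuous_on {0..t} (\<lambda>s. S (t - s) (F (Y s)))" if "continuous_on {0..T} Y" for Y
        using t by (intro convolution_continuous F_path_continuous continuous_on_subset[OF that]) auto
      have "integral {0..t} (\<lambda>s. S (t - s) (F (X' s))) - integral {0..t} (\<lambda>s. S (t - s) (F (X s))) =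
          integral {0..t} (\<lambda>s. S (t - s) (F (X' s)) - S (t - s) (F (X s)))"
        by (rule integral_diff[symmetric]) (intro integrable_continuous_interval cc X X'c)+
      also have "norm \<dots> \<le> (C * \<rho>) * (t - 0)"
      proof (rule integral_bound)
        show "continuous_on {0..t} (\<lambda>s. S (t - s) (F (X' s)) - S (t - s) (F (X s)))"
          by (intro continuous_intros cc X X'c)
        fix s assume s: "s \<in> {0..t}"
        then have sT: "s \<in> {0..T}" using t by auto
        have "norm (X' s) \<le> R + 1" using X'(2)[OF sT] R[OF sT] \<eta>(3) norm_triangle_ineq[of "X s" "X' s - X s"] by simp
        moreover have "norm (X s) \<le> R + 1" using R[OF sT] by simp
        moreover have "dist (X' s) (X s) < d" using X'(2)[OF sT] \<eta>(2) d(1) by (simp add: dist_norm)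
        ultimately have "dist (F (X' s)) (F (X s)) < \<rho>" using d(2) by simp
        then have "norm (F (X' s) - F (X s)) \<le> \<rho>" by (simp add: dist_norm)
        then have "C * norm (F (X' s) - F (X s)) \<le> C * \<rho>" using C_nonneg by (rule mult_left_mono)
        then show "norm (S (t - s) (F (X' s)) - S (t - s) (F (X s))) \<le> C * \<rho>"
          using norm_S_le[of "t - s" "F (X' s) - F (X s)"] s by (simp add: blinfun.diff_right)
      qed (use t in auto)
      also have "(C * \<rho>) * (t - 0) \<le> (C * \<rho>) * T" using t C_nonneg \<rho>(1) by (intro mult_left_mono) auto
      finally have 1: "norm (integral {0..t} (\<lambda>s. S (t - s) (F (X' s))) - integral {0..t} (\<lambda>s. S (t - s) (F (X s)))) \<le> \<delta> / 4"
        using \<rho>(2) by linarith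
      have "norm (S t (X' 0 - X 0)) \<le> C * \<eta>"
        using norm_S_le[of t "X' 0 - X 0"] mult_left_mono[OF X'(2)[of 0] C_nonneg] t by simp
      moreover have "residual X' t - residual X t = ((X' t - X t) - S t (X' 0 - X 0)) -
          (integral {0..t} (\<lambda>s. S (t - s) (F (X' s))) - integral {0..t} (\<lambda>s. S (t - s) (F (X s))))"
        by (simp add: residual_def blinfun.diff_right)
      then have "norm (residual X' t - residual X t) \<le> norm ((X' t - X t) - S t (X' 0 - X 0)) +
          norm (integral {0..t} (\<lambda>s. S (t - s) (F (X' s))) - integral {0..t} (\<lambda>s. S (t - s) (F (X s))))"
        by (simp only: norm_triangle_ineq4)
      moreover have "norm ((X' t - X t) - S t (X' 0 - X 0)) \<le> norm (X' t - X t) + norm (S t (X' 0 - X 0))"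
        by (rule norm_triangle_ineq4)
      moreover have "(C + 1) * \<eta> = C * \<eta> + \<eta>" by (simp add: algebra_simps)
      ultimately show ?thesis using X'(2)[OF t] 1 \<eta>C \<delta> by linarith
    qed
    moreover have "residual X' \<in> responses T (E + \<delta>)"
      using X'(1) \<eta>(4) by (auto simp: driven_def intro: responses_mono)
    ultimately show "\<exists>z\<in>responses T (E + \<delta>). \<forall>t\<in>{0..T}. norm (z t - residual X t) \<le> \<delta>" by blast
  qed
  then show ?thesis using X by (simp add: driven_def)
qed

lemma K_minf_compact: "compactin local_uniform_topology (K_minf S F SQ r)"
proof -
  \<comment> \<open>Some nonnegative level strictly above 2 * r, for the uniform bound and total
    boundedness. Closedness below needs the exact level and approaches it through 2 * r +
    \<delta>.\<close>
  define E where "E = max (2 * r + 1) 0"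
  have E: "E \<ge> 0" "2 * r < E" by (auto simp: E_def)
  obtain R where R: "\<And>\<phi> t. admissible E \<phi> \<Longrightarrow> ((\<lambda>t. norm (\<phi> t)) \<longlongrightarrow> 0) at_bot \<Longrightarrow> t \<le> 0 \<Longrightarrow> norm (\<phi> t) \<le> R"
    using admissible_uniformly_bounded[of E] by metis
  have KR: "norm (\<phi> t) \<le> R" if "\<phi> \<in> K_minf S F SQ r" "t \<le> 0" for \<phi> t
    using R[OF K_minf_admissible[OF that(1) E(2)]] that by (auto simp: K_minf_iff)
  show ?thesis
  proof (rule compactin_local_uniform_topologyI)
    show "K_minf S F SQ r \<subseteq> neg_paths" by (auto simp: K_minf_iff)
    fix m \<epsilon> :: real assume "m > 0" "\<epsilon> > 0"
    then show "\<exists>c :: (real \<Rightarrow> 'e) \<Rightarrow> nat. finite (c ` K_minf S F SQ r) \<and> (\<forall>\<phi>\<in>K_minf S F SQ r. \<forall>\<eta>\<in>K_minf S F SQ r.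
        c \<phi> = c \<eta> \<longrightarrow> (\<forall>t\<in>{-m..0}. dist (\<phi> t) (\<eta> t) \<le> \<epsilon>))"
      by (intro admissible_totally_bounded[where R = R and E = E] KR E(1) K_minf_admissible[OF _ E(2)])
  next
    fix f :: "nat \<Rightarrow> real \<Rightarrow> 'e" and \<phi>
    assume f: "\<And>n. f n \<in> K_minf S F SQ r" and \<phi>: "\<phi> \<in> neg_paths"
      and lim: "\<And>m \<epsilon>. m > 0 \<Longrightarrow> \<epsilon> > 0 \<Longrightarrow> \<exists>n. \<forall>t\<in>{-m..0}. dist (f n t) (\<phi> t) \<le> \<epsilon>"
    have \<phi>c: "continuous_on {..0} \<phi>" using \<phi> by (simp add: neg_paths_def)
    have driven: "driven T (2 * r) (\<lambda>s. \<phi> (s - T))" if T: "T > 0" for T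
    proof (rule driven_closed[OF T shifted_path_continuous[OF \<phi>c]])
      fix \<delta> :: real assume \<delta>: "\<delta> > 0"
      obtain n where n: "\<forall>t\<in>{-T..0}. dist (f n t) (\<phi> t) \<le> \<delta>" using lim[OF T \<delta>] by blast
      have "driven T (2 * r + \<delta>) (\<lambda>s. f n (s - T))"
        using K_minf_admissible[OF f, of "2 * r + \<delta>" n] \<delta> T by (simp add: admissible_def)
      moreover have "norm (f n (t - T) - \<phi> (t - T)) \<le> \<delta>" if "t \<in> {0..T}" for t
        using n that by (auto simp: dist_norm)
      ultimately show "\<exists>X'. driven T (2 * r + \<delta>) X' \<and> (\<forall>t\<in>{0..T}. norm (X' t - \<phi> (t - T)) \<le> \<delta>)"
        by (intro exI[of _ "\<lambda>s. f n (s - T)"]) simp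
    qed
    have "norm (\<phi> t) \<le> R + 1" if t: "t \<le> 0" for t
    proof -
      obtain n where "\<forall>s\<in>{-(1 - t)..0}. dist (f n s) (\<phi> s) \<le> 1" using lim[of "1 - t" 1] t by auto
      then have "norm (f n t - \<phi> t) \<le> 1" using t by (simp add: dist_norm)
      then show ?thesis using KR[OF f t, of n] norm_triangle_ineq4[of "f n t" "f n t - \<phi> t"] by simp
    qed
    moreover have "admissible (2 * r) \<phi>" using driven \<phi>c by (simp add: admissible_def)
    ultimately have "((\<lambda>t. norm (\<phi> t)) \<longlongrightarrow> 0) at_bot" by (intro admissible_bounded_decays) auto
    then show "\<phi> \<in> K_minf S F SQ r"
      using \<phi> driven by (auto simp: K_minf_iff intro: action0_le_if_driven)
  qed
qed

end

theorem theorem4p7: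
  fixes S :: "real \<Rightarrow> 'e::banach \<Rightarrow>\<^sub>L 'e"
    and D :: "'e set" and A :: "'e \<Rightarrow> 'e"
    and SQ :: "real \<Rightarrow> 'h::{real_inner, complete_space, second_countable_topology} \<Rightarrow>\<^sub>L 'e"
    and F :: "'e \<Rightarrow> 'e"
    and M :: "'w measure"
    and K :: "nat set" and e :: "nat \<Rightarrow> 'h" and \<beta> :: "nat \<Rightarrow> real \<Rightarrow> 'w \<Rightarrow> real"
    and Z :: "real \<Rightarrow> 'w \<Rightarrow> 'e"
    and C \<omega> \<kappa> r :: real
  assumes semigroup: "c0_semigroup S"
    and generator: "is_generator S D A"
    and stable: "C \<ge> 1" "\<omega> > 0" "\<And>t. t \<ge> 0 \<Longrightarrow> norm (S t) \<le> C * exp (- \<omega> * t)"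
    and SQ: "\<And>s t. s \<ge> 0 \<Longrightarrow> t > 0 \<Longrightarrow> S s o\<^sub>L SQ t = SQ (s + t)"
    and prob: "prob_space M"
    and wiener: "cylindrical_wiener M K e \<beta>"
    and convolution: "\<And>t. t > 0 \<Longrightarrow> stochastic_convolution M K e \<beta> SQ t (Z t)"
    and gaussian: "\<And>t. t > 0 \<Longrightarrow> gaussian_rv M (Z t)"
    and F_cont: "\<And>B. bounded B \<Longrightarrow> uniformly_continuous_on B F"
    and F_zero: "F 0 = 0"
    and dissipative: "\<kappa> > 0"
      "\<And>x y. x \<in> D \<Longrightarrow> y \<in> D \<Longrightarrow>
         \<exists>xs \<in> norm_subdiff (x - y).
           blinfun_apply xs (A (x - y) + F x - F y) \<le> - \<kappa> * norm (x - y)"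
  shows "compactin local_uniform_topology (K_minf S F SQ r)"
proof -
  have bound: "norm (S t) \<le> C" if "t \<ge> 0" for t
  proof -
    have "norm (S t) \<le> C * exp (- \<omega> * t)" by (rule stable(3)[OF that])
    also have "\<dots> \<le> C * 1" using stable(1,2) that by (intro mult_left_mono) auto
    finally show ?thesis by simp
  qed
  \<comment> \<open>This comes before the noise because \<open>dissipative_norming\<close> supplies
    the norming property required there.\<close>
  interpret dissipative_semigroup S C D A F \<kappa>
    by unfold_locales (fact semigroup bound generator F_cont F_zero dissipative)+
  interpret noise_semigroup S C SQ K e
    by unfold_locales (use SQ wiener in \<open>auto simp: cylindrical_wiener_def\<close>)
  interpret noise_system S C SQ K e
    by (rule noise_systemI[OF prob wiener convolution gaussian dissipative_norming])
  interpret controlled_system S C SQ K e D A F \<kappa> ..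
  show ?thesis by (rule K_minf_compact)
qed

end
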